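(* Let $K\in\{-1,0,1\}$, $c_1,c_2\in\mathbb{R}$, $\varepsilon>0$, and let $v\in C^2(\overline{D_\varepsilon^+}\setminus\{0\})$ solve $$\Delta v+2Ke^v=0\text{ in }D_\varepsilon^+,\qquad \frac{\partial v}{\partial t}=c_1e^{v/2}\text{ on }I_\varepsilon^+,\qquad \frac{\partial v}{\partial t}=c_2e^{v/2}\text{ on }I_\varepsilon^-,$$ and assume $\int_{D_\varepsilon^+}e^v<\infty$. Then a developing map $g$ of $v$ has one of the forms $g(z)=\psi(z^\gamma F(z))$ with $\gamma\in[0,1)$, $F$ meromorphic on $D_\varepsilon^*$ and real (or $\infty$) on $\mathbb{R}\cap D_\varepsilon^*$, or $g(z)=\psi(F(z)+\log z)$ with $F$ meromorphic on $D_\varepsilon^*$ and real (or $\infty$) on $\mathbb{R}\cap D_\varepsilon^*$, where $\psi$ is a Möbius transformation; and in either case $F$ does not have an essential singularity at the origin. In particular, $g$ extends continuously to the origin, and the Schwarzian map $Q$ of $v$ (extended to $D_\varepsilon^*$) has at most a pole of order two at $0$.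
   Context: Identify $\mathbb{R}^2\equiv\mathbb{C}$, $z=s+it$. $D_\varepsilon^+=\{|z|<\varepsilon,\ \mathrm{Im} z>0\}$, $D_\varepsilon^*=\{0<|z|<\varepsilon\}$, $I_\varepsilon^\pm=\{(s,0):0<\pm s<\varepsilon\}$. On the closed upper half-plane minus $0$, $\log z=\ln|z|+i\arg z$, $\arg z\in[0,\pi]$, $z^\gamma=e^{\gamma\log z}$. A developing map of $v$ is a locally univalent meromorphic function $g$ (holomorphic with $1+K|g|^2>0$ if $K\le0$) with $v=\log\frac{4|g'|^2}{(1+K|g|^2)^2}$; it is unique up to Möbius transformations of the form $g\mapsto\frac{\alpha g-\bar\beta}{K\beta g+\bar\alpha}$, $|\alpha|^2+K|\beta|^2=1$. The Schwarzian map of $v$ is $Q=v_{zz}-\frac12 v_z^2$ (with $v_z=(v_s-iv_t)/2$), which equals the Schwarzian derivative $\{g,z\}=(g''/g')'-\frac12(g''/g')^2$; it is holomorphic on $D_\varepsilon^+$, real on the boundary segments, and extends holomorphically to $D_\varepsilon^*$ by $Q(\bar z)=\overline{Q(z)}$. *)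

theory Defs
  imports "HOL-Complex_Analysis.Complex_Analysis"
begin

definition Dplus :: "real \<Rightarrow> complex set" where
  "Dplus \<epsilon> = {z. cmod z < \<epsilon> \<and> Im z > 0}"

definition Dstar :: "real \<Rightarrow> complex set" where
  "Dstar \<epsilon> = {z. 0 < cmod z \<and> cmod z < \<epsilon>}"

definition Dplus_closed_punct :: "real \<Rightarrow> complex set" where
  "Dplus_closed_punct \<epsilon> = closure (Dplus \<epsilon>) - {0}"

definition mobius :: "complex \<Rightarrow> complex \<Rightarrow> complex \<Rightarrow> complex \<Rightarrow> complex \<Rightarrow> complex" where
  "mobius a b c d w = (a * w + b) / (c * w + d)"

definition is_mobius :: "(complex \<Rightarrow> complex) \<Rightarrow> bool" where
  "is_mobius \<psi> \<longleftrightarrow> (\<exists>a b c d. a * d - b * c \<noteq> 0 \<and> \<psi> = mobius a b c d)"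

text \<open>Developing map of v on the open set U (for curvature K):
  a locally univalent meromorphic function (holomorphic with 1 + K|g|^2 > 0 if K \<le> 0)
  with v = log (4|g'|^2 / (1 + K |g|^2)^2) (away from the isolated poles of g;
  at poles the identity holds by continuity).\<close>
definition developing_map :: "real \<Rightarrow> complex set \<Rightarrow> (complex \<Rightarrow> real) \<Rightarrow> (complex \<Rightarrow> complex) \<Rightarrow> bool" where
  "developing_map K U v g \<longleftrightarrow>
     g nicely_meromorphic_on U
   \<and> (\<forall>z\<in>U. \<not> is_pole g z \<longrightarrow> deriv g z \<noteq> 0)
   \<and> (\<forall>z\<in>U. is_pole g z \<longrightarrow> zorder g z = -1)
   \<and> (K \<le> 0 \<longrightarrow> g holomorphic_on U \<and> (\<forall>z\<in>U. 1 + K * (cmod (g z))\<^sup>2 > 0))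
   \<and> (\<forall>z\<in>U. \<not> is_pole g z \<longrightarrow>
        v z = ln (4 * (cmod (deriv g z))\<^sup>2 / (1 + K * (cmod (g z))\<^sup>2)\<^sup>2))"

text \<open>Schwarzian map Q = v_zz - v_z^2/2 with v_z = (v_s - i v_t)/2 and
  v_zz = (v_ss - i v_st - i v_ts - v_tt)/4, in terms of the partial derivatives.\<close>
definition schwarzian_map :: "(complex \<Rightarrow> real) \<Rightarrow> (complex \<Rightarrow> real) \<Rightarrow> (complex \<Rightarrow> real) \<Rightarrow>
    (complex \<Rightarrow> real) \<Rightarrow> (complex \<Rightarrow> real) \<Rightarrow> (complex \<Rightarrow> real) \<Rightarrow> complex \<Rightarrow> complex" where
  "schwarzian_map vs vt vss vst vts vtt z =
     (complex_of_real (vss z) - \<i> * vst z - \<i> * vts z - vtt z) / 4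
     - ((complex_of_real (vs z) - \<i> * vt z) / 2)\<^sup>2 / 2"

end

theory Submission
  imports Defs
begin

text \<open>
  The boundary conditions make the Schwarzian map real on both segments, so that it extends to the
  punctured disc by reflection. In the coordinate \<open>\<zeta> = log z\<close> the developing map is a quotient of two
  solutions of \<open>y'' = R y\<close> on a left half plane, with \<open>R\<close> real on the real axis and \<open>2 \<pi> \<i>\<close>-periodic.

  Finiteness of the integral bounds the spherical area of this quotient. As small area
  controls the spherical derivative, the quotient becomes almost constant on far vertical segments.
  Hence the real lines of the two reflections have a common point, taken to be infinity, and it
  is fixed by the monodromy. This excludes hyperbolic monodromy and leaves a quotient \<open>u / v\<close> of solutions that
  tends to infinity at the puncture and is multiplied by a number of modulus one, or increased
  by \<open>2 \<pi> \<i>\<close>, along one turn.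

  Then \<open>u\<close> has no zeros near the puncture, and Harnack's inequality for \<open>log |u|\<close> shows that \<open>u\<close> and \<open>v\<close> are
  bounded by a power of \<open>1 / |z|\<close>. So the single-valued functions built from them have no essential
  singularity, and neither has the Schwarzian, which has a pole of order at most two because
  \<open>R = q' + q\<^sup>2\<close> for the logarithmic derivative \<open>q\<close> of \<open>v\<close>.
\<close>

section \<open>Linear differential equations of second order\<close>

text \<open>All estimates concern pairs of solutions instead of their quotient. For constant
  Wronskian w the spherical derivative of u / v is |w| / (|u|^2 + |v|^2), a formula without poles,
  so it is small exactly where |u|^2 + |v|^2 is large. Linear changes of the pair alter this sum by
  bounded factors only; in this way the area of the half disc controls that of a sector in which
  discs around boundary points fit.

  Reflection turns one circuit into its inverse, so the matrix T of a circuit in a real basis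
  satisfies T * conj T = 1. Once T is triangular, its diagonal entries have modulus one.
  Triangularity is not algebraic; it comes from a limit value of u / v.

  The delicate case is trivial monodromy. Then the circuit fixes every value, algebra singles out
  none, and small oscillation alone would allow a slow drift of u / v along the real line. A mean
  over vertical segments that stays constant forbids this.

  The equation itself gives no growth bound, since its coefficient might still have an essential
  singularity. The positivity of log |u|, with the known behaviour of u along a circuit, takes its
  place.\<close>

definition ode_sol :: "(complex \<Rightarrow> complex) \<Rightarrow> complex set \<Rightarrow> (complex \<Rightarrow> complex) \<Rightarrow> bool" where
  "ode_sol R S y \<longleftrightarrow> y holomorphic_on S \<and> (\<forall>z\<in>S. deriv (deriv y) z = R z * y z)"

text \<open>With this sign \<open>v / u\<close> has the derivative
  \<open>wronskian u v / u^2\<close>. Its norm divided by |u|^2 + |v|^2 is therefore the spherical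
  derivative of the quotient, also at poles.\<close>

definition wronskian :: "(complex \<Rightarrow> complex) \<Rightarrow> (complex \<Rightarrow> complex) \<Rightarrow> complex \<Rightarrow> complex" where
  "wronskian u v z = u z * deriv v z - deriv u z * v z"

text \<open>Integrating the bound along the segment raises the exponent by one and divides by the
  new exponent, which produces the factorials of a Picard iteration. The case \<open>n = 0\<close>
  is the mean value inequality.\<close>

lemma segment_power_bound:
  fixes G f :: "complex \<Rightarrow> complex" and B :: real
  assumes der: "\<And>w. w \<in> closed_segment a z \<Longrightarrow> (G has_field_derivative f w) (at w)"
    and bd: "\<And>w. w \<in> closed_segment a z \<Longrightarrow> norm (f w) \<le> B * norm (w - a) ^ n"
  shows "norm (G z - G a) \<le> B * norm (z - a) ^ Suc n / Suc n"
proof -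
  define p where "p t = a + of_real t * (z - a)" for t :: real
  have p_seg: "p t \<in> closed_segment a z" if "t \<in> {0..1}" for t
    using that unfolding p_def closed_segment_def
    by (auto intro!: exI[of _ t] simp: algebra_simps scaleR_conv_of_real)
  have dG: "((\<lambda>t. G (p t)) has_vector_derivative (z - a) * f (p t)) (at t)"
    if "t \<in> {0..1}" for t
  proof -
    have "(p has_vector_derivative (z - a)) (at t)"
      unfolding p_def by (auto intro!: derivative_eq_intros)
    from field_vector_diff_chain_at[OF this der[OF p_seg[OF that]]]
    show ?thesis by (simp add: o_def)
  qed
  have "norm (G (p 1) - G (p 0)) \<le>
      B * norm (z - a) ^ Suc n / Suc n * 1 ^ Suc n - B * norm (z - a) ^ Suc n / Suc n * 0 ^ Suc n"
  proof (rule differentiable_bound_general[where f' = "\<lambda>t. (z - a) * f (p t)"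
        and \<phi> = "\<lambda>t. B * norm (z - a) ^ Suc n / Suc n * t ^ Suc n"
        and \<phi>' = "\<lambda>t. B * norm (z - a) ^ Suc n * t ^ n"])
    show "continuous_on {0..1} (\<lambda>t. G (p t))"
      by (intro continuous_at_imp_continuous_on ballI)
        (metis dG has_vector_derivative_continuous)
    fix t :: real assume t: "0 < t" "t < 1"
    show "((\<lambda>t. G (p t)) has_vector_derivative (z - a) * f (p t)) (at t)"
      using t by (intro dG) auto
    show "((\<lambda>t. B * norm (z - a) ^ Suc n / Suc n * t ^ Suc n) has_vector_derivative
        B * norm (z - a) ^ Suc n * t ^ n) (at t)"
      unfolding has_real_derivative_iff_has_vector_derivative[symmetric]
      by (rule derivative_eq_intros refl | simp)+
    have "norm (p t - a) = t * norm (z - a)"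
      using t by (simp add: p_def norm_mult)
    then have "norm (f (p t)) \<le> B * (t * norm (z - a)) ^ n"
      using bd[OF p_seg[of t]] t by auto
    then show "norm ((z - a) * f (p t)) \<le> B * norm (z - a) ^ Suc n * t ^ n"
      using mult_left_mono[of "norm (f (p t))" "B * (t * norm (z - a)) ^ n" "norm (z - a)"]
      by (simp add: norm_mult power_mult_distrib mult_ac)
  qed (auto intro!: continuous_intros)
  then show ?thesis by (simp add: p_def)
qed

text \<open>Picard iteration: the solution is the sum of the iterates of the operator "twofold
  primitive of R f", applied to the affine function with the prescribed value and slope. Convexity
  supplies the primitives and the segments along which they are estimated.\<close>

lemma ode_sol_exists:
  assumes S: "convex S" "open S" "a \<in> S" and R: "R holomorphic_on S"
  obtains y where "ode_sol R S y" "y a = \<alpha>" "deriv y a = \<beta>"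
proof -
  \<comment> \<open>Choosing a primitive vanishing at \<open>a\<close> for all holomorphic functions
    at once makes integration an operator \<open>J\<close> that can be iterated.\<close>
  have "\<forall>f. \<exists>g. f holomorphic_on S \<longrightarrow> (\<forall>z\<in>S. (g has_field_derivative f z) (at z)) \<and> g a = 0"
  proof (intro allI)
    fix f
    show "\<exists>g. f holomorphic_on S \<longrightarrow> (\<forall>z\<in>S. (g has_field_derivative f z) (at z)) \<and> g a = 0"
    proof (cases "f holomorphic_on S")
      case True
      obtain g where g: "\<And>x. x \<in> S \<Longrightarrow> (g has_field_derivative f x) (at x within S)"
        using holomorphic_convex_primitive'[OF S(1,2) True] by blast
      then have "\<forall>z\<in>S. ((\<lambda>z. g z - g a) has_field_derivative f z) (at z)"
        using DERIV_diff[OF _ DERIV_const[of "g a"]] at_within_open[OF _ S(2)] by fastforce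
      then show ?thesis by (intro exI[of _ "\<lambda>z. g z - g a"]) simp
    qed simp
  qed
  from choice[OF this] obtain J where J: "\<And>f z. f holomorphic_on S \<Longrightarrow> z \<in> S \<Longrightarrow> (J f has_field_derivative f z) (at z)"
    and J0: "\<And>f. f holomorphic_on S \<Longrightarrow> J f a = 0"
    by blast
  have Jhol: "J f holomorphic_on S" if "f holomorphic_on S" for f
    using J[OF that] S(2) holomorphic_on_open by blast
  define T where "T f = J (J (\<lambda>z. R z * f z))" for f
  have Thol: "T f holomorphic_on S" if "f holomorphic_on S" for f
    unfolding T_def by (intro Jhol holomorphic_intros R that)
  have T2: "deriv (deriv (T f)) z = R z * f z" if "f holomorphic_on S" "z \<in> S" for f z
  proof -
    have h: "(\<lambda>z. R z * f z) holomorphic_on S" by (intro holomorphic_intros R that)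
    have "deriv (T f) w = J (\<lambda>z. R z * f z) w" if "w \<in> S" for w
      unfolding T_def using J[OF Jhol[OF h] that] by (rule DERIV_imp_deriv)
    then have "deriv (deriv (T f)) z = deriv (J (\<lambda>z. R z * f z)) z"
      using S that by (intro deriv_cong_ev) (auto simp: eventually_nhds)
    also have "\<dots> = R z * f z" using J[OF h that(2)] by (rule DERIV_imp_deriv)
    finally show ?thesis .
  qed
  have Ta: "T f a = 0" "deriv (T f) a = 0" if "f holomorphic_on S" for f
  proof -
    have h: "(\<lambda>z. R z * f z) holomorphic_on S" by (intro holomorphic_intros R that)
    show "T f a = 0" unfolding T_def by (intro J0 Jhol h)
    show "deriv (T f) a = 0"
      unfolding T_def using DERIV_imp_deriv[OF J[OF Jhol[OF h] S(3)]] J0[OF h] by simp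
  qed
  define u where "u n = (T ^^ n) (\<lambda>z. \<alpha> + \<beta> * (z - a))" for n
  have u0: "u 0 = (\<lambda>z. \<alpha> + \<beta> * (z - a))" and uS: "u (Suc n) = T (u n)" for n
    by (simp_all add: u_def)
  have uhol: "u n holomorphic_on S" for n
    by (induction n) (auto simp: u0 uS intro!: Thol holomorphic_intros)
  define s where "s n z = (\<Sum>i<n. u i z)" for n z
  define y where "y z = (\<Sum>i. u i z)" for z
  have shol: "s n holomorphic_on S" for n
    unfolding s_def by (intro holomorphic_intros uhol)
  have lim: "\<exists>d>0. cball z d \<subseteq> S \<and> uniform_limit (cball z d) s y sequentially" if "z \<in> S" for z
  proof -
    obtain d where d: "d > 0" "cball z d \<subseteq> S" using S(2) \<open>z \<in> S\<close> open_contains_cball by blast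
    \<comment> \<open>A compact convex subset of \<open>S\<close> that contains the base point and a
      neighbourhood of \<open>z\<close>: R is bounded on it, and it contains the segments from
      \<open>a\<close> to its points.\<close>
    define C where "C = convex hull (insert a (cball z d))"
    have C: "compact C" "convex C" "a \<in> C" "C \<subseteq> S" "cball z d \<subseteq> C"
      unfolding C_def using S d
      by (auto intro!: compact_convex_hull compact_insert simp: subset_hull hull_inc)
    have segC: "closed_segment a w \<subseteq> C" if "w \<in> C" for w
      using C that by (simp add: closed_segment_subset)
    have "bounded (R ` C)"
      using C R by (intro compact_imp_bounded compact_continuous_image)
        (auto intro: holomorphic_on_imp_continuous_on holomorphic_on_subset)
    then obtain M where M: "M > 0" "\<And>w. w \<in> C \<Longrightarrow> norm (R w) \<le> M"
      by (auto simp: bounded_pos)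
    have "bounded ((\<lambda>w. w - a) ` C)"
      using C by (intro compact_imp_bounded compact_continuous_image continuous_intros)
    then obtain \<rho> where \<rho>: "\<rho> > 0" "\<And>w. w \<in> C \<Longrightarrow> norm (w - a) \<le> \<rho>"
      by (auto simp: bounded_pos)
    define B where "B = norm \<alpha> + norm \<beta> * \<rho>"
    have B0: "B \<ge> 0" using \<rho> by (simp add: B_def)
    \<comment> \<open>Only one of the two integrations is estimated sharply and contributes to 1 /
      n!; in the other the length is bounded by \<open>\<rho>\<close>. This suffices for uniform
      convergence.\<close>
    have bd: "norm (u n w) \<le> B * (M * \<rho>) ^ n / fact n * norm (w - a) ^ n" if "w \<in> C" for n w
      using that
    proof (induction n arbitrary: w)
      case 0
      have "norm (u 0 w) \<le> norm \<alpha> + norm (\<beta> * (w - a))"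
        unfolding u0 by (rule norm_triangle_ineq)
      also have "\<dots> \<le> B" using \<rho>(2)[OF 0] by (simp add: B_def norm_mult mult_left_mono)
      finally show ?case by simp
    next
      case (Suc n)
      have h: "(\<lambda>z. R z * u n z) holomorphic_on S" by (intro holomorphic_intros R uhol)
      let ?B = "M * (B * (M * \<rho>) ^ n / fact n)"
      let ?K = "?B / real (Suc n) * norm (w - a) ^ n * \<rho>"
      have 1: "norm (J (\<lambda>z. R z * u n z) x) \<le> ?B * norm (x - a) ^ Suc n / Suc n" if "x \<in> C" for x
      proof -
        have "norm (J (\<lambda>z. R z * u n z) x - J (\<lambda>z. R z * u n z) a) \<le> ?B * norm (x - a) ^ Suc n / Suc n"
        proof (rule segment_power_bound)
          fix t assume t: "t \<in> closed_segment a x"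
          then have tC: "t \<in> C" using segC[OF that] by auto
          show "(J (\<lambda>z. R z * u n z) has_field_derivative R t * u n t) (at t)"
            using J[OF h] tC C by blast
          show "norm (R t * u n t) \<le> ?B * norm (t - a) ^ n"
            using mult_mono[OF M(2)[OF tC] Suc.IH[OF tC]] M
            by (simp add: norm_mult mult_ac)
        qed
        then show ?thesis using J0[OF h] by simp
      qed
      have "norm (T (u n) w - T (u n) a) \<le> ?B * norm (w - a) ^ Suc n / Suc n * norm (w - a) ^ Suc 0 / Suc 0"
      proof (rule segment_power_bound)
        fix t assume t: "t \<in> closed_segment a w"
        then have tC: "t \<in> C" using segC[OF Suc.prems] by auto
        show "(T (u n) has_field_derivative J (\<lambda>z. R z * u n z) t) (at t)"
          unfolding T_def using J[OF Jhol[OF h]] tC C by blast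
        have "norm (t - a) \<le> norm (w - a)"
          using segment_bound(1)[OF t] by (simp add: norm_minus_commute)
        then have "norm (t - a) ^ Suc n \<le> norm (w - a) ^ Suc n"
          by (intro power_mono) auto
        moreover have "?B / real (Suc n) \<ge> 0" using M \<rho> B0 by simp
        ultimately have "?B / real (Suc n) * norm (t - a) ^ Suc n \<le> ?B / real (Suc n) * norm (w - a) ^ Suc n"
          by (intro mult_left_mono)
        then show "norm (J (\<lambda>z. R z * u n z) t) \<le> ?B * norm (w - a) ^ Suc n / Suc n * norm (t - a) ^ 0"
          using 1[OF tC] by simp
      qed
      then have "norm (u (Suc n) w) \<le> ?B / real (Suc n) * norm (w - a) ^ Suc n * norm (w - a)"
        using Ta[OF uhol[of n]] by (simp add: uS)
      also have "\<dots> \<le> ?B / real (Suc n) * norm (w - a) ^ Suc n * \<rho>"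
        using \<rho>(2)[OF Suc.prems] M \<rho> B0 by (intro mult_left_mono) auto
      also have "\<dots> = B * (M * \<rho>) ^ Suc n / fact (Suc n) * norm (w - a) ^ Suc n"
        by (simp add: field_simps)
      finally show ?case .
    qed
    have "uniform_limit C (\<lambda>n z. \<Sum>i<n. u i z) (\<lambda>z. \<Sum>i. u i z) sequentially"
    proof (rule Weierstrass_m_test)
      fix n w assume w: "w \<in> C"
      have "B * (M * \<rho>) ^ n / fact n * norm (w - a) ^ n \<le> B * (M * \<rho>) ^ n / fact n * \<rho> ^ n"
        using \<rho>(2)[OF w] M \<rho> B0 by (intro mult_left_mono power_mono) auto
      then show "norm (u n w) \<le> B * (inverse (fact n) * (M * \<rho> * \<rho>) ^ n)"
        using bd[OF w, of n] by (simp add: power_mult_distrib field_simps)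
    next
      show "summable (\<lambda>n. B * (inverse (fact n) * (M * \<rho> * \<rho>) ^ n))"
        by (intro summable_mult summable_exp)
    qed
    then have "uniform_limit C s y sequentially" by (simp add: s_def[abs_def] y_def[abs_def])
    then show ?thesis using d C(5) uniform_limit_on_subset by blast
  qed
  have yhol: "y holomorphic_on S"
    by (rule holomorphic_uniform_sequence[OF S(2) shol lim])
  have dlim: "(\<lambda>n. (deriv ^^ m) (s n) z) \<longlonglongrightarrow> (deriv ^^ m) y z" if zS: "z \<in> S" for m z
  proof -
    obtain d where d: "d > 0" "cball z d \<subseteq> S" "uniform_limit (cball z d) s y sequentially"
      using lim[OF zS] by blast
    show ?thesis
    proof (rule higher_deriv_complex_uniform_limit)
      show "uniform_limit (ball z d) s y sequentially"
        using d(3) ball_subset_cball uniform_limit_on_subset by blast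
      show "\<forall>\<^sub>F n in sequentially. s n holomorphic_on ball z d"
        using d ball_subset_cball by (intro always_eventually allI holomorphic_on_subset[OF shol]) auto
    qed (use d in auto)
  qed
  have d1s: "deriv (s n) z = (\<Sum>i<n. deriv (u i) z)" if "z \<in> S" for n z
    unfolding s_def by (intro DERIV_imp_deriv DERIV_sum holomorphic_derivI[OF uhol S(2) that])
  have d2s: "deriv (deriv (s n)) z = (\<Sum>i<n. deriv (deriv (u i)) z)" if "z \<in> S" for n z
  proof -
    have "deriv (deriv (s n)) z = deriv (\<lambda>z. \<Sum>i<n. deriv (u i) z) z"
      using S that d1s by (intro deriv_cong_ev) (auto simp: eventually_nhds)
    also have "\<dots> = (\<Sum>i<n. deriv (deriv (u i)) z)"
      by (intro DERIV_imp_deriv DERIV_sum holomorphic_derivI[OF holomorphic_deriv[OF uhol S(2)] S(2) that])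
    finally show ?thesis .
  qed
  have dd0: "deriv (u 0) z = \<beta>" for z
    unfolding u0 by (intro DERIV_imp_deriv) (auto intro!: derivative_eq_intros)
  have dd00: "deriv (deriv (u 0)) z = 0" for z
    by (simp add: dd0[abs_def])
  \<comment> \<open>The affine starting function has second derivative zero, so differentiating
    twice shifts the partial sums by one index.\<close>
  have rec: "deriv (deriv (s (Suc n))) z = R z * s n z" if "z \<in> S" for n z
    unfolding d2s[OF that] sum.lessThan_Suc_shift dd00 uS T2[OF uhol that]
    by (simp add: s_def sum_distrib_left)
  have "deriv (deriv y) z = R z * y z" if "z \<in> S" for z
  proof (rule LIMSEQ_unique)
    show "(\<lambda>n. deriv (deriv (s (Suc n))) z) \<longlonglongrightarrow> deriv (deriv y) z"
      using LIMSEQ_Suc[OF dlim[OF that, of 2]] by (simp add: numeral_2_eq_2)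
    show "(\<lambda>n. deriv (deriv (s (Suc n))) z) \<longlonglongrightarrow> R z * y z"
      unfolding rec[OF that] using dlim[OF that, of 0] by (auto intro!: tendsto_intros)
  qed
  moreover have "y a = \<alpha>"
  proof (rule LIMSEQ_unique)
    show "(\<lambda>n. s (Suc n) a) \<longlonglongrightarrow> y a" using LIMSEQ_Suc[OF dlim[OF S(3), of 0]] by simp
    have "s (Suc n) a = \<alpha>" for n
      unfolding s_def sum.lessThan_Suc_shift uS Ta(1)[OF uhol] by (simp add: u0)
    then show "(\<lambda>n. s (Suc n) a) \<longlonglongrightarrow> \<alpha>" by simp
  qed
  moreover have "deriv y a = \<beta>"
  proof (rule LIMSEQ_unique)
    show "(\<lambda>n. deriv (s (Suc n)) a) \<longlonglongrightarrow> deriv y a" using LIMSEQ_Suc[OF dlim[OF S(3), of 1]] by simp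
    have "deriv (s (Suc n)) a = \<beta>" for n
      unfolding d1s[OF S(3)] sum.lessThan_Suc_shift uS Ta(2)[OF uhol] by (simp add: dd0)
    then show "(\<lambda>n. deriv (s (Suc n)) a) \<longlonglongrightarrow> \<beta>" by simp
  qed
  ultimately show ?thesis using yhol that by (auto simp: ode_sol_def)
qed

lemma wronskian_const:
  assumes "ode_sol R S u" "ode_sol R S v" "open S" "connected S" "z \<in> S" "w \<in> S"
  shows "wronskian u v z = wronskian u v w"
proof -
  have u: "u holomorphic_on S" "v holomorphic_on S" using assms by (auto simp: ode_sol_def)
  have "(wronskian u v has_field_derivative 0) (at x)" if "x \<in> S" for x
  proof -
    have "(u has_field_derivative deriv u x) (at x)" "(v has_field_derivative deriv v x) (at x)"
      "(deriv u has_field_derivative R x * u x) (at x)" "(deriv v has_field_derivative R x * v x) (at x)"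
      using holomorphic_derivI[OF u(1) assms(3) that] holomorphic_derivI[OF u(2) assms(3) that]
        holomorphic_derivI[OF holomorphic_deriv[OF u(1) assms(3)] assms(3) that]
        holomorphic_derivI[OF holomorphic_deriv[OF u(2) assms(3)] assms(3) that] assms(1,2) that
      by (auto simp: ode_sol_def)
    then show ?thesis unfolding wronskian_def
      by (auto intro!: derivative_eq_intros)
  qed
  then have "wronskian u v constant_on S"
    using assms by (intro has_field_derivative_0_imp_constant_on) auto
  then show ?thesis using assms by (auto simp: constant_on_def)
qed

text \<open>Cramer's rule: W(u,v) y = W(y,v) u + W(u,y) v is an algebraic identity, and all three
  Wronskians are constant. This plays the part of a uniqueness theorem.\<close>

lemma ode_sol_combination:
  assumes "ode_sol R S u" "ode_sol R S v" "ode_sol R S y" "open S" "connected S" "a \<in> S"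
    and W: "wronskian u v a = 1"
  shows "\<forall>z\<in>S. y z = wronskian y v a * u z + wronskian u y a * v z"
proof
  fix z assume z: "z \<in> S"
  have "wronskian u v z * y z = wronskian y v z * u z + wronskian u y z * v z"
    by (simp add: wronskian_def algebra_simps)
  then show "y z = wronskian y v a * u z + wronskian u y a * v z"
    using wronskian_const[OF assms(1,2,4,5) z assms(6)] wronskian_const[OF assms(3,2,4,5) z assms(6)]
      wronskian_const[OF assms(1,3,4,5) z assms(6)] W by simp
qed

section \<open>Small area and the spherical derivative\<close>

text \<open>The numerator is 2 * 16: Cauchy's formula below loses a factor 2, and the disc of
  centres has radius r / 4, hence 1 / 16 of the area of a disc of radius r.\<close>

definition mv_const :: real where
  "mv_const = 32 / measure lborel (ball (0::complex) 1)"

lemma mv_const_pos: "mv_const > 0"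
  by (simp add: mv_const_def content_ball_pos)

(* Cauchy's formula on circles around nearby centres, averaged over the centre: this needs
   only translation invariance of Lebesgue measure, not polar coordinates. *)
lemma holomorphic_square_mean_value:
  assumes p: "p holomorphic_on ball z0 r" and r: "r > 0"
  shows "ennreal ((norm (p z0) * r)\<^sup>2) \<le>
    ennreal mv_const * (\<integral>\<^sup>+z\<in>ball z0 r. ennreal ((norm (p z))\<^sup>2) \<partial>lborel)"
proof -
  \<comment> \<open>The squared norm is continued by zero to the whole plane, so that its integral
    may be translated.\<close>
  define q where "q z = ennreal (indicator (ball z0 r) z * (norm (p z))\<^sup>2)" for z
  have q_meas [measurable]: "q \<in> borel_measurable borel"
  proof -
    have "(\<lambda>z. indicator (ball z0 r) z *\<^sub>R (norm (p z))\<^sup>2) \<in> borel_measurable borel"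
      using holomorphic_on_imp_continuous_on[OF p]
      by (intro borel_measurable_continuous_on_indicator continuous_intros) auto
    then show ?thesis unfolding q_def by simp
  qed
  define e where "e t = of_real (r / 2) * exp (2 * of_real pi * \<i> * of_real t)" for t :: real
  have e_meas [measurable]: "e \<in> borel_measurable borel"
    unfolding e_def by (intro borel_measurable_continuous_onI continuous_intros)
  define A where "A = (\<integral>\<^sup>+z. q z \<partial>lborel)"
  \<comment> \<open>A circle of radius r / 2 whose centre is moved by less than r / 4 keeps distance
    r / 4 from \<open>z0\<close>. With speed \<open>pi * r\<close> the Cauchy kernel costs at most
    \<open>4 * pi\<close>, against the \<open>2 * pi\<close> of the formula.\<close>
  have 1: "ennreal ((norm (p z0))\<^sup>2) \<le> 2 * (\<integral>\<^sup>+t. indicator {0..1} t * q (\<tau> + (z0 + e t)) \<partial>lborel)"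
    if \<tau>: "\<tau> \<in> ball 0 (r / 4)" for \<tau>
  proof -
    let ?\<gamma> = "circlepath (\<tau> + z0) (r / 2)"
    have \<gamma>: "?\<gamma> t = \<tau> + (z0 + e t)" for t
      by (simp add: circlepath e_def)
    have ne: "norm (e t) = r / 2" for t
    proof -
      have "norm (exp (2 * of_real pi * \<i> * of_real t)) = 1"
        by (simp add: norm_exp_eq_Re)
      then show ?thesis using r by (simp add: e_def norm_mult)
    qed
    have sub: "cball (\<tau> + z0) (r / 2) \<subseteq> ball z0 r"
    proof
      fix w assume "w \<in> cball (\<tau> + z0) (r / 2)"
      then have "norm (w - z0) \<le> r / 2 + norm \<tau>"
        using norm_triangle_ineq[of "w - (\<tau> + z0)" \<tau>] by (simp add: dist_norm norm_minus_commute)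
      then show "w \<in> ball z0 r" using \<tau> r by (simp add: dist_norm norm_minus_commute)
    qed
    have \<gamma>in: "?\<gamma> t \<in> cball (\<tau> + z0) (r / 2)" for t
      unfolding \<gamma> using ne[of t] by (simp add: dist_norm norm_minus_commute algebra_simps)
    have hol: "(\<lambda>z. (p z)\<^sup>2) holomorphic_on ball z0 r" by (intro holomorphic_intros p)
    have "((\<lambda>w. (p w)\<^sup>2 / (w - z0)) has_contour_integral 2 * of_real pi * \<i> * (p z0)\<^sup>2) ?\<gamma>"
    proof (rule Cauchy_integral_circlepath)
      show "continuous_on (cball (\<tau> + z0) (r / 2)) (\<lambda>z. (p z)\<^sup>2)"
        using hol sub holomorphic_on_imp_continuous_on continuous_on_subset by blast
      show "(\<lambda>z. (p z)\<^sup>2) holomorphic_on ball (\<tau> + z0) (r / 2)"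
        using holomorphic_on_subset[OF hol] sub ball_subset_cball by blast
      show "norm (z0 - (\<tau> + z0)) < r / 2" using \<tau> r by simp
    qed
    then have int: "((\<lambda>t. (p (?\<gamma> t))\<^sup>2 / (?\<gamma> t - z0) * vector_derivative ?\<gamma> (at t within {0..1}))
        has_integral 2 * of_real pi * \<i> * (p z0)\<^sup>2) {0..1}"
      by (simp only: has_contour_integral_def)
    have cont: "continuous_on {0..1} (\<lambda>t. p (?\<gamma> t))"
      by (rule continuous_on_compose2[OF holomorphic_on_imp_continuous_on[OF p]])
        (use \<gamma>in sub in \<open>auto simp: \<gamma> e_def intro!: continuous_intros\<close>)
    have gint: "((\<lambda>t. 4 * pi * (norm (p (?\<gamma> t)))\<^sup>2) has_integral
         integral {0..1} (\<lambda>t. 4 * pi * (norm (p (?\<gamma> t)))\<^sup>2)) {0..1}"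
      by (intro integrable_integral integrable_continuous_real continuous_intros cont)
    have bb: "norm ((p (?\<gamma> t))\<^sup>2 / (?\<gamma> t - z0) * vector_derivative ?\<gamma> (at t within {0..1}))
          \<le> 4 * pi * (norm (p (?\<gamma> t)))\<^sup>2" if t: "t \<in> {0..1}" for t
    proof -
      have "norm (vector_derivative ?\<gamma> (at t within {0..1})) = pi * r"
        using t r by (simp add: vector_derivative_circlepath01 norm_mult norm_exp_eq_Re)
      moreover have "norm (?\<gamma> t - z0) \<ge> r / 4"
      proof -
        have "r / 2 \<le> norm (?\<gamma> t - z0) + norm \<tau>"
          using norm_triangle_ineq4[of "?\<gamma> t - z0" \<tau>] ne[of t] by (simp add: \<gamma>)
        then show ?thesis using \<tau> by simp
      qed
      ultimately show "norm ((p (?\<gamma> t))\<^sup>2 / (?\<gamma> t - z0) * vector_derivative ?\<gamma> (at t within {0..1}))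
          \<le> 4 * pi * (norm (p (?\<gamma> t)))\<^sup>2"
        using r mult_left_mono[of "r / 4" "norm (?\<gamma> t - z0)" "4 * pi * (norm (p (?\<gamma> t)))\<^sup>2"]
        by (simp add: norm_mult norm_divide norm_power divide_simps mult_ac)
    qed
    have "norm (2 * of_real pi * \<i> * (p z0)\<^sup>2) \<le> integral {0..1} (\<lambda>t. 4 * pi * (norm (p (?\<gamma> t)))\<^sup>2)"
      using integral_norm_bound_integral[OF has_integral_integrable[OF int] has_integral_integrable[OF gint] bb]
      by (simp only: integral_unique[OF int])
    then have le: "(norm (p z0))\<^sup>2 \<le> 2 * integral {0..1} (\<lambda>t. (norm (p (?\<gamma> t)))\<^sup>2)"
      by (simp add: norm_mult norm_power)
    have "(\<integral>\<^sup>+t. indicator {0..1} t * q (\<tau> + (z0 + e t)) \<partial>lborel) =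
        (\<integral>\<^sup>+t. ennreal (indicator {0..1} t * (norm (p (?\<gamma> t)))\<^sup>2) \<partial>lborel)"
      using \<gamma>in sub by (intro nn_integral_cong) (auto simp: q_def indicator_def \<gamma> subset_iff)
    also have "\<dots> = ennreal (integral {0..1} (\<lambda>t. (norm (p (?\<gamma> t)))\<^sup>2))"
      by (intro nn_integral_has_integral_lebesgue integrable_integral integrable_continuous_real
          continuous_intros cont) auto
    finally show ?thesis
      using ennreal_leI[OF le] by (simp add: ennreal_mult'[symmetric] flip: ennreal_numeral)
  qed
  have "emeasure lborel (ball (0::complex) (r / 4)) * ennreal ((norm (p z0))\<^sup>2) =
      (\<integral>\<^sup>+\<tau>. ennreal ((norm (p z0))\<^sup>2) * indicator (ball (0::complex) (r / 4)) \<tau> \<partial>lborel)"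
    by (subst nn_integral_cmult_indicator) (auto simp: mult.commute)
  \<comment> \<open>On the right the offset \<open>\<tau>\<close> is allowed to run over the whole
    plane. After the exchange of the integrals each inner one is the integral of a translate of
    \<open>q\<close>.\<close>
  also have "\<dots> \<le> (\<integral>\<^sup>+\<tau>. 2 * (\<integral>\<^sup>+t. indicator {0..1} t * q (\<tau> + (z0 + e t)) \<partial>lborel) \<partial>lborel)"
    using 1 by (intro nn_integral_mono) (auto simp: indicator_def)
  also have "\<dots> = 2 * (\<integral>\<^sup>+\<tau>. (\<integral>\<^sup>+t. indicator {0..1} t * q (\<tau> + (z0 + e t)) \<partial>lborel) \<partial>lborel)"
    by (intro nn_integral_cmult) measurable
  also have "(\<integral>\<^sup>+\<tau>. (\<integral>\<^sup>+t. indicator {0..1} t * q (\<tau> + (z0 + e t)) \<partial>lborel) \<partial>lborel) =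
      (\<integral>\<^sup>+t. (\<integral>\<^sup>+\<tau>. indicator {0..1} t * q (\<tau> + (z0 + e t)) \<partial>lborel) \<partial>lborel)"
    by (rule lborel_pair.Fubini') measurable
  also have "\<dots> = (\<integral>\<^sup>+t. A * indicator {0..1::real} t \<partial>lborel)"
  proof (intro nn_integral_cong)
    fix t :: real
    have "(\<integral>\<^sup>+\<tau>. q (\<tau> + (z0 + e t)) \<partial>lborel) = (\<integral>\<^sup>+\<tau>. q ((z0 + e t) + \<tau>) \<partial>lborel)"
      by (simp add: add.commute)
    also have "\<dots> = (\<integral>\<^sup>+\<tau>. q \<tau> \<partial>distr lborel borel ((+) (z0 + e t)))"
      by (subst nn_integral_distr) auto
    also have "\<dots> = A" by (simp add: lborel_distr_plus A_def)
    finally show "(\<integral>\<^sup>+\<tau>. indicator {0..1} t * q (\<tau> + (z0 + e t)) \<partial>lborel) = A * indicator {0..1} t"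
      by (simp add: nn_integral_cmult mult.commute)
  qed
  also have "\<dots> = A" by (subst nn_integral_cmult_indicator) auto
  finally have "emeasure lborel (ball (0::complex) (r / 4)) * ennreal ((norm (p z0))\<^sup>2) \<le> 2 * A" .
  moreover have "emeasure lborel (ball (0::complex) (r / 4)) = ennreal ((r / 4)\<^sup>2 * measure lborel (ball (0::complex) 1))"
    using content_ball_conv_unit_ball[of "r / 4" "0::complex"] r emeasure_lborel_ball_finite[of "0::complex" "r / 4"]
    by (simp add: emeasure_eq_ennreal_measure)
  ultimately have "ennreal ((r / 4)\<^sup>2 * measure lborel (ball (0::complex) 1) * (norm (p z0))\<^sup>2) \<le> 2 * A"
    using r by (simp add: ennreal_mult')
  then have "ennreal (16 / measure lborel (ball (0::complex) 1)) *
        ennreal ((r / 4)\<^sup>2 * measure lborel (ball (0::complex) 1) * (norm (p z0))\<^sup>2)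
      \<le> ennreal (16 / measure lborel (ball (0::complex) 1)) * (2 * A)"
    by (rule mult_left_mono) simp
  moreover have "ennreal (16 / measure lborel (ball (0::complex) 1)) *
        ennreal ((r / 4)\<^sup>2 * measure lborel (ball (0::complex) 1) * (norm (p z0))\<^sup>2) = ennreal ((norm (p z0) * r)\<^sup>2)"
    using content_ball_pos[of 1 "0::complex"]
    by (simp add: ennreal_mult'[symmetric] field_simps power2_eq_square)
  moreover have "ennreal (16 / measure lborel (ball (0::complex) 1)) * (2 * A) = ennreal mv_const * A"
    using content_ball_pos[of 1 "0::complex"]
    by (simp add: mv_const_def mult.assoc[symmetric] ennreal_mult'[symmetric] flip: ennreal_numeral)
  moreover have "A = (\<integral>\<^sup>+z\<in>ball z0 r. ennreal ((norm (p z))\<^sup>2) \<partial>lborel)"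
    unfolding A_def q_def by (intro nn_integral_cong) (auto simp: indicator_def)
  ultimately show ?thesis by simp
qed

section \<open>Rotations of the sphere in homogeneous coordinates\<close>

lemma norm_square_sum_pos:
  fixes a b :: complex
  assumes "a \<noteq> 0 \<or> b \<noteq> 0"
  shows "0 < (norm a)\<^sup>2 + (norm b)\<^sup>2"
  using assms by (metis add_pos_nonneg add_nonneg_pos zero_le_power2 zero_less_norm_iff zero_less_power)

text \<open>Up to the factor in front, the two expressions on the left are the image of (u, v) under
  a unitary matrix. On quotients this is a rotation of the sphere, and it brings the point with
  coordinates (a, b) to 0.\<close>

lemma lagrange_identity:
  fixes a b u v :: complex
  shows "(norm (a * v - b * u))\<^sup>2 + (norm (cnj a * u + cnj b * v))\<^sup>2 =
    ((norm a)\<^sup>2 + (norm b)\<^sup>2) * ((norm u)\<^sup>2 + (norm v)\<^sup>2)"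
proof -
  have "complex_of_real ((norm (a * v - b * u))\<^sup>2 + (norm (cnj a * u + cnj b * v))\<^sup>2) =
      complex_of_real (((norm a)\<^sup>2 + (norm b)\<^sup>2) * ((norm u)\<^sup>2 + (norm v)\<^sup>2))"
    unfolding of_real_add of_real_mult complex_norm_square by (simp add: algebra_simps)
  then show ?thesis using of_real_eq_iff by blast
qed

lemma borel_measurable_continuous_ennreal_indicator:
  fixes f :: "complex \<Rightarrow> real"
  assumes "continuous_on S f" "S \<in> sets borel"
  shows "(\<lambda>z. ennreal (f z) * indicator S z) \<in> borel_measurable borel"
proof -
  have "(\<lambda>z. indicator S z *\<^sub>R f z) \<in> borel_measurable borel"
    using assms by (intro borel_measurable_continuous_on_indicator)
  then have "(\<lambda>z. ennreal (indicator S z *\<^sub>R f z)) \<in> borel_measurable borel" by simp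
  also have "(\<lambda>z. ennreal (indicator S z *\<^sub>R f z)) = (\<lambda>z. ennreal (f z) * indicator S z)"
    by (auto simp: indicator_def)
  finally show ?thesis .
qed

text \<open>\<open>X / Z\<close> is the quotient after a rotation that makes it vanish at
  \<open>a\<close>, and its derivative is N(a) W / Z^2. As long as |X| \<le> |Z|, the Lagrange
  identity gives |Z|^2 \<ge> N(a) N(z) / 2, so the derivative is at most 2 s. A continuity argument
  shows that the quotient cannot leave the hemisphere |X| \<le> |Z| on so short a segment.\<close>

lemma segment_quotient_bound:
  fixes s :: real
  assumes S: "open S" "closed_segment a b \<subseteq> S" and hol: "u holomorphic_on S" "v holomorphic_on S"
    and pos: "\<And>z. z \<in> closed_segment a b \<Longrightarrow> 0 < (norm (u z))\<^sup>2 + (norm (v z))\<^sup>2"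
    and bd: "\<And>z. z \<in> closed_segment a b \<Longrightarrow>
        norm (wronskian u v z) \<le> s * ((norm (u z))\<^sup>2 + (norm (v z))\<^sup>2)"
    and small: "2 * s * norm (b - a) < 1"
  defines "X \<equiv> \<lambda>z. u a * v z - v a * u z" and "Z \<equiv> \<lambda>z. cnj (u a) * u z + cnj (v a) * v z"
  shows "Z b \<noteq> 0" "norm (X b) \<le> 2 * s * norm (b - a) * norm (Z b)"
proof -
  define N where "N z = (norm (u z))\<^sup>2 + (norm (v z))\<^sup>2" for z
  have lagrange: "(norm (X z))\<^sup>2 + (norm (Z z))\<^sup>2 = N a * N z" for z
    unfolding X_def Z_def N_def by (rule lagrange_identity)
  have posN: "N z > 0" if "z \<in> closed_segment a b" for z using pos[OF that] by (simp add: N_def)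
  have s0: "s \<ge> 0"
  proof -
    have "0 \<le> s * N a" using order_trans[OF norm_ge_zero bd[of a]] by (simp add: N_def)
    then show ?thesis using posN[of a] by (simp add: zero_le_mult_iff)
  qed
  have step: "Z c \<noteq> 0 \<and> norm (X c) \<le> 2 * s * norm (c - a) * norm (Z c)"
    if c: "c \<in> closed_segment a b" and le: "\<And>z. z \<in> closed_segment a c \<Longrightarrow> norm (X z) \<le> norm (Z z)" for c
  proof -
    have sub: "closed_segment a c \<subseteq> closed_segment a b"
      using c by (simp add: closed_segment_subset)
    have Z0: "Z z \<noteq> 0" if "z \<in> closed_segment a c" for z
    proof
      assume "Z z = 0"
      then have "X z = 0" using le[OF that] by simp
      with \<open>Z z = 0\<close> lagrange[of z] posN[of a] posN[of z] that sub show False by auto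
    qed
    have "norm (X c / Z c - X a / Z a) \<le> 2 * s * norm (c - a) ^ Suc 0 / Suc 0"
    proof (rule segment_power_bound[where f = "\<lambda>z. N a * wronskian u v z / (Z z)\<^sup>2"])
      fix z assume z: "z \<in> closed_segment a c"
      then have zS: "z \<in> S" and zb: "z \<in> closed_segment a b" using sub S by auto
      note d = holomorphic_derivI[OF hol(1) S(1) zS] holomorphic_derivI[OF hol(2) S(1) zS]
      have "((\<lambda>z. X z / Z z) has_field_derivative
          ((u a * deriv v z - v a * deriv u z) * Z z - X z * (cnj (u a) * deriv u z + cnj (v a) * deriv v z))
            / (Z z * Z z)) (at z)"
        unfolding X_def Z_def using Z0[OF z] d
        by (auto intro!: derivative_eq_intros simp: Z_def mult.commute)
      moreover have "(u a * deriv v z - v a * deriv u z) * Z z - X z * (cnj (u a) * deriv u z + cnj (v a) * deriv v z)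
          = N a * wronskian u v z"
        unfolding N_def X_def Z_def wronskian_def of_real_add complex_norm_square by (simp add: algebra_simps)
      ultimately show "((\<lambda>z. X z / Z z) has_field_derivative N a * wronskian u v z / (Z z)\<^sup>2) (at z)"
        by (simp add: power2_eq_square)
      have "N a * norm (wronskian u v z) \<le> N a * (s * N z)"
        using bd[OF zb] posN[of a] by (intro mult_left_mono) (auto simp: N_def)
      also have "\<dots> = s * ((norm (X z))\<^sup>2 + (norm (Z z))\<^sup>2)" by (simp add: lagrange)
      also have "\<dots> \<le> s * (2 * (norm (Z z))\<^sup>2)"
        using power_mono[OF le[OF z], of 2] s0 by (intro mult_left_mono) auto
      finally show "norm (N a * wronskian u v z / (Z z)\<^sup>2) \<le> 2 * s * norm (z - a) ^ 0"
        using Z0[OF z] posN[of a] by (simp add: norm_divide norm_mult norm_power divide_simps mult_ac)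
    qed
    then show ?thesis using Z0[of c] by (simp add: X_def norm_divide divide_simps)
  qed
  define p where "p t = a + of_real t * (b - a)" for t :: real
  have p_seg: "p t \<in> closed_segment a b" if "t \<in> {0..1}" for t
    using that unfolding p_def closed_segment_def
    by (auto intro!: exI[of _ t] simp: algebra_simps scaleR_conv_of_real)
  have seg_p: "\<exists>t'\<in>{0..t}. z = p t'" if zt: "z \<in> closed_segment a (p t)" "t \<in> {0..1}" for z t
  proof -
    obtain x where x: "0 \<le> x" "x \<le> 1" "z = (1 - x) *\<^sub>R a + x *\<^sub>R p t"
      using zt by (auto simp: closed_segment_def)
    then have "z = p (x * t)" by (simp add: p_def scaleR_conv_of_real algebra_simps)
    moreover have "x * t \<in> {0..t}" using x zt by (auto simp: mult_left_le_one_le)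
    ultimately show ?thesis by blast
  qed
  have contp: "continuous_on {0..1} (\<lambda>t. norm (X (p t)) - norm (Z (p t)))"
  proof -
    have "continuous_on {0..1} (\<lambda>t. u (p t))" "continuous_on {0..1} (\<lambda>t. v (p t))"
      using p_seg S(2)
      by (auto intro!: continuous_on_compose2[OF holomorphic_on_imp_continuous_on[OF hol(1)]]
          continuous_on_compose2[OF holomorphic_on_imp_continuous_on[OF hol(2)]] continuous_intros simp: p_def[abs_def])
    then show ?thesis unfolding X_def Z_def by (intro continuous_intros)
  qed
  have lt: "norm (X (p t)) - norm (Z (p t)) < 0" if t: "t \<in> {0..1}" for t
  proof (rule ccontr)
    assume nlt: "\<not> norm (X (p t)) - norm (Z (p t)) < 0"
    \<comment> \<open>At the first point where |X| reaches |Z| the derivative bound is still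
      available, and it yields 1 \<le> 2 s |b - a| there.\<close>
    define T where "T = {0..1} \<inter> (\<lambda>t. norm (X (p t)) - norm (Z (p t))) -` {0..}"
    have T: "closed T" "t \<in> T" "bdd_below T"
      using nlt t unfolding T_def
      by (auto intro!: continuous_closed_preimage[OF contp])
    define t0 where "t0 = Inf T"
    have t0T: "t0 \<in> T" unfolding t0_def using T by (intro closed_contains_Inf) auto
    then have t01: "t0 \<in> {0..1}" and ge: "norm (X (p t0)) \<ge> norm (Z (p t0))" by (auto simp: T_def)
    have below: "norm (X (p t')) < norm (Z (p t'))" if "t' \<in> {0..<t0}" for t'
    proof (rule ccontr)
      assume "\<not> norm (X (p t')) < norm (Z (p t'))"
      then have "t' \<in> T" using that t01 by (auto simp: T_def)
      then have "t0 \<le> t'" unfolding t0_def by (intro cInf_lower T(3))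
      then show False using that by simp
    qed
    have Xa: "norm (X (p 0)) < norm (Z (p 0))"
      using lagrange[of a] posN[of a] by (auto simp: p_def X_def)
    then have t0pos: "0 < t0" using ge t01 by (cases "t0 = 0") auto
    have "norm (X (p t0)) - norm (Z (p t0)) \<le> 0"
    proof (rule continuous_le_on_closure[of "{0..<t0}" "\<lambda>t. norm (X (p t)) - norm (Z (p t))" t0 0])
      show "continuous_on (closure {0..<t0}) (\<lambda>t. norm (X (p t)) - norm (Z (p t)))"
        using t01 t0pos by (intro continuous_on_subset[OF contp]) auto
    qed (use below t0pos in \<open>auto simp: less_imp_le\<close>)
    then have eq: "norm (X (p t0)) = norm (Z (p t0))" using ge by simp
    have "Z (p t0) \<noteq> 0 \<and> norm (X (p t0)) \<le> 2 * s * norm (p t0 - a) * norm (Z (p t0))"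
    proof (rule step[OF p_seg[OF t01]])
      fix z assume "z \<in> closed_segment a (p t0)"
      then obtain t' where "t' \<in> {0..t0}" "z = p t'" using seg_p t01 by blast
      then show "norm (X z) \<le> norm (Z z)" using below[of t'] eq by (cases "t' = t0") auto
    qed
    then have "1 * norm (Z (p t0)) \<le> 2 * s * norm (p t0 - a) * norm (Z (p t0))" "norm (Z (p t0)) > 0"
      using eq by auto
    then have "1 \<le> 2 * s * norm (p t0 - a)" using mult_le_cancel_right_pos by blast
    also have "\<dots> \<le> 2 * s * norm (b - a)"
      using t01 s0 by (intro mult_left_mono) (auto simp: p_def norm_mult mult_left_le_one_le)
    finally show False using small by simp
  qed
  have "Z b \<noteq> 0 \<and> norm (X b) \<le> 2 * s * norm (b - a) * norm (Z b)"
  proof (rule step)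
    fix z assume "z \<in> closed_segment a b"
    then obtain t where "t \<in> {0..1}" "z = p t" using seg_p[of z 1] by (auto simp: p_def)
    then show "norm (X z) \<le> norm (Z z)" using lt[of t] by simp
  qed simp
  then show "Z b \<noteq> 0" "norm (X b) \<le> 2 * s * norm (b - a) * norm (Z b)" by auto
qed

(* Schoen's point-picking argument: at a maximum of (R - |z - z0|) times the spherical derivative,
   a rotation of the sphere turns the quotient into a bounded holomorphic function on a disc of
   comparable size, to which the mean value inequality applies. *)
lemma spherical_derivative_bound:
  fixes A R :: real
  defines "\<sigma> \<equiv> \<lambda>u v z. norm (wronskian u v z) / ((norm (u z))\<^sup>2 + (norm (v z))\<^sup>2)"
  assumes S: "open S" "cball z0 R \<subseteq> S" and R: "R > 0"
    and hol: "u holomorphic_on S" "v holomorphic_on S"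
    and W: "\<And>z. z \<in> cball z0 R \<Longrightarrow> wronskian u v z \<noteq> 0"
    and A: "(\<integral>\<^sup>+z\<in>cball z0 R. ennreal ((\<sigma> u v z)\<^sup>2) \<partial>lborel) \<le> ennreal A" "A \<ge> 0" "256 * mv_const * A < 1"
  shows "(R * \<sigma> u v z0)\<^sup>2 \<le> 16 * mv_const * A"
proof -
  define N where "N z = (norm (u z))\<^sup>2 + (norm (v z))\<^sup>2" for z
  define g where "g = \<sigma> u v"
  have g_eq: "g z = norm (wronskian u v z) / N z" for z by (simp add: g_def \<sigma>_def N_def)
  have N: "N z > 0" if "z \<in> cball z0 R" for z
  proof -
    have "u z \<noteq> 0 \<or> v z \<noteq> 0" using W[OF that] by (auto simp: wronskian_def)
    then show ?thesis unfolding N_def by (rule norm_square_sum_pos)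
  qed
  have gpos: "g z > 0" if "z \<in> cball z0 R" for z using W[OF that] N[OF that] by (simp add: g_eq)
  have cont: "continuous_on (cball z0 R) g"
  proof -
    have "continuous_on S u" "continuous_on S v" "continuous_on S (deriv u)" "continuous_on S (deriv v)"
      using hol S(1) by (auto intro!: holomorphic_on_imp_continuous_on holomorphic_deriv)
    then have "continuous_on (cball z0 R) u" "continuous_on (cball z0 R) v"
      "continuous_on (cball z0 R) (deriv u)" "continuous_on (cball z0 R) (deriv v)"
      using S(2) continuous_on_subset by blast+
    moreover have "\<forall>z\<in>cball z0 R. (norm (u z))\<^sup>2 + (norm (v z))\<^sup>2 \<noteq> 0" using N unfolding N_def by force
    ultimately show ?thesis
      unfolding g_def \<sigma>_def wronskian_def by (intro continuous_intros) auto
  qed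
  obtain z1 where z1: "z1 \<in> cball z0 R"
    and max: "\<And>z. z \<in> cball z0 R \<Longrightarrow> (R - norm (z - z0)) * g z \<le> (R - norm (z1 - z0)) * g z1"
    using continuous_attains_sup[of "cball z0 R" "\<lambda>z. (R - norm (z - z0)) * g z"] R
    by (force intro!: continuous_intros cont)
  define s where "s = g z1"
  define \<rho> where "\<rho> = (R - norm (z1 - z0)) / 2"
  have s: "s > 0" using gpos z1 by (simp add: s_def)
  have z0b: "z0 \<in> cball z0 R" using R by simp
  have \<rho>2: "R - norm (z1 - z0) = 2 * \<rho>" by (simp add: \<rho>_def)
  have Rg: "R * g z0 \<le> 2 * \<rho> * s" using max[OF z0b] unfolding \<rho>2 s_def by simp
  then have \<rho>: "\<rho> > 0"
    using gpos[OF z0b] R s by (smt (verit) mult_pos_pos zero_less_mult_pos2)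
  \<comment> \<open>Where the spherical derivative is at most 2 s, the radius 1 / (8 s) keeps the
    rotated quotient of norm at most 1 / 2.\<close>
  define r where "r = min \<rho> (1 / (8 * s))"
  have r: "r > 0" "r \<le> \<rho>" "s * r \<le> 1 / 8" using \<rho> s by (auto simp: r_def field_simps min_def)
  have ballsub: "ball z1 r \<subseteq> cball z0 R"
  proof
    fix z assume "z \<in> ball z1 r"
    then have "norm (z - z1) < r" by (simp add: dist_norm norm_minus_commute)
    moreover have "norm (z - z0) \<le> norm (z - z1) + norm (z1 - z0)"
      using norm_triangle_ineq[of "z - z1" "z1 - z0"] by simp
    ultimately show "z \<in> cball z0 R"
      using r \<rho> by (simp add: dist_norm norm_minus_commute \<rho>_def)
  qed
  \<comment> \<open>Within distance \<open>\<rho>\<close> of \<open>z1\<close> the weight R - |z -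
    z0| is at least half of its value \<open>2 * \<rho>\<close> at \<open>z1\<close>, so maximality
    loses only a factor 2.\<close>
  have g2: "g z \<le> 2 * s" if "z \<in> ball z1 r" for z
  proof -
    have "norm (z - z1) < r" using that by (simp add: dist_norm norm_minus_commute)
    moreover have "norm (z - z0) \<le> norm (z - z1) + norm (z1 - z0)"
      using norm_triangle_ineq[of "z - z1" "z1 - z0"] by simp
    ultimately have "\<rho> \<le> R - norm (z - z0)" using r \<rho> by (simp add: \<rho>_def)
    then have "\<rho> * g z \<le> (R - norm (z - z0)) * g z"
      using gpos[of z] that ballsub by (intro mult_right_mono) (auto intro: less_imp_le)
    also have "\<dots> \<le> 2 * \<rho> * s" using max[of z] that ballsub unfolding \<rho>2 s_def by auto
    finally show ?thesis using \<rho> by simp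
  qed
  define X where "X z = u z1 * v z - v z1 * u z" for z
  define Z where "Z z = cnj (u z1) * u z + cnj (v z1) * v z" for z
  have lagrange: "(norm (X z))\<^sup>2 + (norm (Z z))\<^sup>2 = N z1 * N z" for z
    unfolding X_def Z_def N_def by (rule lagrange_identity)
  have XZ: "Z b \<noteq> 0 \<and> norm (X b) \<le> norm (Z b)" if b: "b \<in> ball z1 r" for b
  proof -
    have seg: "closed_segment z1 b \<subseteq> ball z1 r"
      using b r by (intro closed_segment_subset) auto
    have small: "2 * (2 * s) * norm (b - z1) \<le> 1 / 2"
    proof -
      have "s * norm (b - z1) \<le> s * r"
        using b s by (intro mult_left_mono) (auto simp: dist_norm norm_minus_commute)
      then show ?thesis using r(3) by simp
    qed
    have *: "Z b \<noteq> 0" "norm (X b) \<le> 2 * (2 * s) * norm (b - z1) * norm (Z b)"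
      unfolding X_def Z_def
    proof (atomize (full), intro conjI segment_quotient_bound[OF S(1) _ hol])
      show "closed_segment z1 b \<subseteq> S" using seg ballsub S by blast
      then show "closed_segment z1 b \<subseteq> S" .
      fix z assume "z \<in> closed_segment z1 b"
      then have z: "z \<in> ball z1 r" "z \<in> cball z0 R" using seg ballsub by auto
      show 1: "0 < (norm (u z))\<^sup>2 + (norm (v z))\<^sup>2" using N[OF z(2)] by (simp add: N_def)
      show 2: "norm (wronskian u v z) \<le> 2 * s * ((norm (u z))\<^sup>2 + (norm (v z))\<^sup>2)"
        using g2[OF z(1)] N[OF z(2)] by (simp add: g_eq N_def divide_simps)
      show "0 < (norm (u z))\<^sup>2 + (norm (v z))\<^sup>2" by (rule 1)
      show "norm (wronskian u v z) \<le> 2 * s * ((norm (u z))\<^sup>2 + (norm (v z))\<^sup>2)" by (rule 2)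
    qed (use small in auto)
    have "2 * (2 * s) * norm (b - z1) * norm (Z b) \<le> 1 / 2 * norm (Z b)"
      using small by (intro mult_right_mono) auto
    then show ?thesis using * norm_ge_zero[of "Z b"] by linarith
  qed
  \<comment> \<open>The derivative of \<open>X / Z\<close>. Its norm is at most twice the spherical
    derivative, because |X| \<le> |Z|, and equals it at the centre \<open>z1\<close>.\<close>
  define p where "p z = N z1 * wronskian u v z / (Z z)\<^sup>2" for z
  have uvb: "u holomorphic_on ball z1 r" "v holomorphic_on ball z1 r"
    using hol ballsub S(2) holomorphic_on_subset by blast+
  have "p holomorphic_on ball z1 r"
    unfolding p_def wronskian_def Z_def
    using XZ by (intro holomorphic_intros uvb holomorphic_deriv) (auto simp: Z_def)
  then have "ennreal ((norm (p z1) * r)\<^sup>2) \<le>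
      ennreal mv_const * (\<integral>\<^sup>+z\<in>ball z1 r. ennreal ((norm (p z))\<^sup>2) \<partial>lborel)"
    using r by (intro holomorphic_square_mean_value)
  also have "(\<integral>\<^sup>+z\<in>ball z1 r. ennreal ((norm (p z))\<^sup>2) \<partial>lborel) \<le>
     (\<integral>\<^sup>+z. 4 * (ennreal ((g z)\<^sup>2) * indicator (cball z0 R) z) \<partial>lborel)"
  proof (rule nn_integral_mono)
    fix z
    show "ennreal ((norm (p z))\<^sup>2) * indicator (ball z1 r) z \<le> 4 * (ennreal ((g z)\<^sup>2) * indicator (cball z0 R) z)"
    proof (cases "z \<in> ball z1 r")
      case True
      then have zR: "z \<in> cball z0 R" using ballsub by auto
      have "norm (p z) * (norm (Z z))\<^sup>2 = g z * (N z1 * N z)"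
        using XZ[OF True] N[OF zR] N[OF z1] by (simp add: p_def g_eq norm_divide norm_mult norm_power)
      also have "\<dots> = g z * ((norm (X z))\<^sup>2 + (norm (Z z))\<^sup>2)" by (simp add: lagrange)
      also have "\<dots> \<le> g z * (2 * (norm (Z z))\<^sup>2)"
        using power_mono[of "norm (X z)" "norm (Z z)" 2] XZ[OF True] gpos[OF zR]
        by (intro mult_left_mono) auto
      finally have "norm (p z) * (norm (Z z))\<^sup>2 \<le> (2 * g z) * (norm (Z z))\<^sup>2" by simp
      moreover have "(norm (Z z))\<^sup>2 > 0" using XZ[OF True] by simp
      ultimately have "norm (p z) \<le> 2 * g z" using mult_le_cancel_right_pos by blast
      then have "(norm (p z))\<^sup>2 \<le> (2 * g z)\<^sup>2" by (intro power_mono) auto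
      then have "ennreal ((norm (p z))\<^sup>2) \<le> ennreal (4 * (g z)\<^sup>2)" by (intro ennreal_leI) (simp add: power_mult_distrib)
      then show ?thesis using True zR by (simp add: ennreal_mult')
    qed simp
  qed
  also have "\<dots> = 4 * (\<integral>\<^sup>+z\<in>cball z0 R. ennreal ((g z)\<^sup>2) \<partial>lborel)"
  proof (rule nn_integral_cmult)
    show "(\<lambda>z. ennreal ((g z)\<^sup>2) * indicator (cball z0 R) z) \<in> borel_measurable lborel"
      using borel_measurable_continuous_ennreal_indicator[OF continuous_on_power[OF cont]] by simp
  qed
  also have "\<dots> \<le> 4 * ennreal A" using A(1) by (intro mult_left_mono) (auto simp: g_def)
  finally have "ennreal ((norm (p z1) * r)\<^sup>2) \<le> ennreal mv_const * (4 * ennreal A)"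
    by (simp add: mult_left_mono)
  also have "\<dots> = ennreal (4 * mv_const * A)"
    using A(2) mv_const_pos by (simp add: ennreal_mult' mult_ac flip: ennreal_numeral)
  finally have le: "(norm (p z1) * r)\<^sup>2 \<le> 4 * mv_const * A"
    using A(2) mv_const_pos by (subst (asm) ennreal_le_iff) auto
  have "norm (p z1) = s"
  proof -
    have "Z z1 = of_real (N z1)" unfolding Z_def N_def of_real_add complex_norm_square by (simp add: mult.commute)
    then show ?thesis using N[OF z1] by (simp add: p_def s_def g_eq norm_divide norm_mult power2_eq_square)
  qed
  with le have le: "(s * r)\<^sup>2 \<le> 4 * mv_const * A" by simp
  \<comment> \<open>Smallness of \<open>A\<close> excludes the other value of the minimum, which
    would give s r = 1 / 8; the threshold 256 is 4 * 64.\<close>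
  have "r = \<rho>"
  proof (rule ccontr)
    assume "r \<noteq> \<rho>"
    then have sr: "s * r = 1 / 8" using s by (simp add: r_def min_def split: if_splits)
    have "(s * r)\<^sup>2 = 1 / 64" unfolding sr by (simp add: power2_eq_square)
    then show False using le A(3) by (simp add: mult.assoc)
  qed
  have "(R * g z0)\<^sup>2 \<le> (2 * \<rho> * s)\<^sup>2" using Rg R gpos[OF z0b] by (intro power_mono) auto
  also have "\<dots> = 4 * (s * r)\<^sup>2" by (simp add: \<open>r = \<rho>\<close> power_mult_distrib)
  finally show ?thesis using le by (simp add: g_def)
qed

section \<open>Lebesgue measure and complex conjugation\<close>

lemma lborel_distr_cnj: "distr lborel borel cnj = lborel"
proof (rule lborel_eqI[symmetric])
  fix l u :: complex assume lu: "\<And>b. b \<in> Basis \<Longrightarrow> l \<bullet> b \<le> u \<bullet> b"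
  have le: "Re l \<le> Re u" "Im l \<le> Im u" using lu[of 1] lu[of \<i>] by (auto simp: Basis_complex_def inner_complex_def)
  have vim: "cnj -` box l u = box (Complex (Re l) (- Im u)) (Complex (Re u) (- Im l))"
    by (auto simp: box_def Basis_complex_def inner_complex_def)
  have "emeasure (distr lborel borel cnj) (box l u) = emeasure lborel (cnj -` box l u)"
    by (subst emeasure_distr) (auto intro!: borel_measurable_continuous_onI continuous_intros)
  also have "\<dots> = ennreal ((Re u - Re l) * (Im u - Im l))"
    unfolding vim using le by (subst emeasure_lborel_box)
      (auto simp: Basis_complex_def inner_complex_def prod_ennreal)
  finally show "emeasure (distr lborel borel cnj) (box l u) = (\<Prod>b\<in>Basis. (u - l) \<bullet> b)"
    using le by (simp add: Basis_complex_def inner_complex_def)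
qed simp

lemma nn_integral_cnj:
  assumes [measurable]: "f \<in> borel_measurable borel"
  shows "(\<integral>\<^sup>+z. f (cnj z) \<partial>lborel) = (\<integral>\<^sup>+z. f z \<partial>lborel)"
proof -
  have "(\<integral>\<^sup>+z. f z \<partial>lborel) = (\<integral>\<^sup>+z. f z \<partial>distr lborel borel cnj)" by (simp add: lborel_distr_cnj)
  also have "\<dots> = (\<integral>\<^sup>+z. f (cnj z) \<partial>lborel)"
    by (subst nn_integral_distr) (auto intro!: borel_measurable_continuous_onI continuous_intros)
  finally show ?thesis by simp
qed

text \<open>The area estimate compares a point with its mirror image, and does so off the real
  axis.\<close>

lemma AE_lborel_Im_nonzero: "AE z in lborel. Im z \<noteq> 0"
proof (rule AE_I)
  have "negligible {z::complex. \<i> \<bullet> z = 0}" by (rule negligible_hyperplane) simp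
  then have "{z. Im z = 0} \<in> null_sets lebesgue"
    by (simp add: negligible_iff_null_sets inner_complex_def)
  moreover have "closed {z. Im z = 0}" by (simp add: closed_halfspace_Im_eq)
  ultimately show "emeasure lborel {z. Im z = 0} = 0" "{z. Im z = 0} \<in> sets lborel"
    by (auto simp: null_sets_def)
qed auto

lemma open_Dplus [simp]: "open (Dplus \<epsilon>)"
proof -
  have "Dplus \<epsilon> = ball 0 \<epsilon> \<inter> {z. 0 < Im z}" by (auto simp: Dplus_def)
  then show ?thesis by (simp add: open_Int open_halfspace_Im_gt)
qed

lemma open_Dstar [simp]: "open (Dstar \<epsilon>)"
proof -
  have "Dstar \<epsilon> = ball 0 \<epsilon> - {0}" by (auto simp: Dstar_def)
  then show ?thesis by (simp add: open_delete)
qed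

(* The integral bounds the spherical area of u/v on the half disc; the hypotheses on N say that the
   area of its continuation to a sector of opening larger than pi is comparable. *)
lemma finite_area_imp_large_norm:
  fixes u v :: "complex \<Rightarrow> complex" and C \<epsilon> :: real
  defines "N \<equiv> \<lambda>\<zeta>. (norm (u \<zeta>))\<^sup>2 + (norm (v \<zeta>))\<^sup>2"
  assumes eps: "\<epsilon> > 0"
    and hol: "u holomorphic_on {\<zeta>. Re \<zeta> < ln \<epsilon>}" "v holomorphic_on {\<zeta>. Re \<zeta> < ln \<epsilon>}"
    and W: "\<And>\<zeta>. Re \<zeta> < ln \<epsilon> \<Longrightarrow> wronskian u v \<zeta> = 1"
    and cnj: "\<And>\<zeta>. Re \<zeta> < ln \<epsilon> \<Longrightarrow> N (cnj \<zeta>) = N \<zeta>"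
    and shift: "\<And>\<zeta>. Re \<zeta> < ln \<epsilon> \<Longrightarrow> N (\<zeta> + 2 * of_real pi * \<i>) \<le> C * N \<zeta>" and C: "C \<ge> 1"
    and area: "(\<integral>\<^sup>+z\<in>Dplus \<epsilon>. ennreal ((1 / (norm z * N (Ln z)))\<^sup>2) \<partial>lborel) < \<infinity>"
  shows "\<exists>X\<le>ln \<epsilon>. \<forall>\<zeta>. Re \<zeta> < X \<and> - pi \<le> Im \<zeta> \<and> Im \<zeta> \<le> 3 * pi \<longrightarrow> M \<le> N \<zeta>"
proof -
  let ?H = "{\<zeta>. Re \<zeta> < ln \<epsilon>}"
  have oH: "open ?H" by (rule open_halfspace_Re_lt)
  have Npos: "N \<zeta> > 0" if "Re \<zeta> < ln \<epsilon>" for \<zeta>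
  proof -
    have "u \<zeta> \<noteq> 0 \<or> v \<zeta> \<noteq> 0" using W[OF that] by (auto simp: wronskian_def)
    then show ?thesis unfolding N_def by (rule norm_square_sum_pos)
  qed
  \<comment> \<open>The branch of the logarithm cut along the negative imaginary axis. Its domain
    contains the disc of radius |z| / 2 around every nonzero z of the closed upper half plane near
    the puncture, which is not so for the principal branch.\<close>
  define L where "L z = Ln (- \<i> * z) + of_real (pi / 2) * \<i>" for z
  define \<Omega> where "\<Omega> = {z \<in> Dstar \<epsilon>. - \<i> * z \<notin> \<real>\<^sub>\<le>\<^sub>0}"
  have open\<Omega>: "open \<Omega>"
  proof -
    have "\<Omega> = Dstar \<epsilon> \<inter> (\<lambda>z. - \<i> * z) -` (- \<real>\<^sub>\<le>\<^sub>0)" by (auto simp: \<Omega>_def)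
    moreover have "open ((\<lambda>z. - \<i> * z) -` (- \<real>\<^sub>\<le>\<^sub>0))"
      by (intro open_vimage continuous_intros) (simp add: open_Compl)
    ultimately show ?thesis by (simp add: open_Int)
  qed
  have Re_L: "Re (L z) = ln (norm z)" if "z \<noteq> 0" for z
    using that by (simp add: L_def norm_mult)
  have exp_half: "exp (of_real pi * \<i> / 2) = \<i>"
    using cis_conv_exp[of "pi / 2"] by (simp add: mult.commute)
  have divi: "w / \<i> = - \<i> * w" for w :: complex
    by (simp add: divide_eq_eq complex_eq_iff)
  have exp_L: "exp (L z) = z" if "z \<noteq> 0" for z
  proof -
    have "exp (Ln (- \<i> * z)) = - \<i> * z" using that by (simp add: exp_Ln)
    moreover have "- \<i> * z * \<i> = z" by (simp add: complex_eq_iff)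
    ultimately show ?thesis by (simp add: L_def exp_add exp_half)
  qed
  have L_Ln: "L z = Ln z" if "Im z > 0" for z
  proof -
    have z0: "z \<noteq> 0" using that by auto
    have "- \<i> * z = exp (Ln z - of_real (pi / 2) * \<i>)"
      using z0 by (simp add: exp_diff exp_half divi)
    then have "L z = Ln (exp (Ln z - of_real (pi / 2) * \<i>)) + of_real (pi / 2) * \<i>" by (simp add: L_def)
    moreover have "0 < Im (Ln z)" "Im (Ln z) < pi" using Im_Ln_pos_lt_imp[of z] that Im_Ln_pos_lt[OF z0] by auto
    ultimately show ?thesis by (simp add: Ln_exp)
  qed
  have LH: "Re (L z) < ln \<epsilon>" if "z \<in> \<Omega>" for z
    using that eps by (subst Re_L) (auto simp: \<Omega>_def Dstar_def)
  have dL: "(L has_field_derivative 1 / z) (at z)" if "z \<in> \<Omega>" for z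
    unfolding L_def using that by (auto intro!: derivative_eq_intros simp: \<Omega>_def Dstar_def field_simps)
  have Lhol: "L holomorphic_on \<Omega>" using dL open\<Omega> holomorphic_on_open by blast
  define U V where "U z = u (L z)" and "V z = v (L z)" for z
  have UV: "U holomorphic_on \<Omega>" "V holomorphic_on \<Omega>"
    unfolding U_def V_def using LH
    by (auto intro!: holomorphic_on_compose_gen[OF Lhol, unfolded o_def] hol)
  have dU: "deriv U z = deriv u (L z) * (1 / z)" "deriv V z = deriv v (L z) * (1 / z)" if "z \<in> \<Omega>" for z
  proof -
    have LzH: "L z \<in> ?H" using LH[OF that] by simp
    show "deriv U z = deriv u (L z) * (1 / z)" "deriv V z = deriv v (L z) * (1 / z)"
      using DERIV_chain2[OF holomorphic_derivI[OF hol(1) oH LzH] dL[OF that]]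
        DERIV_chain2[OF holomorphic_derivI[OF hol(2) oH LzH] dL[OF that]]
      by (auto simp: U_def[abs_def] V_def[abs_def] intro!: DERIV_imp_deriv)
  qed
  have WUV: "wronskian U V z = 1 / z" if "z \<in> \<Omega>" for z
    using W[OF LH[OF that]] that unfolding wronskian_def dU[OF that]
    by (simp add: U_def V_def divide_simps \<Omega>_def Dstar_def algebra_simps)
  define \<sigma> where "\<sigma> z = norm (wronskian U V z) / ((norm (U z))\<^sup>2 + (norm (V z))\<^sup>2)" for z
  have \<sigma>_eq: "\<sigma> z = 1 / (norm z * N (L z))" if "z \<in> \<Omega>" for z
    by (simp add: \<sigma>_def WUV[OF that] N_def U_def V_def norm_divide)
  define f where "f z = ennreal ((1 / (norm z * N (Ln z)))\<^sup>2) * indicator (Dplus \<epsilon>) z" for z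
  have f_meas [measurable]: "f \<in> borel_measurable borel"
  proof -
    have Ln_cont: "continuous_on (Dplus \<epsilon>) Ln"
      by (intro continuous_intros) (auto simp: Dplus_def complex_nonpos_Reals_iff)
    have Ln_H: "Re (Ln z) < ln \<epsilon>" if "z \<in> Dplus \<epsilon>" for z
    proof -
      have "z \<noteq> 0" using that by (auto simp: Dplus_def)
      then show ?thesis using that eps by (simp add: Dplus_def)
    qed
    have "continuous_on (Dplus \<epsilon>) (\<lambda>z. u (Ln z))" "continuous_on (Dplus \<epsilon>) (\<lambda>z. v (Ln z))"
      using Ln_H by (auto intro!: continuous_on_compose2[OF holomorphic_on_imp_continuous_on[OF hol(1)] Ln_cont]
          continuous_on_compose2[OF holomorphic_on_imp_continuous_on[OF hol(2)] Ln_cont])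
    moreover have "\<forall>z\<in>Dplus \<epsilon>. norm z * ((norm (u (Ln z)))\<^sup>2 + (norm (v (Ln z)))\<^sup>2) \<noteq> 0"
    proof
      fix z assume z: "z \<in> Dplus \<epsilon>"
      then have "z \<noteq> 0" by (auto simp: Dplus_def)
      then show "norm z * ((norm (u (Ln z)))\<^sup>2 + (norm (v (Ln z)))\<^sup>2) \<noteq> 0"
        using Npos[OF Ln_H[OF z]] unfolding N_def by (metis less_irrefl mult_eq_0_iff norm_eq_zero)
    qed
    ultimately have "continuous_on (Dplus \<epsilon>) (\<lambda>z. (1 / (norm z * N (Ln z)))\<^sup>2)"
      unfolding N_def by (intro continuous_intros) auto
    then show ?thesis
      unfolding f_def by (intro borel_measurable_continuous_ennreal_indicator) auto
  qed
  \<comment> \<open>The density in the lower half plane is compared with that at the mirror image;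
    the factor \<open>C^2\<close> pays for the change of branch.\<close>
  have pw: "ennreal ((\<sigma> z)\<^sup>2) * indicator \<Omega> z \<le> f z + ennreal (C\<^sup>2) * f (cnj z)" if "Im z \<noteq> 0" for z
  proof (cases "z \<in> \<Omega>")
    case True
    then have z0: "z \<noteq> 0" and ze: "norm z < \<epsilon>" by (auto simp: \<Omega>_def Dstar_def)
    show ?thesis
    proof (cases "Im z > 0")
      case True
      have "L z = Ln z" using True by (rule L_Ln)
      then show ?thesis using True ze \<open>z \<in> \<Omega>\<close> \<sigma>_eq by (simp add: f_def Dplus_def)
    next
      case False
      then have Im: "Im z < 0" using that by simp
      \<comment> \<open>The first case occurs to the right of the cut, the second to its
        left.\<close>
      have Lc: "L (cnj z) = cnj (L z) \<or> L (cnj z) = cnj (L z) + 2 * of_real pi * \<i>"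
      proof -
        have "exp (L (cnj z)) = exp (cnj (L z))" using z0 by (simp add: exp_L flip: exp_cnj)
        then obtain n :: int where n: "L (cnj z) = cnj (L z) + of_int (2 * n) * of_real pi * \<i>"
          by (auto simp: exp_eq)
        have "Im (Ln (cnj z)) > 0" "Im (Ln (cnj z)) < pi"
          using Im_Ln_pos_lt_imp[of "cnj z"] Im_Ln_pos_lt[of "cnj z"] z0 Im by auto
        moreover have "Im (L (cnj z)) = Im (Ln (cnj z))" using L_Ln[of "cnj z"] Im by simp
        moreover have "- pi / 2 < Im (L z)" "Im (L z) \<le> 3 * pi / 2"
          using mpi_less_Im_Ln[of "- \<i> * z"] Im_Ln_le_pi[of "- \<i> * z"] z0 by (auto simp: L_def)
        moreover have "Im (L (cnj z)) = - Im (L z) + 2 * of_int n * pi" by (simp add: n)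
        ultimately have "- 1 / 2 * pi < 2 * of_int n * pi \<and> 2 * of_int n * pi < 5 / 2 * pi"
          by linarith
        then have "- 1 / 2 < 2 * real_of_int n" "2 * real_of_int n < 5 / 2"
          by (simp_all only: mult_less_cancel_right_pos pi_gt_zero)
        then have "n = 0 \<or> n = 1" by linarith
        then show ?thesis using n by auto
      qed
      have Lc': "L (cnj z) = Ln (cnj z)" using Im by (intro L_Ln) simp
      have "N (L (cnj z)) \<le> C * N (L z)"
        using Lc
      proof
        assume "L (cnj z) = cnj (L z)"
        then have "N (L (cnj z)) = N (L z)" using cnj[OF LH[OF \<open>z \<in> \<Omega>\<close>]] by simp
        then show ?thesis using C Npos[OF LH[OF \<open>z \<in> \<Omega>\<close>]] by (simp add: mult_le_cancel_right1)
      next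
        assume "L (cnj z) = cnj (L z) + 2 * of_real pi * \<i>"
        then show ?thesis
          using shift[of "cnj (L z)"] cnj[OF LH[OF \<open>z \<in> \<Omega>\<close>]] LH[OF \<open>z \<in> \<Omega>\<close>] by simp
      qed
      moreover have "N (L (cnj z)) > 0" using Npos[of "L (cnj z)"] Re_L[of "cnj z"] z0 ze eps by simp
      moreover have "N (L z) > 0" using Npos LH True by simp
      ultimately have "\<sigma> z \<le> C * (1 / (norm (cnj z) * N (Ln (cnj z))))"
        using z0 by (simp add: \<sigma>_eq[OF True] Lc' divide_simps mult_ac)
      then have "(\<sigma> z)\<^sup>2 \<le> (C * (1 / (norm (cnj z) * N (Ln (cnj z)))))\<^sup>2"
        by (intro power_mono) (auto simp: \<sigma>_def)
      then have "ennreal ((\<sigma> z)\<^sup>2) \<le> ennreal (C\<^sup>2) * ennreal ((1 / (norm (cnj z) * N (Ln (cnj z))))\<^sup>2)"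
        by (simp add: power_mult_distrib power_divide ennreal_mult'[symmetric] ennreal_leI)
      moreover have "cnj z \<in> Dplus \<epsilon>" using Im ze by (simp add: Dplus_def)
      ultimately have "ennreal ((\<sigma> z)\<^sup>2) * indicator \<Omega> z \<le> ennreal (C\<^sup>2) * f (cnj z)"
        using True by (simp add: f_def)
      then show ?thesis by (simp add: add_increasing)
    qed
  qed simp
  have cont\<sigma>: "continuous_on \<Omega> (\<lambda>z. (\<sigma> z)\<^sup>2)"
  proof -
    have "\<forall>z\<in>\<Omega>. (norm (U z))\<^sup>2 + (norm (V z))\<^sup>2 \<noteq> 0"
      using Npos[OF LH] unfolding U_def V_def N_def by force
    then show ?thesis unfolding \<sigma>_def wronskian_def
      using UV open\<Omega> by (intro continuous_intros holomorphic_on_imp_continuous_on holomorphic_deriv) auto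
  qed
  define h where "h z = ennreal ((\<sigma> z)\<^sup>2) * indicator \<Omega> z" for z
  have h_meas [measurable]: "h \<in> borel_measurable borel"
    unfolding h_def using cont\<sigma> open\<Omega> by (intro borel_measurable_continuous_ennreal_indicator) auto
  have cnj_meas [measurable]: "cnj \<in> borel_measurable borel"
    by (intro borel_measurable_continuous_onI continuous_intros)
  have "(\<integral>\<^sup>+z. h z \<partial>lborel) \<le> (\<integral>\<^sup>+z. f z + ennreal (C\<^sup>2) * f (cnj z) \<partial>lborel)"
    using AE_lborel_Im_nonzero by (intro nn_integral_mono_AE) (auto elim!: eventually_mono simp: h_def pw)
  also have "\<dots> = (\<integral>\<^sup>+z. f z \<partial>lborel) + ennreal (C\<^sup>2) * (\<integral>\<^sup>+z. f (cnj z) \<partial>lborel)"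
    by (subst nn_integral_add) (auto simp: nn_integral_cmult)
  also have "(\<integral>\<^sup>+z. f (cnj z) \<partial>lborel) = (\<integral>\<^sup>+z. f z \<partial>lborel)" by (rule nn_integral_cnj) simp
  also have "(\<integral>\<^sup>+z. f z \<partial>lborel) + ennreal (C\<^sup>2) * (\<integral>\<^sup>+z. f z \<partial>lborel) < \<infinity>"
    using area by (simp add: f_def ennreal_mult_less_top)
  finally have hfin: "(\<integral>\<^sup>+z. h z \<partial>lborel) < \<infinity>" .
  \<comment> \<open>By continuity from above of a finite measure, the area over discs shrinking to
    the puncture tends to zero.\<close>
  define B where "B n = cball (0::complex) (1 / Suc n) \<inter> \<Omega>" for n :: nat
  have "(\<lambda>n. emeasure (density lborel h) (B n)) \<longlonglongrightarrow> emeasure (density lborel h) (\<Inter>n. B n)"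
  proof (rule Lim_emeasure_decseq)
    show "range B \<subseteq> sets (density lborel h)" using open\<Omega> by (auto simp: B_def)
    show "decseq B"
    proof (unfold decseq_def, intro allI impI)
      fix m n :: nat assume "m \<le> n"
      then have "1 / real (Suc n) \<le> 1 / real (Suc m)" by (intro frac_le) auto
      then have "cball (0::complex) (1 / Suc n) \<subseteq> cball 0 (1 / Suc m)" by (rule subset_cball)
      then show "B n \<subseteq> B m" unfolding B_def by blast
    qed
    show "emeasure (density lborel h) (B i) \<noteq> \<infinity>" for i
    proof -
      have "emeasure (density lborel h) (B i) \<le> (\<integral>\<^sup>+z. h z \<partial>lborel)"
        using open\<Omega> by (subst emeasure_density) (auto simp: B_def indicator_def intro!: nn_integral_mono)
      then show ?thesis using hfin by (auto simp: top_unique)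
    qed
  qed
  moreover have "(\<Inter>n. B n) = {}"
  proof -
    have False if z: "\<And>n. z \<in> B n" for z
    proof -
      have "norm z > 0" using z[of 0] by (auto simp: B_def \<Omega>_def Dstar_def)
      then obtain n where "1 / real (Suc n) < norm z" using nat_approx_posE by blast
      then show False using z[of n] by (simp add: B_def)
    qed
    then show ?thesis by auto
  qed
  ultimately have lim: "(\<lambda>n. emeasure (density lborel h) (B n)) \<longlonglongrightarrow> 0" by simp
  \<comment> \<open>\<open>K\<close> includes the factor \<open>C\<close> that is lost when the
    bound is carried over a turn. \<open>A\<close> satisfies the smallness condition for the
    spherical derivative bound, which on a disc of radius |z0| / 2 then reads (1 / (2 N))^2 \<le> 1
    / (32 (K^2 + 1)).\<close>
  define K where "K = C * \<bar>M\<bar>"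
  define A where "A = 1 / (512 * mv_const * (K\<^sup>2 + 1))"
  have K1: "K\<^sup>2 + 1 > 0" by (simp add: add_nonneg_pos)
  have A: "A > 0" "256 * mv_const * A < 1" "16 * mv_const * A = 1 / (32 * (K\<^sup>2 + 1))"
    using mv_const_pos K1 add_pos_nonneg[of 256 "512 * K\<^sup>2"] by (auto simp: A_def divide_simps)
  obtain n where n: "emeasure (density lborel h) (B n) < ennreal A"
    using order_tendstoD(2)[OF lim, of "ennreal A"] A by (auto simp: eventually_sequentially)
  define r where "r = min \<epsilon> (1 / Suc n) / 2"
  have r: "r > 0" "2 * r \<le> \<epsilon>" "2 * r \<le> 1 / Suc n" using eps by (auto simp: r_def)
  have main: "K \<le> N \<zeta>" if \<zeta>: "Re \<zeta> < ln r" "0 \<le> Im \<zeta>" "Im \<zeta> \<le> pi" for \<zeta>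
  proof -
    define z0 where "z0 = exp \<zeta>"
    have nz0: "norm z0 < r" "norm z0 > 0"
      using \<zeta>(1) r by (auto simp: z0_def norm_exp_eq_Re) (metis exp_less_cancel_iff exp_ln)
    have Im0: "Im z0 \<ge> 0" using \<zeta> by (simp add: z0_def Im_exp sin_ge_zero)
    define R where "R = norm z0 / 2"
    have sub: "cball z0 R \<subseteq> B n"
    proof
      fix z assume "z \<in> cball z0 R"
      then have zd: "norm (z - z0) \<le> norm z0 / 2" by (simp add: R_def dist_norm norm_minus_commute)
      have "norm z \<le> norm (z - z0) + norm z0" using norm_triangle_ineq[of "z - z0" z0] by simp
      then have "norm z < 2 * r" using zd nz0 by linarith
      moreover have "z \<noteq> 0" using zd nz0 by auto
      moreover have "- \<i> * z \<notin> \<real>\<^sub>\<le>\<^sub>0"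
      proof
        assume "- \<i> * z \<in> \<real>\<^sub>\<le>\<^sub>0"
        then have "Re z = 0" "Im z \<le> 0" by (auto simp: complex_nonpos_Reals_iff)
        have "(norm z0)\<^sup>2 \<le> (norm (z - z0))\<^sup>2"
          unfolding cmod_power2 using \<open>Re z = 0\<close> \<open>Im z \<le> 0\<close> Im0
          by (auto simp: abs_le_square_iff[symmetric] power2_eq_square[symmetric] intro!: add_mono)
        then have "norm z0 \<le> norm (z - z0)" by (rule power2_le_imp_le) simp
        then show False using zd nz0 by simp
      qed
      ultimately show "z \<in> B n" using r by (auto simp: B_def \<Omega>_def Dstar_def)
    qed
    then have sub\<Omega>: "cball z0 R \<subseteq> \<Omega>" by (auto simp: B_def)
    have z0\<Omega>: "z0 \<in> \<Omega>" using sub\<Omega> nz0 by (auto simp: R_def)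
    have "(R * \<sigma> z0)\<^sup>2 \<le> 16 * mv_const * A"
      unfolding \<sigma>_def
    proof (rule spherical_derivative_bound[OF open\<Omega> sub\<Omega> _ UV])
      show "R > 0" using nz0 by (simp add: R_def)
      show "wronskian U V z \<noteq> 0" if "z \<in> cball z0 R" for z
        using WUV[of z] sub\<Omega> that by (auto simp: \<Omega>_def Dstar_def)
      have "(\<integral>\<^sup>+z\<in>cball z0 R. ennreal ((\<sigma> z)\<^sup>2) \<partial>lborel) \<le> (\<integral>\<^sup>+z. h z * indicator (B n) z \<partial>lborel)"
        using sub sub\<Omega> by (intro nn_integral_mono) (auto simp: h_def indicator_def)
      also have "\<dots> = emeasure (density lborel h) (B n)"
        using open\<Omega> by (subst emeasure_density) (auto simp: B_def)
      also have "\<dots> \<le> ennreal A" using n by simp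
      finally show "(\<integral>\<^sup>+z\<in>cball z0 R. ennreal ((norm (wronskian U V z) / ((norm (U z))\<^sup>2 + (norm (V z))\<^sup>2))\<^sup>2) \<partial>lborel) \<le> ennreal A"
        by (simp add: \<sigma>_def)
    qed (use A in auto)
    moreover have "L z0 = \<zeta>"
    proof -
      have "- \<i> * z0 = exp (\<zeta> - of_real (pi / 2) * \<i>)"
        by (simp add: z0_def exp_diff exp_half divi)
      then have "L z0 = Ln (exp (\<zeta> - of_real (pi / 2) * \<i>)) + of_real (pi / 2) * \<i>" by (simp add: L_def)
      then show ?thesis using \<zeta> pi_gt_zero by (simp add: Ln_exp)
    qed
    ultimately have "(1 / (2 * N \<zeta>))\<^sup>2 \<le> 1 / (32 * (K\<^sup>2 + 1))"
      using nz0 by (simp add: \<sigma>_eq[OF z0\<Omega>] A(3) R_def)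
    moreover have "N \<zeta> > 0" using LH[OF z0\<Omega>] Npos \<open>L z0 = \<zeta>\<close> by simp
    ultimately have "K\<^sup>2 \<le> (N \<zeta>)\<^sup>2" using K1 by (simp add: power_divide divide_simps power_mult_distrib)
    then show ?thesis using \<open>N \<zeta> > 0\<close> power2_le_imp_le less_imp_le by blast
  qed
  have K: "M \<le> K" "\<bar>M\<bar> \<le> K" using mult_right_mono[OF C, of "\<bar>M\<bar>"] by (auto simp: K_def)
  have lnr: "ln r \<le> ln \<epsilon>" using r by simp
  \<comment> \<open>The heights from 0 to pi are extended first by reflection, and then up to 3 pi
    by a reflection followed by a turn.\<close>
  have sym: "K \<le> N \<zeta>" if \<zeta>: "Re \<zeta> < ln r" "- pi \<le> Im \<zeta>" "Im \<zeta> \<le> pi" for \<zeta>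
  proof (cases "0 \<le> Im \<zeta>")
    case False
    have "K \<le> N (cnj \<zeta>)" using \<zeta> False by (intro main) auto
    then show ?thesis using cnj[of \<zeta>] \<zeta> lnr by simp
  qed (use \<zeta> main in auto)
  have "M \<le> N \<zeta>" if \<zeta>: "Re \<zeta> < ln r" "- pi \<le> Im \<zeta>" "Im \<zeta> \<le> 3 * pi" for \<zeta>
  proof (cases "Im \<zeta> \<le> pi")
    case True
    then show ?thesis using sym[of \<zeta>] \<zeta> K by simp
  next
    case False
    have "K \<le> N (cnj \<zeta> + 2 * of_real pi * \<i>)" using \<zeta> False by (intro sym) auto
    also have "\<dots> \<le> C * N \<zeta>" using shift[of "cnj \<zeta>"] cnj[of \<zeta>] \<zeta> lnr by simp
    finally have "\<bar>M\<bar> \<le> N \<zeta>" using C by (simp add: K_def)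
    then show ?thesis by simp
  qed
  then show ?thesis using lnr by blast
qed

section \<open>Monodromy\<close>

definition turn :: complex where "turn = 2 * of_real pi * \<i>"

lemma Re_turn [simp]: "Re turn = 0" and Im_turn [simp]: "Im turn = 2 * pi"
  and cnj_turn [simp]: "cnj turn = - turn" and exp_turn [simp]: "exp turn = 1"
  and turn_nonzero [simp]: "turn \<noteq> 0"
  by (auto simp: turn_def complex_eq_iff)

text \<open>One turn, from 0 to 2 pi, with a margin pi on either side. The margin equals the radius
  of the discs in the Harnack estimate and leaves room for comparing a point with its
  translate.\<close>

definition left_strip :: "real \<Rightarrow> complex set" where
  "left_strip X = {\<zeta>. Re \<zeta> < X \<and> - pi \<le> Im \<zeta> \<and> Im \<zeta> \<le> 3 * pi}"

text \<open>For a constant Wronskian this means that the spherical derivative of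
  \<open>u / v\<close> tends to zero, uniformly over the height of the strip.\<close>

definition blowup :: "(complex \<Rightarrow> complex) \<Rightarrow> (complex \<Rightarrow> complex) \<Rightarrow> bool" where
  "blowup u v \<longleftrightarrow> (\<forall>M. \<exists>X. \<forall>\<zeta>\<in>left_strip X. M \<le> (norm (u \<zeta>))\<^sup>2 + (norm (v \<zeta>))\<^sup>2)"

lemma blowup_linear_change:
  assumes "blowup u v" and c: "c > 0"
    and le: "\<And>\<zeta>. Re \<zeta> < X0 \<Longrightarrow> c * ((norm (u \<zeta>))\<^sup>2 + (norm (v \<zeta>))\<^sup>2) \<le> (norm (u' \<zeta>))\<^sup>2 + (norm (v' \<zeta>))\<^sup>2"
  shows "blowup u' v'"
  unfolding blowup_def
proof
  fix M
  obtain X where X: "\<And>\<zeta>. \<zeta> \<in> left_strip X \<Longrightarrow> M / c \<le> (norm (u \<zeta>))\<^sup>2 + (norm (v \<zeta>))\<^sup>2"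
    using assms(1) unfolding blowup_def by blast
  have "M \<le> (norm (u' \<zeta>))\<^sup>2 + (norm (v' \<zeta>))\<^sup>2" if "\<zeta> \<in> left_strip (min X X0)" for \<zeta>
  proof -
    have "\<zeta> \<in> left_strip X" "Re \<zeta> < X0" using that by (auto simp: left_strip_def)
    from X[OF this(1)] have "M \<le> c * ((norm (u \<zeta>))\<^sup>2 + (norm (v \<zeta>))\<^sup>2)"
      using c by (simp add: divide_le_eq mult.commute)
    also have "\<dots> \<le> (norm (u' \<zeta>))\<^sup>2 + (norm (v' \<zeta>))\<^sup>2" by (rule le) fact
    finally show ?thesis .
  qed
  then show "\<exists>X. \<forall>\<zeta>\<in>left_strip X. M \<le> (norm (u' \<zeta>))\<^sup>2 + (norm (v' \<zeta>))\<^sup>2" by blast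
qed

(* On far vertical segments the quotient u/v moves little on the sphere. *)
lemma blowup_oscillation:
  assumes hol: "u holomorphic_on {\<zeta>. Re \<zeta> < X0}" "v holomorphic_on {\<zeta>. Re \<zeta> < X0}"
    and W: "\<And>\<zeta>. Re \<zeta> < X0 \<Longrightarrow> wronskian u v \<zeta> = w"
    and bl: "blowup u v" and \<delta>: "\<delta> > 0"
  shows "\<exists>X\<le>X0. \<forall>\<zeta>\<in>left_strip X. norm (u (Re \<zeta>) * v \<zeta> - v (Re \<zeta>) * u \<zeta>) \<le>
    \<delta> * (norm (u (Re \<zeta>)) + norm (v (Re \<zeta>))) * (norm (u \<zeta>) + norm (v \<zeta>))"
proof -
  \<comment> \<open>A vertical segment from the real axis to a point of the strip has length at most
    3 pi, and the bound for the quotient has a factor 2.\<close>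
  define s where "s = min \<delta> (1 / 2) / (6 * pi)"
  have s: "s > 0" "2 * s * (3 * pi) \<le> \<delta>" "2 * s * (3 * pi) < 1"
    using \<delta> by (auto simp: s_def min_def field_simps)
  obtain X where X: "\<And>\<zeta>. \<zeta> \<in> left_strip X \<Longrightarrow> (norm w + 1) / s \<le> (norm (u \<zeta>))\<^sup>2 + (norm (v \<zeta>))\<^sup>2"
    using bl unfolding blowup_def by blast
  have "norm (u (Re \<zeta>) * v \<zeta> - v (Re \<zeta>) * u \<zeta>) \<le>
      \<delta> * (norm (u (Re \<zeta>)) + norm (v (Re \<zeta>))) * (norm (u \<zeta>) + norm (v \<zeta>))"
    if \<zeta>: "\<zeta> \<in> left_strip (min X X0)" for \<zeta>
  proof -
    let ?x = "complex_of_real (Re \<zeta>)"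
    have seg: "z \<in> left_strip X \<and> Re z < X0" if z: "z \<in> closed_segment ?x \<zeta>" for z
    proof -
      obtain t where t: "0 \<le> t" "t \<le> 1" "z = (1 - t) *\<^sub>R ?x + t *\<^sub>R \<zeta>"
        using z by (auto simp: closed_segment_def)
      have "Re z = Re \<zeta>" "Im z = t * Im \<zeta>" unfolding t(3) by (simp_all add: algebra_simps)
      moreover have "- pi \<le> t * Im \<zeta>" "t * Im \<zeta> \<le> 3 * pi"
      proof -
        have "t * (- pi) \<le> t * Im \<zeta>" "t * Im \<zeta> \<le> t * (3 * pi)"
          using \<zeta> t by (intro mult_left_mono; simp add: left_strip_def)+
        moreover have "t * pi \<le> pi" "t * (3 * pi) \<le> 3 * pi" using t by (auto simp: mult_left_le_one_le)
        ultimately show "- pi \<le> t * Im \<zeta>" "t * Im \<zeta> \<le> 3 * pi" by linarith+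
      qed
      ultimately show ?thesis using \<zeta> by (auto simp: left_strip_def)
    qed
    have len: "norm (\<zeta> - ?x) \<le> 3 * pi"
    proof -
      have "\<zeta> - ?x = of_real (Im \<zeta>) * \<i>" by (simp add: complex_eq_iff)
      then have "norm (\<zeta> - ?x) = \<bar>Im \<zeta>\<bar>" by (simp add: norm_mult)
      then show ?thesis using \<zeta> by (auto simp: left_strip_def)
    qed
    have sl: "2 * s * norm (\<zeta> - ?x) \<le> 2 * s * (3 * pi)" using len s by (intro mult_left_mono) auto
    have big: "norm w + 1 \<le> s * ((norm (u z))\<^sup>2 + (norm (v z))\<^sup>2)" if "z \<in> closed_segment ?x \<zeta>" for z
      using X[of z] seg[OF that] s by (simp add: divide_le_eq mult.commute)
    have "norm (u ?x * v \<zeta> - v ?x * u \<zeta>) \<le>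
        2 * s * norm (\<zeta> - ?x) * norm (cnj (u ?x) * u \<zeta> + cnj (v ?x) * v \<zeta>)"
    proof (rule segment_quotient_bound(2)[OF _ _ hol])
      show "open {\<zeta>. Re \<zeta> < X0}" by (rule open_halfspace_Re_lt)
      show "closed_segment ?x \<zeta> \<subseteq> {\<zeta>. Re \<zeta> < X0}" using seg by auto
      fix z assume z: "z \<in> closed_segment ?x \<zeta>"
      have "0 < norm w + 1" by (simp add: add_nonneg_pos)
      then have "0 < s * ((norm (u z))\<^sup>2 + (norm (v z))\<^sup>2)" using big[OF z] by linarith
      then show "0 < (norm (u z))\<^sup>2 + (norm (v z))\<^sup>2" using s(1) zero_less_mult_pos by blast
      show "norm (wronskian u v z) \<le> s * ((norm (u z))\<^sup>2 + (norm (v z))\<^sup>2)"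
        using big[OF z] W[of z] seg[OF z] by simp
    next
      show "2 * s * norm (\<zeta> - ?x) < 1" using sl s(3) by linarith
    qed
    also have "\<dots> \<le> \<delta> * norm (cnj (u ?x) * u \<zeta> + cnj (v ?x) * v \<zeta>)"
      using sl s(2) by (intro mult_right_mono) (linarith, simp)
    also have "\<dots> \<le> \<delta> * ((norm (u ?x) + norm (v ?x)) * (norm (u \<zeta>) + norm (v \<zeta>)))"
    proof (intro mult_left_mono)
      have "norm (cnj (u ?x) * u \<zeta> + cnj (v ?x) * v \<zeta>) \<le> norm (u ?x) * norm (u \<zeta>) + norm (v ?x) * norm (v \<zeta>)"
        by (rule order_trans[OF norm_triangle_ineq]) (simp add: norm_mult)
      also have "\<dots> \<le> (norm (u ?x) + norm (v ?x)) * (norm (u \<zeta>) + norm (v \<zeta>))"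
        by (simp add: algebra_simps)
      finally show "norm (cnj (u ?x) * u \<zeta> + cnj (v ?x) * v \<zeta>) \<le> (norm (u ?x) + norm (v ?x)) * (norm (u \<zeta>) + norm (v \<zeta>))" .
    qed (use \<delta> in auto)
    finally show ?thesis by (simp add: mult.assoc)
  qed
  then show ?thesis by (intro exI[of _ "min X X0"]) auto
qed

text \<open>Infinity is an accumulation value of \<open>u / v\<close> at the far end of the negative
  real axis. Compactness yields such a sequence and no more; \<open>ratio_small\<close> makes a
  limit of it.\<close>

definition dominates :: "(complex \<Rightarrow> complex) \<Rightarrow> (complex \<Rightarrow> complex) \<Rightarrow> bool" where
  "dominates u v \<longleftrightarrow> (\<forall>\<eta>>0. \<forall>X. \<exists>x<X. u (of_real x) \<noteq> 0 \<and> norm (v (of_real x)) \<le> \<eta> * norm (u (of_real x)))"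

(* (p, q) is a limit of normalised values of the real pair (y1, y2) along the negative real axis. *)
lemma exists_dominating_combination:
  assumes nz: "\<And>\<zeta>. Re \<zeta> < X0 \<Longrightarrow> y1 \<zeta> \<noteq> 0 \<or> y2 \<zeta> \<noteq> 0"
    and real: "\<And>\<zeta>. Re \<zeta> < X0 \<Longrightarrow> y1 (cnj \<zeta>) = cnj (y1 \<zeta>) \<and> y2 (cnj \<zeta>) = cnj (y2 \<zeta>)"
  obtains p q :: real where "p\<^sup>2 + q\<^sup>2 = 1"
    "dominates (\<lambda>z. of_real p * y1 z + of_real q * y2 z) (\<lambda>z. of_real p * y2 z - of_real q * y1 z)"
proof -
  define x where "x n = X0 - 1 - real n" for n
  \<comment> \<open>The real vector (y1, y2) is coded as a complex number, so that its directions
    lie on the compact unit circle.\<close>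
  define e where "e n = Complex (Re (y1 (of_real (x n)))) (Re (y2 (of_real (x n))))" for n
  have re: "y1 (of_real (x n)) = of_real (Re (e n))" "y2 (of_real (x n)) = of_real (Im (e n))" for n
    using real[of "of_real (x n)"] by (auto simp: e_def x_def complex_eq_iff)
  have e0: "e n \<noteq> 0" for n
    using nz[of "of_real (x n)"] unfolding re by (auto simp: x_def complex_eq_iff)
  define d where "d n = e n / of_real (norm (e n))" for n
  have "\<forall>n. d n \<in> sphere 0 1" using e0 by (auto simp: d_def norm_divide)
  then obtain l r where l: "l \<in> sphere 0 1" "strict_mono (r :: nat \<Rightarrow> nat)" "(d \<circ> r) \<longlonglongrightarrow> l"
    using compact_sphere[of "0::complex" 1] unfolding compact_def by metis
  define p q where "p = Re l" and "q = Im l"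
  have pq: "p\<^sup>2 + q\<^sup>2 = 1" using l(1) by (simp add: p_def q_def flip: cmod_power2)
  let ?u = "\<lambda>z. of_real p * y1 z + of_real q * y2 z" and ?v = "\<lambda>z. of_real p * y2 z - of_real q * y1 z"
  \<comment> \<open>The components of the direction along the limit \<open>l\<close> and
    perpendicular to it; they tend to 1 and 0.\<close>
  define U V where "U n = p * Re (d n) + q * Im (d n)" and "V n = p * Im (d n) - q * Re (d n)" for n
  have U: "?u (of_real (x n)) = of_real (norm (e n) * U n)" "?v (of_real (x n)) = of_real (norm (e n) * V n)" for n
    unfolding re using e0[of n] by (simp_all add: U_def V_def d_def field_simps)
  have "(\<lambda>n. U (r n)) \<longlonglongrightarrow> p * Re l + q * Im l" "(\<lambda>n. V (r n)) \<longlonglongrightarrow> p * Im l - q * Re l"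
    using l(3) unfolding U_def V_def o_def by (intro tendsto_intros; simp)+
  then have lim: "(\<lambda>n. U (r n)) \<longlonglongrightarrow> 1" "(\<lambda>n. V (r n)) \<longlonglongrightarrow> 0"
    using pq by (simp_all add: p_def q_def power2_eq_square mult.commute)
  have "dominates ?u ?v"
    unfolding dominates_def
  proof (intro allI impI)
    fix \<eta> X :: real assume \<eta>: "\<eta> > 0"
    have "\<forall>\<^sub>F n in sequentially. 1 / 2 < U (r n)" by (rule order_tendstoD(1)[OF lim(1)]) simp
    moreover have "\<forall>\<^sub>F n in sequentially. \<bar>V (r n)\<bar> < \<eta> / 2"
      using order_tendstoD(2)[OF tendsto_rabs[OF lim(2)], of "\<eta> / 2"] \<eta> by simp
    moreover have "\<forall>\<^sub>F n in sequentially. x (r n) < X"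
    proof -
      have "\<forall>\<^sub>F n in sequentially. n \<ge> nat \<lceil>X0 - X\<rceil>" by (rule eventually_ge_at_top)
      then show ?thesis
      proof eventually_elim
        case (elim n)
        have "n \<le> r n" using seq_suble[OF l(2)] .
        then have "X0 - X \<le> real (r n)" using elim by linarith
        then show ?case by (simp add: x_def)
      qed
    qed
    ultimately have "\<forall>\<^sub>F n in sequentially. 1 / 2 < U (r n) \<and> \<bar>V (r n)\<bar> < \<eta> / 2 \<and> x (r n) < X"
      by eventually_elim auto
    then obtain n where n: "1 / 2 < U (r n)" "\<bar>V (r n)\<bar> < \<eta> / 2" "x (r n) < X"
      by (auto simp: eventually_sequentially)
    have "\<eta> * (1 / 2) \<le> \<eta> * \<bar>U (r n)\<bar>" using n \<eta> by (intro mult_left_mono) auto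
    then have "\<bar>V (r n)\<bar> \<le> \<eta> * \<bar>U (r n)\<bar>" using n by simp
    then have "norm (e (r n)) * \<bar>V (r n)\<bar> \<le> \<eta> * (norm (e (r n)) * \<bar>U (r n)\<bar>)"
      using mult_left_mono[of "\<bar>V (r n)\<bar>" "\<eta> * \<bar>U (r n)\<bar>" "norm (e (r n))"] by (simp add: mult_ac)
    then have "norm (?v (of_real (x (r n)))) \<le> \<eta> * norm (?u (of_real (x (r n))))"
      unfolding U norm_of_real abs_mult by simp
    moreover have "?u (of_real (x (r n))) \<noteq> 0" unfolding U using n e0 by simp
    ultimately show "\<exists>x<X. ?u (of_real x) \<noteq> 0 \<and> norm (?v (of_real x)) \<le> \<eta> * norm (?u (of_real x))"
      using n(3) by blast
  qed
  then show ?thesis using that pq by blast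
qed

text \<open>Along the dominating sequence \<open>u / v\<close> is near infinity, and one turn later
  it is near a / c. For nonzero \<open>c\<close> this is a finite point, against the small
  oscillation on vertical segments. So the monodromy fixes infinity.\<close>

lemma dominated_shift_coefficient_zero:
  assumes hol: "u holomorphic_on {\<zeta>. Re \<zeta> < X0}" "v holomorphic_on {\<zeta>. Re \<zeta> < X0}"
    and W: "\<And>\<zeta>. Re \<zeta> < X0 \<Longrightarrow> wronskian u v \<zeta> = w"
    and bl: "blowup u v" and dom: "dominates u v"
    and sh: "\<And>\<zeta>. Re \<zeta> < X0 \<Longrightarrow> u (\<zeta> + turn) = a * u \<zeta> + b * v \<zeta>"
        "\<And>\<zeta>. Re \<zeta> < X0 \<Longrightarrow> v (\<zeta> + turn) = c * u \<zeta> + d * v \<zeta>"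
  shows "c = 0"
proof (rule ccontr)
  assume c: "c \<noteq> 0"
  define S where "S = norm a + norm b + norm c + norm d"
  have S: "S > 0" "norm c \<le> S" using c by (auto simp: S_def add_nonneg_pos add_pos_nonneg)
  \<comment> \<open>With \<open>S\<close> the sum of the four norms, each of the two error terms
    becomes |c| / 4.\<close>
  define \<eta> \<delta> where "\<eta> = norm c / (4 * S)" and "\<delta> = norm c / (8 * S)"
  have \<eta>: "\<eta> > 0" "\<eta> \<le> 1" "\<delta> > 0" using c S by (auto simp: \<eta>_def \<delta>_def divide_simps)
  obtain X where X: "X \<le> X0" "\<And>\<zeta>. \<zeta> \<in> left_strip X \<Longrightarrow> norm (u (Re \<zeta>) * v \<zeta> - v (Re \<zeta>) * u \<zeta>) \<le>
    \<delta> * (norm (u (Re \<zeta>)) + norm (v (Re \<zeta>))) * (norm (u \<zeta>) + norm (v \<zeta>))"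
    using blowup_oscillation[OF hol W bl \<eta>(3)] by blast
  obtain x where x: "x < X" "u (of_real x) \<noteq> 0" "norm (v (of_real x)) \<le> \<eta> * norm (u (of_real x))"
    using dom \<eta> unfolding dominates_def by blast
  define t where "t = v (of_real x) / u (of_real x)"
  have t: "norm t \<le> \<eta>" "norm t \<le> 1" "v (of_real x) = t * u (of_real x)"
    using x \<eta> by (auto simp: t_def norm_divide divide_simps intro: order_trans)
  have "of_real x + turn \<in> left_strip X" using x by (simp add: left_strip_def)
  from X(2)[OF this] have "norm (u (of_real x) * (c * u (of_real x) + d * v (of_real x)) - v (of_real x) * (a * u (of_real x) + b * v (of_real x)))
     \<le> \<delta> * (norm (u (of_real x)) + norm (v (of_real x))) *
       (norm (a * u (of_real x) + b * v (of_real x)) + norm (c * u (of_real x) + d * v (of_real x)))"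
    using sh[of "of_real x"] x X(1) by simp
  also have "u (of_real x) * (c * u (of_real x) + d * v (of_real x)) - v (of_real x) * (a * u (of_real x) + b * v (of_real x))
     = (c + t * (d - a - b * t)) * (u (of_real x) * u (of_real x))" unfolding t(3) by (simp add: algebra_simps)
  also have "a * u (of_real x) + b * v (of_real x) = (a + b * t) * u (of_real x)" unfolding t(3) by (simp add: algebra_simps)
  also have "c * u (of_real x) + d * v (of_real x) = (c + d * t) * u (of_real x)" unfolding t(3) by (simp add: algebra_simps)
  also have "\<delta> * (norm (u (of_real x)) + norm (v (of_real x))) * (norm ((a + b * t) * u (of_real x)) + norm ((c + d * t) * u (of_real x)))
      = (\<delta> * (1 + norm t) * (norm (a + b * t) + norm (c + d * t))) * (norm (u (of_real x)) * norm (u (of_real x)))"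
    unfolding t(3) norm_mult by (simp add: algebra_simps)
  finally have le: "norm (c + t * (d - a - b * t)) \<le> \<delta> * (1 + norm t) * (norm (a + b * t) + norm (c + d * t))"
    using x(2) unfolding norm_mult by (subst (asm) mult_le_cancel_right_pos) auto
  have bt: "norm (b * t) \<le> norm b" "norm (d * t) \<le> norm d"
    using t(2) by (auto simp: norm_mult mult_left_le)
  have "norm (t * (d - a - b * t)) \<le> \<eta> * S"
    unfolding norm_mult
  proof (rule mult_mono[OF t(1)])
    have "norm (d - a - b * t) \<le> norm d + norm a + norm (b * t)"
      by (metis add_right_mono norm_triangle_ineq4 order_trans)
    then show "norm (d - a - b * t) \<le> S" using bt unfolding S_def by (smt (verit) norm_ge_zero)
  qed (use \<eta> in auto)
  moreover have "\<eta> * S = norm c / 4" using S by (simp add: \<eta>_def)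
  moreover have "norm c \<le> norm (c + t * (d - a - b * t)) + norm (t * (d - a - b * t))"
    using norm_triangle_ineq4[of "c + t * (d - a - b * t)" "t * (d - a - b * t)"] by simp
  moreover have "\<delta> * (1 + norm t) * (norm (a + b * t) + norm (c + d * t)) \<le> \<delta> * 2 * S"
  proof (intro mult_mono)
    show "norm (a + b * t) + norm (c + d * t) \<le> S"
      using norm_triangle_ineq[of a "b * t"] norm_triangle_ineq[of c "d * t"] bt unfolding S_def by linarith
  qed (use \<eta> t S in auto)
  moreover have "\<delta> * 2 * S = norm c / 4" using S by (simp add: \<delta>_def)
  ultimately have "norm c \<le> norm c / 2" using le by linarith
  then show False using c by simp
qed

text \<open>By the Cauchy-Riemann equations the horizontal derivative is -i times the vertical one,
  so differentiation under the integral leaves a difference of end values. It vanishes for periodic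
  f, and it will be bounded when f is the logarithm of the dominating solution.\<close>

lemma vertical_integral_derivative:
  assumes f: "f holomorphic_on U" "open U"
    and sub: "\<And>x y. x \<in> {a..b} \<Longrightarrow> y \<in> {0..2 * pi} \<Longrightarrow> Complex x y \<in> U" and x0: "x0 \<in> {a..b}"
  shows "((\<lambda>x. integral {0..2 * pi} (\<lambda>y. f (Complex x y))) has_vector_derivative
    - \<i> * (f (of_real x0 + turn) - f (of_real x0))) (at x0 within {a..b})"
proof -
  have df: "(f has_field_derivative deriv f z) (at z)" if "z \<in> U" for z
    using holomorphic_derivI[OF f that] by simp
  have cC: "continuous_on A (\<lambda>p. Complex (fst p) (snd p))" for A
    by (simp add: Complex_eq) (intro continuous_intros)
  have cU: "continuous_on U f" "continuous_on U (deriv f)"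
    using f by (auto intro!: holomorphic_on_imp_continuous_on holomorphic_deriv)
  have cont: "continuous_on {0..2 * pi} (\<lambda>y. f (Complex x y))" if "x \<in> {a..b}" for x
    by (rule continuous_on_compose2[OF cU(1)]) (use sub[OF that] in \<open>auto simp: Complex_eq intro!: continuous_intros\<close>)
  have "((\<lambda>x. integral (cbox 0 (2 * pi)) (\<lambda>y. f (Complex x y))) has_vector_derivative
      integral (cbox 0 (2 * pi)) (\<lambda>y. deriv f (Complex x0 y))) (at x0 within {a..b})"
  proof (rule leibniz_rule_vector_derivative)
    fix x t :: real assume xt: "x \<in> {a..b}" "t \<in> cbox 0 (2 * pi)"
    have "((\<lambda>x. Complex x t) has_vector_derivative 1) (at x)"
      unfolding Complex_eq by (auto intro!: derivative_eq_intros)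
    from field_vector_diff_chain_at[OF this df[of "Complex x t"]]
    show "((\<lambda>x. f (Complex x t)) has_vector_derivative deriv f (Complex x t)) (at x within {a..b})"
      using sub[of x t] xt by (auto simp: o_def intro: has_vector_derivative_at_within)
  next
    show "(\<lambda>y. f (Complex x y)) integrable_on cbox 0 (2 * pi)" if "x \<in> {a..b}" for x
      using cont[OF that] by (intro integrable_continuous) simp
    have "continuous_on ({a..b} \<times> cbox 0 (2 * pi)) (\<lambda>p. deriv f (Complex (fst p) (snd p)))"
      by (rule continuous_on_compose2[OF cU(2) cC]) (use sub in auto)
    then show "continuous_on ({a..b} \<times> cbox 0 (2 * pi)) (\<lambda>(x, t). deriv f (Complex x t))"
      by (simp add: case_prod_unfold)
  qed (use x0 in auto)
  moreover have "((\<lambda>y. deriv f (Complex x0 y)) has_integral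
      (- \<i> * f (Complex x0 (2 * pi)) - - \<i> * f (Complex x0 0))) {0..2 * pi}"
  proof (rule fundamental_theorem_of_calculus)
    fix y :: real assume y: "y \<in> {0..2 * pi}"
    have "((\<lambda>y. Complex x0 y) has_vector_derivative \<i>) (at y)"
      unfolding Complex_eq by (auto intro!: derivative_eq_intros)
    from field_vector_diff_chain_at[OF this df[OF sub[OF x0 y]]]
    have "((\<lambda>y. f (Complex x0 y)) has_vector_derivative \<i> * deriv f (Complex x0 y)) (at y)" by (simp add: o_def)
    then have "((\<lambda>y. - \<i> * f (Complex x0 y)) has_vector_derivative - \<i> * (\<i> * deriv f (Complex x0 y))) (at y)"
      by (rule has_vector_derivative_mult_right)
    then show "((\<lambda>y. - \<i> * f (Complex x0 y)) has_vector_derivative deriv f (Complex x0 y)) (at y within {0..2 * pi})"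
      by (rule has_vector_derivative_at_within[THEN has_vector_derivative_eq_rhs]) simp
  qed simp
  moreover have "Complex x0 (2 * pi) = of_real x0 + turn" "Complex x0 0 = of_real x0"
    by (auto simp: complex_eq_iff)
  ultimately show ?thesis by (simp add: integral_unique algebra_simps)
qed

text \<open>
  The monodromy normal forms: \<open>\<tau> = 0\<close> is the elliptic or trivial case, in which \<open>u / v\<close> is multiplied
  by \<open>\<mu>\<^sup>2\<close> along one turn, and \<open>\<tau> = turn\<close> is the parabolic case, in which \<open>turn\<close> is added to \<open>u / v\<close>.
\<close>

definition monodromy_form :: "real \<Rightarrow> (complex \<Rightarrow> complex) \<Rightarrow> (complex \<Rightarrow> complex) \<Rightarrow> complex \<Rightarrow> complex \<Rightarrow> complex \<Rightarrow> bool" where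
  "monodromy_form X0 u v w \<mu> \<tau> \<longleftrightarrow>
     u holomorphic_on {\<zeta>. Re \<zeta> < X0} \<and> v holomorphic_on {\<zeta>. Re \<zeta> < X0} \<and>
     (\<forall>\<zeta>. Re \<zeta> < X0 \<longrightarrow> wronskian u v \<zeta> = w) \<and> w \<noteq> 0 \<and>
     (\<forall>\<zeta>. Re \<zeta> < X0 \<longrightarrow> u (cnj \<zeta>) = cnj (u \<zeta>) \<and> v (cnj \<zeta>) = cnj (v \<zeta>)) \<and>
     (\<forall>\<zeta>. Re \<zeta> < X0 \<longrightarrow> u (\<zeta> + turn) = \<mu> * (u \<zeta> + \<tau> * v \<zeta>) \<and> v (\<zeta> + turn) = cnj \<mu> * v \<zeta>) \<and>
     norm \<mu> = 1 \<and> (\<tau> = 0 \<or> \<tau> = turn \<and> cnj \<mu> = \<mu>) \<and> blowup u v \<and> dominates u v"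

section \<open>Convergence of the quotient to infinity, by type of monodromy\<close>

context
  fixes X0 u v w \<mu> \<tau>
  assumes mf: "monodromy_form X0 u v w \<mu> \<tau>"
begin

lemma mf_hol: "u holomorphic_on {\<zeta>. Re \<zeta> < X0}" "v holomorphic_on {\<zeta>. Re \<zeta> < X0}"
  and mf_wronskian: "\<And>\<zeta>. Re \<zeta> < X0 \<Longrightarrow> wronskian u v \<zeta> = w"
  and mf_shift: "\<And>\<zeta>. Re \<zeta> < X0 \<Longrightarrow> u (\<zeta> + turn) = \<mu> * (u \<zeta> + \<tau> * v \<zeta>)"
      "\<And>\<zeta>. Re \<zeta> < X0 \<Longrightarrow> v (\<zeta> + turn) = cnj \<mu> * v \<zeta>"
  and mf_norm: "norm \<mu> = 1" and mf_cases: "\<tau> = 0 \<or> \<tau> = turn \<and> cnj \<mu> = \<mu>"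
  and mf_blowup: "blowup u v" and mf_dominates: "dominates u v"
  using mf by (auto simp: monodromy_form_def)

lemma mf_nonzero: "Re \<zeta> < X0 \<Longrightarrow> u \<zeta> \<noteq> 0 \<or> v \<zeta> \<noteq> 0"
  using mf by (auto simp: monodromy_form_def wronskian_def)

lemma mf_continuous_real:
  assumes "b < X0"
  shows "continuous_on {a..b} (\<lambda>x. u (of_real x))" "continuous_on {a..b} (\<lambda>x. v (of_real x))"
  by (rule continuous_on_compose2[OF holomorphic_on_imp_continuous_on[OF mf_hol(1)]]
      continuous_on_compose2[OF holomorphic_on_imp_continuous_on[OF mf_hol(2)]];
      use assms in \<open>force intro!: continuous_intros\<close>)+

lemma mf_oscillation:
  assumes "\<delta> > 0"
  obtains X where "X \<le> X0" "\<And>\<zeta>. \<zeta> \<in> left_strip X \<Longrightarrow> norm (u (Re \<zeta>) * v \<zeta> - v (Re \<zeta>) * u \<zeta>) \<le>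
    \<delta> * (norm (u (Re \<zeta>)) + norm (v (Re \<zeta>))) * (norm (u \<zeta>) + norm (v \<zeta>))"
  using blowup_oscillation[OF mf_hol mf_wronskian mf_blowup assms] by blast

text \<open>One turn adds 2 pi i to \<open>u / v\<close>. A translation moves the points of a
  bounded set by a definite spherical distance, so small oscillation drives the values on the far
  real axis out of every bounded set.\<close>

lemma ratio_small_real_parabolic:
  assumes \<tau>: "\<tau> = turn" "cnj \<mu> = \<mu>" and \<eta>: "\<eta> > 0"
  shows "\<exists>X\<le>X0. \<forall>x<X. norm (v (of_real x)) \<le> \<eta> * norm (u (of_real x))"
proof -
  \<comment> \<open>If the claim fails at x, then |u| + |v| \<le> c |v| there. With this
    \<open>\<delta>\<close> the oscillation is at most (pi + 1/2) |v|^2, while the displacement is 2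
    pi |v|^2.\<close>
  define c where "c = 1 + 1 / \<eta>"
  define \<delta> where "\<delta> = 1 / (2 * c\<^sup>2)"
  have pos: "c > 0" using \<eta> by (simp add: c_def add_pos_pos)
  have \<delta>: "\<delta> > 0" using pos by (simp add: \<delta>_def)
  obtain X where X: "X \<le> X0" "\<And>\<zeta>. \<zeta> \<in> left_strip X \<Longrightarrow> norm (u (Re \<zeta>) * v \<zeta> - v (Re \<zeta>) * u \<zeta>) \<le>
    \<delta> * (norm (u (Re \<zeta>)) + norm (v (Re \<zeta>))) * (norm (u \<zeta>) + norm (v \<zeta>))"
    using mf_oscillation[OF \<delta>] by blast
  have "norm (v (of_real x)) \<le> \<eta> * norm (u (of_real x))" if x: "x < X" for x
  proof (rule ccontr)
    assume n: "\<not> ?thesis"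
    let ?u = "norm (u (of_real x))" and ?v = "norm (v (of_real x))"
    have v: "?v > 0" "?u \<le> ?v / \<eta>" using n \<eta> by (auto simp: field_simps intro: order_le_less_trans[rotated])
    have xs: "of_real x + turn \<in> left_strip X" using x by (simp add: left_strip_def)
    have sh: "u (of_real x + turn) = \<mu> * (u (of_real x) + turn * v (of_real x))" "v (of_real x + turn) = \<mu> * v (of_real x)"
      using mf_shift[of "of_real x"] x X(1) \<tau> by auto
    have "u (of_real x) * v (of_real x + turn) - v (of_real x) * u (of_real x + turn) = - \<mu> * turn * (v (of_real x) * v (of_real x))"
      unfolding sh by (simp add: algebra_simps)
    then have "2 * pi * (?v * ?v) = norm (u (of_real x) * v (of_real x + turn) - v (of_real x) * u (of_real x + turn))"
      using mf_norm by (simp add: norm_mult turn_def)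
    also have "\<dots> \<le> \<delta> * (?u + ?v) * (norm (u (of_real x + turn)) + norm (v (of_real x + turn)))"
      using X(2)[OF xs] by simp
    also have "\<dots> \<le> \<delta> * (?u + ?v) * ((?u + 2 * pi * ?v) + ?v)"
    proof (rule mult_left_mono)
      show "norm (u (of_real x + turn)) + norm (v (of_real x + turn)) \<le> (?u + 2 * pi * ?v) + ?v"
        unfolding sh using mf_norm norm_triangle_ineq[of "u (of_real x)" "turn * v (of_real x)"]
        by (simp add: norm_mult turn_def)
    qed (use \<delta> in simp)
    also have "\<dots> \<le> \<delta> * (?u + ?v) * ((2 * pi + 1) * (?u + ?v))"
      using \<delta> pi_gt3 by (intro mult_left_mono) (auto simp: algebra_simps)
    also have "\<dots> = \<delta> * (2 * pi + 1) * (?u + ?v)\<^sup>2" by (simp add: power2_eq_square)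
    also have "\<dots> \<le> \<delta> * (2 * pi + 1) * (?v * c)\<^sup>2"
      using v \<delta> by (intro mult_left_mono power_mono) (auto simp: c_def algebra_simps)
    also have "\<dots> = (pi + 1 / 2) * (?v * ?v)" using pos by (simp add: \<delta>_def power_mult_distrib power2_eq_square field_simps)
    finally have "2 * pi \<le> pi + 1 / 2" using v(1) by (subst (asm) mult_le_cancel_right_pos) auto
    then show False using pi_gt3 by simp
  qed
  then show ?thesis using X(1) by blast
qed

text \<open>One turn multiplies \<open>u / v\<close> by \<open>\<mu>^2\<close>, which differs from 1
  and so moves the points of the circle |u / v| = 1 / \<open>\<eta>\<close> by a definite distance.
  Far to the left the values on the real axis therefore avoid this circle, and by continuity they
  stay on the side where domination provides a point.\<close>

lemma ratio_small_real_elliptic: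
  assumes \<tau>: "\<tau> = 0" and \<mu>: "cnj \<mu> \<noteq> \<mu>" and \<eta>: "\<eta> > 0" "\<eta> \<le> 1"
  shows "\<exists>X\<le>X0. \<forall>x<X. norm (v (of_real x)) \<le> \<eta> * norm (u (of_real x))"
proof -
  define \<delta> where "\<delta> = norm (cnj \<mu> - \<mu>) * \<eta> / 8"
  have \<delta>: "\<delta> > 0" using \<mu> \<eta> by (simp add: \<delta>_def)
  obtain X where X: "X \<le> X0" "\<And>\<zeta>. \<zeta> \<in> left_strip X \<Longrightarrow> norm (u (Re \<zeta>) * v \<zeta> - v (Re \<zeta>) * u \<zeta>) \<le>
    \<delta> * (norm (u (Re \<zeta>)) + norm (v (Re \<zeta>))) * (norm (u \<zeta>) + norm (v \<zeta>))"
    using mf_oscillation[OF \<delta>] by blast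
  have ne: "norm (v (of_real x)) - \<eta> * norm (u (of_real x)) \<noteq> 0" if x: "x < X" for x
  proof
    assume "norm (v (of_real x)) - \<eta> * norm (u (of_real x)) = 0"
    then have eq: "norm (v (of_real x)) = \<eta> * norm (u (of_real x))" by simp
    then have u0: "norm (u (of_real x)) > 0" using mf_nonzero[of "of_real x"] x X(1) by auto
    let ?u = "norm (u (of_real x))"
    have xs: "of_real x + turn \<in> left_strip X" using x by (simp add: left_strip_def)
    have sh: "u (of_real x + turn) = \<mu> * u (of_real x)" "v (of_real x + turn) = cnj \<mu> * v (of_real x)"
      using mf_shift[of "of_real x"] x X(1) \<tau> by auto
    have "u (of_real x) * v (of_real x + turn) - v (of_real x) * u (of_real x + turn) = (cnj \<mu> - \<mu>) * (u (of_real x) * v (of_real x))"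
      unfolding sh by (simp add: algebra_simps)
    then have "norm (cnj \<mu> - \<mu>) * (?u * (\<eta> * ?u)) = norm (u (of_real x) * v (of_real x + turn) - v (of_real x) * u (of_real x + turn))"
      by (simp add: norm_mult eq)
    also have "\<dots> \<le> \<delta> * (?u + \<eta> * ?u) * (?u + \<eta> * ?u)"
      using X(2)[OF xs] mf_norm by (simp add: sh norm_mult eq)
    also have "\<dots> \<le> \<delta> * (2 * ?u) * (2 * ?u)"
      using \<eta> \<delta> u0 by (intro mult_mono) (auto intro!: mult_left_le_one_le mult_nonneg_nonneg add_nonneg_nonneg)
    also have "\<dots> = norm (cnj \<mu> - \<mu>) * (?u * (\<eta> * ?u)) / 2" by (simp add: \<delta>_def)
    finally have "norm (cnj \<mu> - \<mu>) * (?u * (\<eta> * ?u)) \<le> norm (cnj \<mu> - \<mu>) * (?u * (\<eta> * ?u)) / 2" .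
    moreover have "norm (cnj \<mu> - \<mu>) > 0" using \<mu> by simp
    ultimately show False
      using mult_pos_pos[OF _ mult_pos_pos[OF u0 mult_pos_pos[OF \<eta>(1) u0]], of "norm (cnj \<mu> - \<mu>)"] \<mu> by linarith
  qed
  \<comment> \<open>Half of \<open>\<eta>\<close> puts this point strictly outside the
    circle.\<close>
  obtain x1 where x1: "x1 < X" "u (of_real x1) \<noteq> 0" "norm (v (of_real x1)) \<le> (\<eta> / 2) * norm (u (of_real x1))"
    using mf_dominates \<eta> unfolding dominates_def by (meson half_gt_zero)
  have neg: "norm (v (of_real x1)) - \<eta> * norm (u (of_real x1)) < 0"
  proof -
    have "0 < \<eta> * norm (u (of_real x1))" "norm (v (of_real x1)) * 2 \<le> \<eta> * norm (u (of_real x1))"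
      using x1 \<eta> by auto
    then show ?thesis by linarith
  qed
  have "norm (v (of_real x)) \<le> \<eta> * norm (u (of_real x))" if x: "x < X" for x
  proof (rule ccontr)
    assume "\<not> ?thesis"
    then have "0 \<in> closed_segment (norm (v (of_real x1)) - \<eta> * norm (u (of_real x1))) (norm (v (of_real x)) - \<eta> * norm (u (of_real x)))"
      using neg by (auto simp: closed_segment_eq_real_ivl)
    moreover have "continuous_on (closed_segment x1 x) (\<lambda>x. norm (v (of_real x)) - \<eta> * norm (u (of_real x)))"
      using mf_continuous_real[of "max x x1" "min x x1"] x x1 X(1)
      by (intro continuous_intros) (auto simp: closed_segment_eq_real_ivl min_def max_def split: if_splits)
    ultimately obtain t where "t \<in> closed_segment x1 x" "norm (v (of_real t)) - \<eta> * norm (u (of_real t)) = 0"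
      using IVT'_closed_segment_real[of 0 "\<lambda>x. norm (v (of_real x)) - \<eta> * norm (u (of_real x))" x1 x] by blast
    then show False using ne[of t] x x1 by (auto simp: closed_segment_eq_real_ivl split: if_splits)
  qed
  then show ?thesis using X(1) by blast
qed

(* With trivial monodromy the mean of u/v over a vertical segment of length 2 pi does not depend on
   the segment, which prevents u/v from returning from large values. *)
lemma ratio_small_real_trivial:
  assumes \<tau>: "\<tau> = 0" and \<mu>: "cnj \<mu> = \<mu>" and \<eta>: "\<eta> > 0" "\<eta> \<le> 1"
  shows "\<exists>X\<le>X0. \<forall>x<X. norm (v (of_real x)) \<le> \<eta> * norm (u (of_real x))"
proof -
  define M where "M = 1 / \<eta>"
  have M: "M \<ge> 1" using \<eta> by (simp add: M_def)
  \<comment> \<open>With this value \<open>u / v\<close> varies by at most M / 4 on a vertical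
    segment that starts at a value of norm at most 2 M.\<close>
  define \<delta> where "\<delta> = 1 / (24 * (1 + 2 * M))"
  have \<delta>: "\<delta> > 0" "\<delta> * (1 + 2 * M) = 1 / 24" using M by (auto simp: \<delta>_def)
  obtain X where X: "X \<le> X0" "\<And>\<zeta>. \<zeta> \<in> left_strip X \<Longrightarrow> norm (u (Re \<zeta>) * v \<zeta> - v (Re \<zeta>) * u \<zeta>) \<le>
    \<delta> * (norm (u (Re \<zeta>)) + norm (v (Re \<zeta>))) * (norm (u \<zeta>) + norm (v \<zeta>))"
    using mf_oscillation[OF \<delta>(1)] by blast
  define f where "f z = u z / v z" for z
  have close: "v \<zeta> \<noteq> 0 \<and> norm (f (Re \<zeta>) - f \<zeta>) \<le> M / 4"
    if \<zeta>: "\<zeta> \<in> left_strip X" and le: "norm (u (Re \<zeta>)) \<le> 2 * M * norm (v (Re \<zeta>))" for \<zeta>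
  proof -
    let ?x = "complex_of_real (Re \<zeta>)"
    have reX: "Re \<zeta> < X0" using \<zeta> X(1) by (auto simp: left_strip_def)
    have v0: "v ?x \<noteq> 0"
    proof
      assume "v ?x = 0"
      then have "u ?x = 0" using le by simp
      then show False using mf_nonzero[of ?x] reX \<open>v ?x = 0\<close> by simp
    qed
    have "norm (u ?x * v \<zeta> - v ?x * u \<zeta>) \<le> \<delta> * (norm (u ?x) + norm (v ?x)) * (norm (u \<zeta>) + norm (v \<zeta>))"
      by (rule X(2)[OF \<zeta>])
    also have "\<dots> \<le> \<delta> * ((1 + 2 * M) * norm (v ?x)) * (norm (u \<zeta>) + norm (v \<zeta>))"
      using le \<delta> by (intro mult_right_mono mult_left_mono) (auto simp: algebra_simps)
    also have "\<dots> = (\<delta> * (1 + 2 * M)) * (norm (v ?x) * (norm (u \<zeta>) + norm (v \<zeta>)))"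
      by (simp only: mult_ac)
    also have "\<dots> = norm (v ?x) * ((norm (u \<zeta>) + norm (v \<zeta>)) / 24)"
      unfolding \<delta>(2) by simp
    finally have b: "norm (u ?x * v \<zeta> - v ?x * u \<zeta>) \<le> norm (v ?x) * ((norm (u \<zeta>) + norm (v \<zeta>)) / 24)" .
    have v\<zeta>: "v \<zeta> \<noteq> 0"
    proof
      assume "v \<zeta> = 0"
      then have "norm (v ?x) * norm (u \<zeta>) \<le> norm (v ?x) * (norm (u \<zeta>) / 24)" using b by (simp add: norm_mult)
      then have "norm (u \<zeta>) \<le> norm (u \<zeta>) / 24" using v0 by simp
      then show False using mf_nonzero[OF reX] \<open>v \<zeta> = 0\<close> by simp
    qed
    have "f ?x - f \<zeta> = (u ?x * v \<zeta> - v ?x * u \<zeta>) / (v ?x * v \<zeta>)"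
      using v0 v\<zeta> by (simp add: f_def divide_simps)
    then have "norm (f ?x - f \<zeta>) = norm (u ?x * v \<zeta> - v ?x * u \<zeta>) / (norm (v ?x) * norm (v \<zeta>))"
      by (simp add: norm_divide norm_mult)
    also have "\<dots> \<le> norm (v ?x) * ((norm (u \<zeta>) + norm (v \<zeta>)) / 24) / (norm (v ?x) * norm (v \<zeta>))"
      using b by (intro divide_right_mono) auto
    also have "\<dots> = (norm (f \<zeta>) + 1) / 24" using v0 v\<zeta> by (simp add: f_def norm_divide field_simps)
    finally have c: "norm (f ?x - f \<zeta>) \<le> (norm (f \<zeta>) + 1) / 24" .
    moreover have "norm (f ?x) \<le> 2 * M" using le v0 by (simp add: f_def norm_divide divide_simps)
    moreover have "norm (f \<zeta>) \<le> norm (f ?x) + norm (f ?x - f \<zeta>)" using norm_triangle_ineq4[of "f ?x" "f ?x - f \<zeta>"] by simp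
    moreover have "e \<le> M / 4" if "e \<le> (F + 1) / 24" "A \<le> 2 * M" "F \<le> A + e" for e F A :: real
      using that M by (simp add: field_simps)
    ultimately have "norm (f ?x - f \<zeta>) \<le> M / 4" by blast
    then show ?thesis using v\<zeta> by simp
  qed
  have "norm (v (of_real b)) \<le> \<eta> * norm (u (of_real b))" if b: "b < X" for b
  proof (rule ccontr)
    assume nle: "\<not> ?thesis"
    then have lt: "norm (u (of_real b)) < M * norm (v (of_real b))" using \<eta> by (simp add: M_def field_simps)
    obtain x1 where x1: "x1 < b" "u (of_real x1) \<noteq> 0" "norm (v (of_real x1)) \<le> 1 / (2 * M) * norm (u (of_real x1))"
      using mf_dominates M unfolding dominates_def by (metis divide_pos_pos mult_pos_pos zero_less_numeral zero_less_one order_less_le_trans)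
    define g where "g x = norm (u (of_real x)) - 2 * M * norm (v (of_real x))" for x
    have cg: "continuous_on {x1..b} g"
      unfolding g_def using mf_continuous_real[of b x1] b X(1) by (intro continuous_intros) auto
    \<comment> \<open>Its supremum \<open>a\<close> is the last place before \<open>b\<close> where
      |u| \<ge> 2 M |v|. From \<open>a\<close> to \<open>b\<close> the quotient is bounded by 2 M on
      the axis, hence free of poles on the rectangle above, and its vertical mean is
      constant.\<close>
    define T where "T = {x1..b} \<inter> g -` {0..}"
    have "closed T" unfolding T_def by (intro continuous_closed_preimage[OF cg]) auto
    moreover have "x1 \<in> T" using x1 M by (auto simp: T_def g_def field_simps)
    moreover have "bdd_above T" unfolding T_def by (meson bdd_above.I2 bdd_above_Int1 bdd_above_Icc)
    ultimately have aT: "Sup T \<in> T" by (intro closed_contains_Sup) auto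
    define a where "a = Sup T"
    have a: "x1 \<le> a" "a \<le> b" "g a \<ge> 0" using aT by (auto simp: T_def a_def)
    have ab: "a < b"
    proof (rule ccontr)
      assume "\<not> a < b"
      then have "2 * M * norm (v (of_real b)) \<le> norm (u (of_real b))" using a by (simp add: g_def)
      moreover have "0 \<le> M * norm (v (of_real b))" using M by simp
      ultimately show False using lt by linarith
    qed
    have above: "g x < 0" if "x \<in> {a<..b}" for x
    proof (rule ccontr)
      assume "\<not> g x < 0"
      then have "x \<in> T" using that a by (auto simp: T_def)
      then have "x \<le> a" unfolding a_def using \<open>bdd_above T\<close> by (intro cSup_upper)
      then show False using that by simp
    qed
    have "g a \<le> 0"
    proof (rule continuous_le_on_closure[of "{a<..b}" g a 0])
      show "continuous_on (closure {a<..b}) g" using ab a by (intro continuous_on_subset[OF cg]) auto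
    qed (use above ab in \<open>auto simp: less_imp_le\<close>)
    then have g0: "g x \<le> 0" if "x \<in> {a..b}" for x using above[of x] that by (cases "x = a") auto
    have cl: "v (Complex x y) \<noteq> 0 \<and> norm (f (of_real x) - f (Complex x y)) \<le> M / 4"
      if "x \<in> {a..b}" "y \<in> {0..2 * pi}" for x y
      using close[of "Complex x y"] g0[of x] that b by (auto simp: left_strip_def g_def)
    define U where "U = {\<zeta>. Re \<zeta> < X0} \<inter> v -` (- {0})"
    have U: "open U" unfolding U_def
      by (intro continuous_open_preimage holomorphic_on_imp_continuous_on mf_hol open_halfspace_Re_lt) auto
    have fU: "f holomorphic_on U" unfolding f_def
      by (intro holomorphic_on_divide holomorphic_on_subset[OF mf_hol(1)] holomorphic_on_subset[OF mf_hol(2)]) (auto simp: U_def)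
    have subU: "Complex x y \<in> U" if "x \<in> {a..b}" "y \<in> {0..2 * pi}" for x y
      using cl[OF that] that b X(1) by (auto simp: U_def)
    define m where "m x = integral {0..2 * pi} (\<lambda>y. f (Complex x y))" for x
    have dm: "(m has_vector_derivative 0) (at x within {a..b})" if x: "x \<in> {a..b}" for x
    proof -
      have "f (of_real x + turn) = f (of_real x)"
        using mf_shift[of "of_real x"] x b X(1) \<tau> \<mu> mf_norm by (auto simp: f_def)
      then show ?thesis
        using vertical_integral_derivative[OF fU U subU x] unfolding m_def by simp
    qed
    have meq: "m a = m b"
      using has_vector_derivative_zero_constant[of "{a..b}" m] dm ab by (metis atLeastAtMost_iff convex_real_interval(5) less_eq_real_def)
    have mclose: "norm (m x - of_real (2 * pi) * f (of_real x)) \<le> 2 * pi * (M / 4)" if x: "x \<in> {a..b}" for x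
    proof -
      have cont: "continuous_on {0..2 * pi} (\<lambda>y. f (Complex x y))"
        by (rule continuous_on_compose2[OF holomorphic_on_imp_continuous_on[OF fU]])
          (use subU[OF x] in \<open>auto simp: Complex_eq intro!: continuous_intros\<close>)
      have "((\<lambda>y. f (Complex x y) - f (of_real x)) has_integral (m x - (2 * pi - 0) *\<^sub>R f (of_real x))) {0..2 * pi}"
        unfolding m_def using pi_gt_zero
        by (intro has_integral_diff integrable_integral integrable_continuous_real cont has_integral_const_real[THEN has_integral_eq_rhs]) auto
      then have "norm (m x - (2 * pi - 0) *\<^sub>R f (of_real x)) \<le> (M / 4) * measure lborel {0..2 * pi}"
        using cl[OF x] M by (intro has_integral_bound_real[of _ "{}"]) (auto simp: norm_minus_commute)
      then show ?thesis by (simp add: scaleR_conv_of_real mult.commute)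
    qed
    \<comment> \<open>The common mean lies within M / 4 of the value at either end, but these values
      have norms at least 2 M and less than M.\<close>
    have "norm (of_real (2 * pi) * f (of_real a) - of_real (2 * pi) * f (of_real b)) \<le> 2 * pi * (M / 4) + 2 * pi * (M / 4)"
      using norm_triangle_ineq4[of "m b - of_real (2 * pi) * f (of_real b)" "m a - of_real (2 * pi) * f (of_real a)"]
        mclose[of a] mclose[of b] ab meq by (simp add: algebra_simps)
    then have "2 * pi * norm (f (of_real a) - f (of_real b)) \<le> 2 * pi * (M / 2)"
      by (simp add: norm_mult flip: right_diff_distrib)
    then have "norm (f (of_real a) - f (of_real b)) \<le> M / 2" using pi_gt_zero by (subst (asm) mult_le_cancel_left_pos) auto
    moreover have "norm (f (of_real a)) \<ge> 2 * M"
      using cl[of a 0] a ab by (auto simp: f_def norm_divide g_def divide_simps complex_of_real_def)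
    moreover have "norm (f (of_real b)) < M"
      using lt M by (cases "v (of_real b) = 0") (auto simp: f_def norm_divide divide_simps)
    ultimately show False using norm_triangle_ineq2[of "f (of_real a)" "f (of_real b)"] M by linarith
  qed
  then show ?thesis using X(1) by blast
qed

text \<open>The three types of monodromy settle the real axis; small oscillation spreads the
  estimate over vertical segments.\<close>

lemma ratio_small:
  assumes \<eta>: "\<eta> > 0"
  shows "\<exists>X\<le>X0. \<forall>\<zeta>\<in>left_strip X. norm (v \<zeta>) \<le> \<eta> * norm (u \<zeta>)"
proof -
  \<comment> \<open>Then \<open>\<eta>1 + 2 * \<delta> \<le> \<eta> / 2\<close> and
    \<open>2 * \<delta> \<le> 1 / 2\<close>, so that the term with v on the right can be
    absorbed.\<close>
  define \<eta>1 \<delta> where "\<eta>1 = min 1 (\<eta> / 4)" and "\<delta> = min (1 / 4) (\<eta> / 8)"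
  have p: "\<eta>1 > 0" "\<eta>1 \<le> 1" "\<eta>1 \<le> \<eta> / 4" "\<delta> > 0" "\<delta> \<le> 1 / 4" "\<delta> \<le> \<eta> / 8"
    using \<eta> by (auto simp: \<eta>1_def \<delta>_def)
  have "\<exists>X\<le>X0. \<forall>x<X. norm (v (of_real x)) \<le> \<eta>1 * norm (u (of_real x))"
    using mf_cases ratio_small_real_parabolic ratio_small_real_elliptic ratio_small_real_trivial p by blast
  then obtain X1 where X1: "X1 \<le> X0" "\<And>x. x < X1 \<Longrightarrow> norm (v (of_real x)) \<le> \<eta>1 * norm (u (of_real x))"
    by blast
  obtain X2 where X2: "X2 \<le> X0" "\<And>\<zeta>. \<zeta> \<in> left_strip X2 \<Longrightarrow> norm (u (Re \<zeta>) * v \<zeta> - v (Re \<zeta>) * u \<zeta>) \<le>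
    \<delta> * (norm (u (Re \<zeta>)) + norm (v (Re \<zeta>))) * (norm (u \<zeta>) + norm (v \<zeta>))"
    using mf_oscillation[OF p(4)] by blast
  have "norm (v \<zeta>) \<le> \<eta> * norm (u \<zeta>)" if \<zeta>: "\<zeta> \<in> left_strip (min X1 X2)" for \<zeta>
  proof -
    let ?x = "complex_of_real (Re \<zeta>)"
    have reX: "Re \<zeta> < X1" "\<zeta> \<in> left_strip X2" using \<zeta> by (auto simp: left_strip_def)
    have vx: "norm (v ?x) \<le> \<eta>1 * norm (u ?x)" by (rule X1(2)[OF reX(1)])
    then have ux: "norm (u ?x) > 0" using mf_nonzero[of ?x] reX X1(1) by auto
    have vx1: "norm (v ?x) \<le> norm (u ?x)" using vx p mult_right_mono[of \<eta>1 1 "norm (u ?x)"] by simp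
    have "norm (u ?x * v \<zeta>) \<le> norm (v ?x * u \<zeta>) + norm (u ?x * v \<zeta> - v ?x * u \<zeta>)"
      using norm_triangle_ineq[of "v ?x * u \<zeta>" "u ?x * v \<zeta> - v ?x * u \<zeta>"] by simp
    also have "\<dots> \<le> norm (v ?x * u \<zeta>) + \<delta> * (norm (u ?x) + norm (v ?x)) * (norm (u \<zeta>) + norm (v \<zeta>))"
      using X2(2)[OF reX(2)] by simp
    also have "\<dots> \<le> (\<eta>1 * norm (u ?x)) * norm (u \<zeta>) + \<delta> * (2 * norm (u ?x)) * (norm (u \<zeta>) + norm (v \<zeta>))"
      using vx vx1 p by (intro add_mono mult_right_mono mult_left_mono) (auto simp: norm_mult mult_right_mono)
    finally have "norm (u ?x) * norm (v \<zeta>) \<le> norm (u ?x) * (\<eta>1 * norm (u \<zeta>) + 2 * \<delta> * (norm (u \<zeta>) + norm (v \<zeta>)))"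
      by (simp add: norm_mult algebra_simps)
    then have "norm (v \<zeta>) \<le> \<eta>1 * norm (u \<zeta>) + 2 * \<delta> * (norm (u \<zeta>) + norm (v \<zeta>))"
      using ux by (subst (asm) mult_le_cancel_left_pos) auto
    also have "\<dots> = (\<eta>1 + 2 * \<delta>) * norm (u \<zeta>) + 2 * \<delta> * norm (v \<zeta>)" by (simp add: algebra_simps)
    also have "\<dots> \<le> \<eta> / 2 * norm (u \<zeta>) + 1 / 2 * norm (v \<zeta>)"
      using p by (intro add_mono mult_right_mono) auto
    finally show ?thesis by simp
  qed
  then show ?thesis using X1(1) by (intro exI[of _ "min X1 X2"]) auto
qed

end

text \<open>The new quotient is an affine image of \<open>u / v\<close>, and affine maps fix
  infinity.\<close>

lemma dominates_blowup_shear: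
  assumes bl: "blowup u v" and dom: "dominates u v" and k: "k \<noteq> 0"
  shows "blowup (\<lambda>z. k * u z + c * v z) v" "dominates (\<lambda>z. k * u z + c * v z) v"
proof -
  define C where "C = 2 / (norm k)\<^sup>2 + 2 * (norm c)\<^sup>2 / (norm k)\<^sup>2 + 1"
  have C: "C > 0" by (simp add: C_def add_nonneg_pos)
  show "blowup (\<lambda>z. k * u z + c * v z) v"
  proof (rule blowup_linear_change[OF bl, of "1 / C" 0])
    fix z
    let ?U = "k * u z + c * v z"
    have "norm k * norm (u z) \<le> norm ?U + norm c * norm (v z)"
      using norm_triangle_ineq4[of ?U "c * v z"] by (simp add: norm_mult)
    then have "(norm k * norm (u z))\<^sup>2 \<le> (norm ?U + norm c * norm (v z))\<^sup>2"
      by (intro power_mono) auto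
    also have "\<dots> \<le> 2 * (norm ?U)\<^sup>2 + 2 * (norm c)\<^sup>2 * (norm (v z))\<^sup>2"
      using zero_le_power2[of "norm ?U - norm c * norm (v z)"] by (simp add: power2_eq_square algebra_simps)
    finally have "(norm (u z))\<^sup>2 \<le> 2 / (norm k)\<^sup>2 * (norm ?U)\<^sup>2 + 2 * (norm c)\<^sup>2 / (norm k)\<^sup>2 * (norm (v z))\<^sup>2"
      using k by (simp add: power_mult_distrib field_simps)
    then have "(norm (u z))\<^sup>2 + (norm (v z))\<^sup>2 \<le>
        2 / (norm k)\<^sup>2 * (norm ?U)\<^sup>2 + (2 * (norm c)\<^sup>2 / (norm k)\<^sup>2 + 1) * (norm (v z))\<^sup>2"
      by (simp add: algebra_simps)
    also have "\<dots> \<le> C * (norm ?U)\<^sup>2 + C * (norm (v z))\<^sup>2"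
      by (intro add_mono mult_right_mono) (auto simp: C_def)
    finally have "(norm (u z))\<^sup>2 + (norm (v z))\<^sup>2 \<le> ((norm ?U)\<^sup>2 + (norm (v z))\<^sup>2) * C"
      by (simp add: algebra_simps)
    then have "((norm (u z))\<^sup>2 + (norm (v z))\<^sup>2) / C \<le> (norm ?U)\<^sup>2 + (norm (v z))\<^sup>2"
      using C by (subst pos_divide_le_eq)
    then show "1 / C * ((norm (u z))\<^sup>2 + (norm (v z))\<^sup>2) \<le> (norm ?U)\<^sup>2 + (norm (v z))\<^sup>2"
      by simp
  qed (use C in auto)
  show "dominates (\<lambda>z. k * u z + c * v z) v"
    unfolding dominates_def
  proof (intro allI impI)
    fix \<eta> X :: real assume \<eta>: "\<eta> > 0"
    define e where "e = norm c + 1"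
    \<comment> \<open>The first bound makes |c v| at most half of |k u|, so the new function has
      norm at least |k u| / 2; the second then gives the required ratio.\<close>
    define \<eta>' where "\<eta>' = min (norm k / (2 * e)) (\<eta> * norm k / 2)"
    have c1: "e > 0" by (simp add: e_def add_nonneg_pos)
    then have \<eta>': "\<eta>' > 0" using \<eta> k by (simp add: \<eta>'_def)
    obtain x where x: "x < X" "u (of_real x) \<noteq> 0" "norm (v (of_real x)) \<le> \<eta>' * norm (u (of_real x))"
      using dom \<eta>' unfolding dominates_def by blast
    let ?u = "norm (u (of_real x))" and ?v = "norm (v (of_real x))" and ?U = "k * u (of_real x) + c * v (of_real x)"
    have \<eta>'u: "\<eta>' * ?u \<le> norm k / (2 * e) * ?u" "\<eta>' * ?u \<le> \<eta> * norm k / 2 * ?u"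
      by (intro mult_right_mono; simp add: \<eta>'_def)+
    have "norm c * ?v \<le> e * (norm k / (2 * e) * ?u)"
      using order_trans[OF x(3) \<eta>'u(1)] c1 by (intro mult_mono) (auto simp: e_def)
    also have "\<dots> = norm k / 2 * ?u" using c1 by simp
    finally have "norm c * ?v \<le> norm k / 2 * ?u" .
    moreover have "norm k * ?u \<le> norm ?U + norm c * ?v"
      using norm_triangle_ineq4[of ?U "c * v (of_real x)"] by (simp add: norm_mult)
    ultimately have U: "norm k / 2 * ?u \<le> norm ?U" by simp
    moreover have "norm k / 2 * ?u > 0" using k x by simp
    ultimately have "?U \<noteq> 0" by auto
    moreover have "?v \<le> \<eta> * norm ?U"
    proof -
      have "?v \<le> \<eta> * norm k / 2 * ?u"
        using x(3) \<eta>'u(2) by (rule order_trans)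
      also have "\<dots> = \<eta> * (norm k / 2 * ?u)" by simp
      also have "\<dots> \<le> \<eta> * norm ?U" using U \<eta> by (intro mult_left_mono) auto
      finally show ?thesis .
    qed
    ultimately show "\<exists>x<X. k * u (of_real x) + c * v (of_real x) \<noteq> 0 \<and>
        norm (v (of_real x)) \<le> \<eta> * norm (k * u (of_real x) + c * v (of_real x))"
      using x(1) by blast
  qed
qed

section \<open>Reduction of the monodromy to normal form\<close>

lemma deriv_linear_combination:
  assumes "f field_differentiable at z" "g field_differentiable at z"
  shows "deriv (\<lambda>z. a * f z + b * g z) z = a * deriv f z + b * deriv g z"
  using assms by (simp add: deriv_add deriv_cmult field_differentiable_mult field_differentiable_const)

lemma wronskian_linear_combination:
  assumes "f field_differentiable at z" "g field_differentiable at z"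
  shows "wronskian (\<lambda>z. a * f z + b * g z) (\<lambda>z. c * f z + d * g z) z = (a * d - b * c) * wronskian f g z"
  unfolding wronskian_def deriv_linear_combination[OF assms] by (simp add: algebra_simps)

text \<open>An orthogonal change of basis moves the accumulation value to infinity and makes the
  matrix of a turn triangular. The determinant is 1 and the product with the conjugate matrix is the
  identity, so the diagonal is A, cnj A with |A| = 1 and the corner entry B is imaginary. If A is
  not real, a real shear removes B; otherwise a real scaling normalises the translation.\<close>

lemma exists_monodromy_form:
  assumes hol: "y1 holomorphic_on {\<zeta>. Re \<zeta> < X0}" "y2 holomorphic_on {\<zeta>. Re \<zeta> < X0}"
    and W: "\<And>\<zeta>. Re \<zeta> < X0 \<Longrightarrow> wronskian y1 y2 \<zeta> = 1"
    and real: "\<And>\<zeta>. Re \<zeta> < X0 \<Longrightarrow> y1 (cnj \<zeta>) = cnj (y1 \<zeta>) \<and> y2 (cnj \<zeta>) = cnj (y2 \<zeta>)"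
    and bl: "blowup y1 y2"
    and sh: "\<And>\<zeta>. Re \<zeta> < X0 \<Longrightarrow> y1 (\<zeta> + turn) = a11 * y1 \<zeta> + a12 * y2 \<zeta>"
        "\<And>\<zeta>. Re \<zeta> < X0 \<Longrightarrow> y2 (\<zeta> + turn) = a21 * y1 \<zeta> + a22 * y2 \<zeta>"
  obtains \<alpha> \<beta> \<gamma> \<delta> w \<mu> \<tau> where
    "monodromy_form X0 (\<lambda>z. \<alpha> * y1 z + \<beta> * y2 z) (\<lambda>z. \<gamma> * y1 z + \<delta> * y2 z) w \<mu> \<tau>"
    "\<alpha> * \<delta> - \<beta> * \<gamma> \<noteq> 0"
proof -
  let ?H = "{\<zeta>. Re \<zeta> < X0}"
  have oH: "open ?H" by (rule open_halfspace_Re_lt)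
  have nz: "y1 \<zeta> \<noteq> 0 \<or> y2 \<zeta> \<noteq> 0" if "Re \<zeta> < X0" for \<zeta>
    using W[OF that] by (auto simp: wronskian_def)
  have fd: "y1 field_differentiable at \<zeta>" "y2 field_differentiable at \<zeta>" if "Re \<zeta> < X0" for \<zeta>
    using hol oH that by (auto intro: holomorphic_on_imp_differentiable_at)
  obtain p q :: real where pq: "p\<^sup>2 + q\<^sup>2 = 1" and
    dom: "dominates (\<lambda>z. of_real p * y1 z + of_real q * y2 z) (\<lambda>z. of_real p * y2 z - of_real q * y1 z)"
    using exists_dominating_combination[of X0 y1 y2, OF nz real] by blast
  have pqc: "complex_of_real p * of_real p + of_real q * of_real q = 1"
    using pq by (simp add: power2_eq_square flip: of_real_mult of_real_add)
  define u where "u z = of_real p * y1 z + of_real q * y2 z" for z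
  define v where "v z = - of_real q * y1 z + of_real p * y2 z" for z
  have dom: "dominates u v" using dom by (simp add: u_def[abs_def] v_def[abs_def])
  have y_uv: "y1 z = of_real p * u z - of_real q * v z" "y2 z = of_real q * u z + of_real p * v z" for z
  proof -
    have "of_real p * u z - of_real q * v z = (of_real p * of_real p + of_real q * of_real q) * y1 z"
      "of_real q * u z + of_real p * v z = (of_real p * of_real p + of_real q * of_real q) * y2 z"
      by (simp_all add: u_def v_def algebra_simps)
    then show "y1 z = of_real p * u z - of_real q * v z" "y2 z = of_real q * u z + of_real p * v z"
      by (simp_all add: pqc)
  qed
  have uvhol: "u holomorphic_on ?H" "v holomorphic_on ?H"
    unfolding u_def v_def by (intro holomorphic_intros hol)+
  have uvfd: "u field_differentiable at \<zeta>" "v field_differentiable at \<zeta>" if "Re \<zeta> < X0" for \<zeta>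
    using uvhol oH that by (auto intro: holomorphic_on_imp_differentiable_at)
  have Wuv: "wronskian u v \<zeta> = 1" if "Re \<zeta> < X0" for \<zeta>
    using wronskian_linear_combination[OF fd[OF that], of "of_real p" "of_real q" "- of_real q" "of_real p"] W[OF that] pqc
    unfolding u_def v_def by simp
  have uvreal: "u (cnj \<zeta>) = cnj (u \<zeta>)" "v (cnj \<zeta>) = cnj (v \<zeta>)" if "Re \<zeta> < X0" for \<zeta>
    using real[OF that] by (auto simp: u_def v_def)
  have bluv: "blowup u v"
  proof (rule blowup_linear_change[OF bl, of 1 0])
    fix z
    have "(norm (y1 z))\<^sup>2 + (norm (y2 z))\<^sup>2 = (p\<^sup>2 + q\<^sup>2) * ((norm (y1 z))\<^sup>2 + (norm (y2 z))\<^sup>2)" by (simp add: pq)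
    also have "\<dots> = (norm (u z))\<^sup>2 + (norm (v z))\<^sup>2"
      unfolding u_def v_def cmod_power2 by (simp add: power2_eq_square algebra_simps)
    finally show "1 * ((norm (y1 z))\<^sup>2 + (norm (y2 z))\<^sup>2) \<le> (norm (u z))\<^sup>2 + (norm (v z))\<^sup>2" by simp
  qed simp
  define P Q where "P = complex_of_real p" and "Q = complex_of_real q"
  define A where "A = (P * a11 + Q * a21) * P + (P * a12 + Q * a22) * Q"
  define B where "B = - (P * a11 + Q * a21) * Q + (P * a12 + Q * a22) * P"
  define C where "C = (- Q * a11 + P * a21) * P + (- Q * a12 + P * a22) * Q"
  define D where "D = - (- Q * a11 + P * a21) * Q + (- Q * a12 + P * a22) * P"
  have shu: "u (\<zeta> + turn) = A * u \<zeta> + B * v \<zeta>" if "Re \<zeta> < X0" for \<zeta>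
  proof -
    have "u (\<zeta> + turn) = P * (a11 * y1 \<zeta> + a12 * y2 \<zeta>) + Q * (a21 * y1 \<zeta> + a22 * y2 \<zeta>)"
      unfolding u_def sh[OF that] P_def Q_def by simp
    also have "\<dots> = A * u \<zeta> + B * v \<zeta>"
      unfolding y_uv[of \<zeta>] A_def B_def by (simp add: P_def Q_def algebra_simps)
    finally show ?thesis .
  qed
  have shv0: "v (\<zeta> + turn) = C * u \<zeta> + D * v \<zeta>" if "Re \<zeta> < X0" for \<zeta>
  proof -
    have "v (\<zeta> + turn) = - Q * (a11 * y1 \<zeta> + a12 * y2 \<zeta>) + P * (a21 * y1 \<zeta> + a22 * y2 \<zeta>)"
      unfolding v_def sh[OF that] P_def Q_def by simp
    also have "\<dots> = C * u \<zeta> + D * v \<zeta>"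
      unfolding y_uv[of \<zeta>] C_def D_def by (simp add: P_def Q_def algebra_simps)
    finally show ?thesis .
  qed
  have C0: "C = 0" by (rule dominated_shift_coefficient_zero[OF uvhol Wuv bluv dom shu shv0])
  have shv: "v (\<zeta> + turn) = D * v \<zeta>" if "Re \<zeta> < X0" for \<zeta> using shv0[OF that] C0 by simp
  \<comment> \<open>Reflection conjugates a turn into its inverse, so the backward turn has the
    conjugate matrix.\<close>
  have bwd: "u (\<zeta> - turn) = cnj A * u \<zeta> + cnj B * v \<zeta>" "v (\<zeta> - turn) = cnj D * v \<zeta>" if "Re \<zeta> < X0" for \<zeta>
    using shu[of "cnj \<zeta>"] shv[of "cnj \<zeta>"] uvreal[of \<zeta>] uvreal[of "cnj \<zeta> + turn"] that by auto
  have "\<exists>\<zeta>. Re \<zeta> < X0 \<and> v \<zeta> \<noteq> 0"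
  proof (rule ccontr)
    assume "\<not> ?thesis"
    then have v0: "v \<zeta> = 0" if "Re \<zeta> < X0" for \<zeta> using that by blast
    let ?z = "complex_of_real (X0 - 1)"
    have "deriv v ?z = deriv (\<lambda>_. 0) ?z"
      by (intro deriv_cong_ev eventually_mono[OF eventually_nhds_in_open[OF oH]]) (auto simp: v0)
    then show False using Wuv[of ?z] v0[of ?z] by (simp add: wronskian_def)
  qed
  then obtain \<zeta>0 where \<zeta>0: "Re \<zeta>0 < X0" "v \<zeta>0 \<noteq> 0" by blast
  have "v \<zeta>0 = D * cnj D * v \<zeta>0" using shv[of "\<zeta>0 - turn"] bwd(2)[OF \<zeta>0(1)] \<zeta>0 by simp
  then have DD: "D * cnj D = 1" using \<zeta>0 by simp
  \<comment> \<open>Translation preserves the constant Wronskian, and the determinant of the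
    triangular matrix is \<open>A * D\<close>.\<close>
  have AD: "A * D = 1"
  proof -
    let ?z = "complex_of_real (X0 - 1)"
    have zH: "Re ?z < X0" by simp
    have du: "deriv f (?z + turn) = deriv (\<lambda>\<zeta>. f (\<zeta> + turn)) ?z" if "f field_differentiable at (?z + turn)" for f
    proof -
      have "((\<lambda>\<zeta>. \<zeta> + turn) has_field_derivative 1) (at ?z)" by (auto intro!: derivative_eq_intros)
      from DERIV_chain2[OF field_differentiable_derivI[OF that] this] show ?thesis
        by (intro DERIV_imp_deriv[symmetric]) simp
    qed
    have ev: "\<forall>\<^sub>F \<zeta> in nhds ?z. Re \<zeta> < X0"
      using eventually_nhds_in_open[OF oH, of ?z] by simp
    have "deriv u (?z + turn) = deriv (\<lambda>\<zeta>. A * u \<zeta> + B * v \<zeta>) ?z"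
      using ev uvfd[of "?z + turn"] by (subst du) (auto intro!: deriv_cong_ev elim!: eventually_mono simp: shu)
    moreover have "deriv v (?z + turn) = deriv (\<lambda>\<zeta>. 0 * u \<zeta> + D * v \<zeta>) ?z"
      using ev uvfd[of "?z + turn"] by (subst du) (auto intro!: deriv_cong_ev elim!: eventually_mono simp: shv)
    ultimately have "wronskian u v (?z + turn) = wronskian (\<lambda>\<zeta>. A * u \<zeta> + B * v \<zeta>) (\<lambda>\<zeta>. 0 * u \<zeta> + D * v \<zeta>) ?z"
      unfolding wronskian_def using shu[OF zH] shv[OF zH] by simp
    also have "\<dots> = A * D" using wronskian_linear_combination[OF uvfd[OF zH], of A B 0 D] Wuv[OF zH] by simp
    finally show ?thesis using Wuv[of "?z + turn"] by simp
  qed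
  have Dc: "D = cnj A"
  proof -
    have "D = D * cnj (A * D)" by (simp add: AD)
    also have "\<dots> = (D * cnj D) * cnj A" by simp
    finally show ?thesis by (simp add: DD)
  qed
  have AA: "A * cnj A = 1" using AD Dc by simp
  have nA: "norm A = 1"
  proof -
    have "complex_of_real ((norm A)\<^sup>2) = 1" unfolding complex_norm_square by (rule AA)
    then have "(norm A)\<^sup>2 = 1" using of_real_eq_1_iff by blast
    then show ?thesis by (simp add: power2_eq_1_iff) (smt (verit) norm_ge_zero)
  qed
  have Bi: "cnj B = - B"
  proof -
    have "u \<zeta>0 = A * (cnj A * u \<zeta>0 + cnj B * v \<zeta>0) + B * (A * v \<zeta>0)"
      using shu[of "\<zeta>0 - turn"] bwd[OF \<zeta>0(1)] \<zeta>0 Dc by simp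
    also have "\<dots> = (A * cnj A) * u \<zeta>0 + A * (cnj B + B) * v \<zeta>0" by (simp add: algebra_simps)
    finally have "A * (cnj B + B) * v \<zeta>0 = 0" by (simp add: AA)
    then have "cnj B + B = 0" using \<zeta>0 nA by auto
    then show ?thesis by (simp add: eq_neg_iff_add_eq_0)
  qed
  \<comment> \<open>The equation for \<open>\<tau>\<close> is the requirement that the triangular
    matrix has the normal form in the new basis.\<close>
  have shear: "monodromy_form X0 (\<lambda>z. k * u z + c * v z) v k A \<tau>"
    if k: "k \<noteq> 0" "cnj k = k" and c: "cnj c = c"
      and \<tau>: "k * B + c * cnj A = A * (c + \<tau>)" "\<tau> = 0 \<or> \<tau> = turn \<and> cnj A = A" for k c \<tau>
    unfolding monodromy_form_def
  proof (intro conjI allI impI)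
    show "(\<lambda>z. k * u z + c * v z) holomorphic_on ?H" "v holomorphic_on ?H" by (intro holomorphic_intros uvhol)+
    fix \<zeta> assume \<zeta>: "Re \<zeta> < X0"
    show "wronskian (\<lambda>z. k * u z + c * v z) v \<zeta> = k"
      using wronskian_linear_combination[OF uvfd[OF \<zeta>], of k c 0 1] Wuv[OF \<zeta>] by simp
    show "k * u (cnj \<zeta>) + c * v (cnj \<zeta>) = cnj (k * u \<zeta> + c * v \<zeta>)" "v (cnj \<zeta>) = cnj (v \<zeta>)"
      using uvreal[OF \<zeta>] k c by auto
    have "k * (A * u \<zeta> + B * v \<zeta>) + c * (cnj A * v \<zeta>) = A * k * u \<zeta> + (k * B + c * cnj A) * v \<zeta>"
      by (simp add: algebra_simps)
    also have "\<dots> = A * (k * u \<zeta> + c * v \<zeta> + \<tau> * v \<zeta>)" unfolding \<tau>(1) by (simp add: algebra_simps)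
    finally show "k * u (\<zeta> + turn) + c * v (\<zeta> + turn) = A * (k * u \<zeta> + c * v \<zeta> + \<tau> * v \<zeta>)"
      using shu[OF \<zeta>] shv[OF \<zeta>] Dc by simp
    show "v (\<zeta> + turn) = cnj A * v \<zeta>" using shv[OF \<zeta>] Dc by simp
  qed (use k nA \<tau>(2) dominates_blowup_shear[OF bluv dom k(1)] in auto)
  have A0: "A \<noteq> 0" using nA by auto
  have "\<exists>k c \<tau>. monodromy_form X0 (\<lambda>z. k * u z + c * v z) v k A \<tau> \<and> k \<noteq> 0"
  proof (cases "cnj A = A")
    case False
    \<comment> \<open>Adding this multiple of v moves the second fixed point of the turn to 0. The
      coefficient is real as a quotient of imaginary numbers.\<close>
    have "monodromy_form X0 (\<lambda>z. 1 * u z + (B / (A - cnj A)) * v z) v 1 A 0"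
    proof (rule shear)
      show "cnj (B / (A - cnj A)) = B / (A - cnj A)" using Bi False by (simp add: divide_simps) (simp add: algebra_simps)
      show "1 * B + B / (A - cnj A) * cnj A = A * (B / (A - cnj A) + 0)" using False by (simp add: divide_simps) (simp add: algebra_simps)
    qed auto
    then show ?thesis by (metis zero_neq_one)
  next
    case True
    show ?thesis
    proof (cases "B = 0")
      case True
      have "monodromy_form X0 (\<lambda>z. 1 * u z + 0 * v z) v 1 A 0" by (rule shear) (use True in auto)
      then show ?thesis by (metis zero_neq_one)
    next
      case B: False
      \<comment> \<open>This factor makes the translation equal to \<open>turn\<close>. It is real,
        since A is real and both \<open>turn\<close> and B are imaginary.\<close>
      have "monodromy_form X0 (\<lambda>z. (turn * A / B) * u z + 0 * v z) v (turn * A / B) A turn"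
        by (rule shear) (use True B Bi A0 in auto)
      moreover have "turn * A / B \<noteq> 0" using A0 B by simp
      ultimately show ?thesis by blast
    qed
  qed
  then obtain k c \<tau> where mf: "monodromy_form X0 (\<lambda>z. k * u z + c * v z) v k A \<tau>" and k: "k \<noteq> 0" by blast
  show ?thesis
  proof (rule that)
    have "(\<lambda>z. k * u z + c * v z) = (\<lambda>z. (k * P - c * Q) * y1 z + (k * Q + c * P) * y2 z)"
      by (auto simp: u_def v_def P_def Q_def algebra_simps)
    then show "monodromy_form X0 (\<lambda>z. (k * P - c * Q) * y1 z + (k * Q + c * P) * y2 z) (\<lambda>z. (- Q) * y1 z + P * y2 z) k A \<tau>"
      using mf by (simp add: v_def[abs_def] P_def Q_def)
    have "(k * P - c * Q) * P - (k * Q + c * P) * (- Q) = k * (P * P + Q * Q)" by (simp add: algebra_simps)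
    then show "(k * P - c * Q) * P - (k * Q + c * P) * (- Q) \<noteq> 0" using k pqc by (simp add: P_def Q_def)
  qed
qed

section \<open>Growth of the dominating solution\<close>

text \<open>Infinitesimal Harnack inequality: the Cayley transform centred at the value f z carries
  the right half plane to the unit disc, where the Schwarz lemma applies.\<close>

lemma deriv_bound_positive_real_part:
  assumes f: "f holomorphic_on ball z R" and R: "R > 0"
    and pos: "\<And>w. w \<in> ball z R \<Longrightarrow> Re (f w) > 0"
  shows "norm (deriv f z) \<le> 2 * Re (f z) / R"
proof -
  define a where "a = f z"
  have a: "Re a > 0" using pos[of z] R by (simp add: a_def)
  define g where "g w = (f (z + of_real R * w) - a) / (f (z + of_real R * w) + cnj a)" for w
  have inb: "z + of_real R * w \<in> ball z R" if "w \<in> ball 0 1" for w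
    using that R by (simp add: dist_norm norm_mult)
  have den: "f (z + of_real R * w) + cnj a \<noteq> 0" if "w \<in> ball 0 1" for w
  proof -
    have "Re (f (z + of_real R * w) + cnj a) > 0" using pos[OF inb[OF that]] a by simp
    then show ?thesis by (metis less_irrefl zero_complex.sel(1))
  qed
  have hol1: "(\<lambda>w. f (z + of_real R * w)) holomorphic_on ball 0 1"
    by (rule holomorphic_on_compose_gen[OF _ f, unfolded o_def])
      (use inb in \<open>auto intro!: holomorphic_intros\<close>)
  have hol: "g holomorphic_on ball 0 1"
    unfolding g_def using den by (intro holomorphic_intros hol1) auto
  have lt: "norm (g w) < 1" if w: "norm w < 1" for w
  proof -
    let ?b = "f (z + of_real R * w)"
    have b: "Re ?b > 0" using pos inb w by simp
    have "(norm (?b - a))\<^sup>2 < (norm (?b + cnj a))\<^sup>2"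
      unfolding cmod_power2 using mult_pos_pos[OF a b] by (simp add: power2_eq_square algebra_simps)
    then have "norm (?b - a) < norm (?b + cnj a)" by (rule power2_less_imp_less) simp
    then show ?thesis using den[of w] w by (simp add: g_def norm_divide divide_simps)
  qed
  have "g 0 = 0" by (simp add: g_def a_def)
  then have d1: "norm (deriv g 0) \<le> 1" using Schwarz_Lemma(2)[OF hol _ lt, of 0] by simp
  have df: "(f has_field_derivative deriv f z) (at (z + of_real R * 0))"
    using holomorphic_derivI[OF f, of z] R by simp
  have "((\<lambda>w. z + of_real R * w) has_field_derivative of_real R) (at 0)"
    by (auto intro!: derivative_eq_intros)
  from DERIV_chain2[OF df this]
  have "((\<lambda>w. f (z + of_real R * w)) has_field_derivative deriv f z * of_real R) (at 0)" .
  then have "(g has_field_derivative ((deriv f z * of_real R) * (a + cnj a) - (a - a) * (deriv f z * of_real R)) / ((a + cnj a) * (a + cnj a))) (at 0)"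
    unfolding g_def using den[of 0] by (auto intro!: derivative_eq_intros simp: a_def)
  then have "deriv g 0 = deriv f z * of_real R / (a + cnj a)"
    using den[of 0] by (subst DERIV_imp_deriv) (auto simp: a_def)
  moreover have "a + cnj a = of_real (2 * Re a)" by (simp add: complex_eq_iff)
  ultimately have "norm (deriv f z) * R / (2 * Re a) \<le> 1" using d1 a R by (simp add: norm_divide norm_mult)
  then show ?thesis using a R by (simp add: a_def divide_simps mult.commute)
qed

(* log |u| is a positive harmonic function on a half strip whose mean over vertical segments of length
   2 pi grows at most linearly, so Harnack's inequality bounds |u| by a power of exp (- Re z). *)
lemma monodromy_form_growth:
  assumes mf: "monodromy_form X0 u v w \<mu> \<tau>"
  shows "\<exists>K\<ge>0. \<exists>X\<le>min X0 0. \<forall>\<zeta>. Re \<zeta> < X \<and> 0 \<le> Im \<zeta> \<and> Im \<zeta> \<le> 2 * pi \<longrightarrow>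
     norm (u \<zeta>) \<le> exp (K * (1 - Re \<zeta>)) \<and> norm (v \<zeta>) \<le> exp (K * (1 - Re \<zeta>))"
proof -
  note hol = mf_hol[OF mf]
  \<comment> \<open>As |\<open>\<tau>\<close>| \<le> 2 pi, the ratio 1 / (8 pi) keeps the norm of
    \<open>\<tau> * v / u\<close> at most 1 / 4, and 1 plus this quotient has a principal
    logarithm.\<close>
  obtain X1 where X1: "X1 \<le> X0" "\<And>\<zeta>. \<zeta> \<in> left_strip X1 \<Longrightarrow> norm (v \<zeta>) \<le> 1 / (8 * pi) * norm (u \<zeta>)"
    using ratio_small[OF mf, of "1 / (8 * pi)"] pi_gt3 by auto
  \<comment> \<open>Together with |v| \<le> |u| the value 4 gives |u|^2 \<ge> 2, so log |u| is
    positive.\<close>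
  obtain X2 where X2: "\<And>\<zeta>. \<zeta> \<in> left_strip X2 \<Longrightarrow> 4 \<le> (norm (u \<zeta>))\<^sup>2 + (norm (v \<zeta>))\<^sup>2"
    using mf_blowup[OF mf] unfolding blowup_def by blast
  define X where "X = min (min X1 X2) 0"
  have vu: "norm (v \<zeta>) \<le> norm (u \<zeta>)" "norm (\<tau> * v \<zeta>) \<le> 1 / 4 * norm (u \<zeta>)" "1 < norm (u \<zeta>)"
    if "\<zeta> \<in> left_strip X" for \<zeta>
  proof -
    have \<zeta>: "\<zeta> \<in> left_strip X1" "\<zeta> \<in> left_strip X2" using that by (auto simp: left_strip_def X_def)
    have v: "norm (v \<zeta>) \<le> 1 / (8 * pi) * norm (u \<zeta>)" by (rule X1(2)[OF \<zeta>(1)])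
    also have "\<dots> \<le> 1 * norm (u \<zeta>)" using pi_gt3 by (intro mult_right_mono) auto
    finally show le: "norm (v \<zeta>) \<le> norm (u \<zeta>)" by simp
    have "norm \<tau> \<le> 2 * pi" using mf_cases[OF mf] by (auto simp: turn_def norm_mult)
    then have "norm (\<tau> * v \<zeta>) \<le> (2 * pi) * (1 / (8 * pi) * norm (u \<zeta>))"
      unfolding norm_mult using v by (intro mult_mono) auto
    then show "norm (\<tau> * v \<zeta>) \<le> 1 / 4 * norm (u \<zeta>)" by simp
    have "4 \<le> (norm (u \<zeta>))\<^sup>2 + (norm (v \<zeta>))\<^sup>2" by (rule X2[OF \<zeta>(2)])
    moreover have "(norm (v \<zeta>))\<^sup>2 \<le> (norm (u \<zeta>))\<^sup>2" by (rule power_mono[OF le norm_ge_zero])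
    ultimately have "1 < (norm (u \<zeta>))\<^sup>2" by linarith
    then have "1\<^sup>2 < (norm (u \<zeta>))\<^sup>2" by simp
    then show "1 < norm (u \<zeta>)" by (rule power2_less_imp_less) simp
  qed
  define V where "V = {\<zeta>. Re \<zeta> < X} \<inter> ({\<zeta>. - pi < Im \<zeta>} \<inter> {\<zeta>. Im \<zeta> < 3 * pi})"
  have V: "open V" "convex V" unfolding V_def
    by (intro open_Int convex_Int open_halfspace_Re_lt open_halfspace_Im_lt open_halfspace_Im_gt
      convex_halfspace_Re_lt convex_halfspace_Im_lt convex_halfspace_Im_gt)+
  have VS: "V \<subseteq> left_strip X" by (auto simp: V_def left_strip_def)
  have VH: "V \<subseteq> {\<zeta>. Re \<zeta> < X0}" using X1(1) by (auto simp: V_def X_def)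
  have u0: "u \<zeta> \<noteq> 0" if "\<zeta> \<in> V" for \<zeta> using vu(3)[of \<zeta>] that VS by auto
  obtain l where l: "l holomorphic_on V" "\<And>\<zeta>. \<zeta> \<in> V \<Longrightarrow> u \<zeta> = exp (l \<zeta>)"
    using contractible_imp_holomorphic_log[OF holomorphic_on_subset[OF hol(1) VH] convex_imp_contractible[OF V(2)] u0] by blast
  have Rel: "Re (l \<zeta>) > 0" if "\<zeta> \<in> V" for \<zeta>
  proof -
    have "1 < norm (u \<zeta>)" using vu(3) that VS by auto
    then show ?thesis using l(2)[OF that] by (simp add: norm_exp_eq_Re)
  qed
  \<comment> \<open>The part of the strip from which one turn stays within \<open>V\<close>.\<close>
  define V' where "V' = {\<zeta>. Re \<zeta> < X} \<inter> ({\<zeta>. - pi < Im \<zeta>} \<inter> {\<zeta>. Im \<zeta> < pi})"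
  have V': "open V'" "convex V'" unfolding V'_def
    by (intro open_Int convex_Int open_halfspace_Re_lt open_halfspace_Im_lt open_halfspace_Im_gt
      convex_halfspace_Re_lt convex_halfspace_Im_lt convex_halfspace_Im_gt)+
  have V'V: "V' \<subseteq> V" and V't: "\<And>\<zeta>. \<zeta> \<in> V' \<Longrightarrow> \<zeta> + turn \<in> V" using pi_gt3 by (auto simp: V'_def V_def)
  define h where "h \<zeta> = \<tau> * v \<zeta> / u \<zeta>" for \<zeta>
  have h: "norm (h \<zeta>) \<le> 1 / 4" if "\<zeta> \<in> V" for \<zeta>
    using vu(2)[of \<zeta>] u0[OF that] that VS by (auto simp: h_def norm_divide divide_simps)
  have h1: "1 + h \<zeta> \<notin> \<real>\<^sub>\<le>\<^sub>0" if "\<zeta> \<in> V" for \<zeta>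
  proof -
    have "\<bar>Re (h \<zeta>)\<bar> \<le> 1 / 4" using h[OF that] abs_Re_le_cmod[of "h \<zeta>"] by linarith
    then show ?thesis by (auto simp: complex_nonpos_Reals_iff)
  qed
  \<comment> \<open>Up to a branch of log \<open>\<mu>\<close>, the increment of log u over a turn
    is the logarithm of 1 + \<open>h\<close>. \<open>D\<close> is this branch; its exponential is
    constant, hence so is \<open>D\<close>, and the increment is bounded.\<close>
  define D where "D \<zeta> = l (\<zeta> + turn) - l \<zeta> - Ln (1 + h \<zeta>)" for \<zeta>
  have lV': "l holomorphic_on V'" "(\<lambda>\<zeta>. l (\<zeta> + turn)) holomorphic_on V'"
    using l(1) V'V holomorphic_on_subset apply blast
    by (rule holomorphic_on_compose_gen[OF _ l(1), unfolded o_def]) (use V't in \<open>auto intro!: holomorphic_intros\<close>)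
  have hhol: "h holomorphic_on V'"
    unfolding h_def using u0 V'V by (intro holomorphic_intros holomorphic_on_subset[OF hol(1)] holomorphic_on_subset[OF hol(2)]) (use VH in auto)
  have Dhol: "D holomorphic_on V'"
    unfolding D_def using h1 V'V by (intro holomorphic_intros lV' hhol) auto
  have expD: "exp (D \<zeta>) = \<mu>" if z: "\<zeta> \<in> V'" for \<zeta>
  proof -
    have zV: "\<zeta> \<in> V" using z V'V by auto
    have "1 + h \<zeta> \<noteq> 0" using h1[OF zV] by auto
    then have "exp (D \<zeta>) = u (\<zeta> + turn) / u \<zeta> / (1 + h \<zeta>)"
      by (simp add: D_def exp_diff l(2)[OF zV] l(2)[OF V't[OF z]])
    also have "u (\<zeta> + turn) = \<mu> * (u \<zeta> * (1 + h \<zeta>))"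
      using mf_shift(1)[OF mf, of \<zeta>] zV VH u0[OF zV] by (auto simp: h_def algebra_simps)
    finally show ?thesis using \<open>1 + h \<zeta> \<noteq> 0\<close> u0[OF zV] by simp
  qed
  have "D constant_on V'"
  proof (rule has_field_derivative_0_imp_constant_on[OF _ _ V'(1)])
    fix \<zeta> assume z: "\<zeta> \<in> V'"
    have d: "(D has_field_derivative deriv D \<zeta>) (at \<zeta>)" using holomorphic_derivI[OF Dhol V'(1) z] .
    then have "((\<lambda>\<zeta>. exp (D \<zeta>)) has_field_derivative exp (D \<zeta>) * deriv D \<zeta>) (at \<zeta>)"
      by (auto intro!: derivative_eq_intros)
    moreover have "((\<lambda>\<zeta>. exp (D \<zeta>)) has_field_derivative 0) (at \<zeta>)"
      by (rule has_field_derivative_transform_within_open[OF DERIV_const[of \<mu>] V'(1) z]) (simp add: expD)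
    ultimately have "exp (D \<zeta>) * deriv D \<zeta> = 0" by (rule DERIV_unique)
    then show "(D has_field_derivative 0) (at \<zeta>)" using d by simp
  qed (use V'(2) in \<open>simp add: convex_connected\<close>)
  then obtain D0 where D0: "\<And>\<zeta>. \<zeta> \<in> V' \<Longrightarrow> D \<zeta> = D0" by (auto simp: constant_on_def)
  define C where "C = norm D0 + 1 / 2"
  have C: "C \<ge> 0" by (simp add: C_def)
  have lC: "norm (l (\<zeta> + turn) - l \<zeta>) \<le> C" if z: "\<zeta> \<in> V'" for \<zeta>
  proof -
    have "l (\<zeta> + turn) - l \<zeta> = D0 + Ln (1 + h \<zeta>)" using D0[OF z] by (simp add: D_def algebra_simps)
    moreover have "norm (Ln (1 + h \<zeta>)) \<le> 2 * norm (h \<zeta>)" using h[of \<zeta>] z V'V by (intro norm_Ln_le) force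
    ultimately show ?thesis using h[of \<zeta>] z V'V norm_triangle_ineq[of D0 "Ln (1 + h \<zeta>)"] by (force simp: C_def)
  qed
  define m where "m x = integral {0..2 * pi} (\<lambda>y. l (Complex x y))" for x
  have sub: "Complex x y \<in> V" if "x < X" "y \<in> {0..2 * pi}" for x y
    using that pi_gt3 by (auto simp: V_def)
  \<comment> \<open>Discs of radius pi around points to the left of \<open>b\<close> with height
    from 0 to 2 pi stay in the domain of the logarithm.\<close>
  define b where "b = X - pi - 1"
  have mb: "norm (m b - m x) \<le> C * (b - x)" if x: "x < b" for x
  proof -
    have d: "(m has_vector_derivative - \<i> * (l (of_real t + turn) - l (of_real t))) (at t within {x..b})" if "t \<in> {x..b}" for t
      unfolding m_def
      by (rule vertical_integral_derivative[OF l(1) V(1) _ that]) (use sub pi_gt3 in \<open>auto simp: b_def\<close>)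
    have "norm (m b - m x) \<le> C * b - C * x"
    proof (rule differentiable_bound_general[OF x, where \<phi> = "\<lambda>t. C * t" and \<phi>' = "\<lambda>_. C"])
      show "continuous_on {x..b} m"
        by (rule continuous_on_vector_derivative) (rule d)
      fix t assume t: "x < t" "t < b"
      show "(m has_vector_derivative - \<i> * (l (of_real t + turn) - l (of_real t))) (at t)"
        using d[of t] t by (simp add: at_within_Icc_at)
      show "((*) C has_vector_derivative C) (at t)"
        unfolding has_real_derivative_iff_has_vector_derivative[symmetric] by (auto intro!: derivative_eq_intros)
      show "norm (- \<i> * (l (of_real t + turn) - l (of_real t))) \<le> C"
        using lC[of "of_real t"] t pi_gt3 by (simp add: norm_mult V'_def b_def)
    qed (intro continuous_intros)
    then show ?thesis by (simp add: algebra_simps)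
  qed
  \<comment> \<open>On discs of radius pi the derivative bound gives |\<open>\<phi>'\<close>| \<le>
    \<open>\<phi>\<close>, because 2 / pi < 1. Integration over a height of at most 2 pi costs a
    factor exp (2 pi).\<close>
  have harnack: "Re (l (Complex x y)) \<le> exp (2 * pi) * Re (l (of_real x))" "Re (l (of_real x)) \<le> exp (2 * pi) * Re (l (Complex x y))"
    if x: "x < b" and y: "y \<in> {0..2 * pi}" for x y
  proof -
    define \<phi> where "\<phi> t = Re (l (Complex x t))" for t
    have d: "(\<phi> has_real_derivative - Im (deriv l (Complex x t))) (at t)"
      and bd: "\<bar>Im (deriv l (Complex x t))\<bar> \<le> \<phi> t" and pos: "\<phi> t > 0" if t: "0 \<le> t" "t \<le> 2 * pi" for t
    proof -
      have zV: "Complex x t \<in> V" using sub x t pi_gt3 by (simp add: b_def)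
      have "((\<lambda>t. Complex x t) has_vector_derivative \<i>) (at t)"
        unfolding Complex_eq by (auto intro!: derivative_eq_intros)
      from field_vector_diff_chain_at[OF this holomorphic_derivI[OF l(1) V(1) zV]]
      have "((\<lambda>t. l (Complex x t)) has_vector_derivative \<i> * deriv l (Complex x t)) (at t)" by (simp add: o_def)
      from bounded_linear.has_vector_derivative[OF bounded_linear_Re this]
      show "(\<phi> has_real_derivative - Im (deriv l (Complex x t))) (at t)"
        unfolding has_real_derivative_iff_has_vector_derivative \<phi>_def by simp
      have bV: "ball (Complex x t) pi \<subseteq> V"
      proof
        fix z assume "z \<in> ball (Complex x t) pi"
        then have "norm (z - Complex x t) < pi" by (simp add: dist_norm norm_minus_commute)
        then have "\<bar>Re z - x\<bar> < pi" "\<bar>Im z - t\<bar> < pi"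
          using abs_Re_le_cmod[of "z - Complex x t"] abs_Im_le_cmod[of "z - Complex x t"] by auto
        then show "z \<in> V" using x t by (auto simp: V_def b_def)
      qed
      show pos: "\<phi> t > 0" using Rel[OF zV] by (simp add: \<phi>_def)
      have "norm (deriv l (Complex x t)) \<le> 2 * Re (l (Complex x t)) / pi"
        by (rule deriv_bound_positive_real_part) (use bV Rel l(1) holomorphic_on_subset in auto)
      also have "\<dots> \<le> \<phi> t" using pi_gt3 pos by (simp add: \<phi>_def divide_simps mult.commute mult_right_mono)
      finally show "\<bar>Im (deriv l (Complex x t))\<bar> \<le> \<phi> t" using abs_Im_le_cmod[of "deriv l (Complex x t)"] by linarith
    qed
    have y': "0 \<le> y" "y \<le> 2 * pi" using y by auto
    have "exp (- y) * \<phi> y \<le> exp (- 0) * \<phi> 0"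
    proof (rule DERIV_nonpos_imp_nonincreasing[OF y'(1)])
      fix t assume t: "0 \<le> t" "t \<le> y"
      then have "((\<lambda>t. exp (- t) * \<phi> t) has_real_derivative exp (- t) * (- Im (deriv l (Complex x t))) + (- exp (- t)) * \<phi> t) (at t)"
        using y' by (auto intro!: derivative_eq_intros d simp: algebra_simps)
      moreover have "exp (- t) * (- Im (deriv l (Complex x t))) + (- exp (- t)) * \<phi> t = exp (- t) * (- Im (deriv l (Complex x t)) - \<phi> t)"
        by (simp add: algebra_simps)
      moreover have "exp (- t) * (- Im (deriv l (Complex x t)) - \<phi> t) \<le> 0"
        using bd[of t] t y' by (intro mult_nonneg_nonpos) auto
      ultimately show "\<exists>y. ((\<lambda>t. exp (- t) * \<phi> t) has_real_derivative y) (at t) \<and> y \<le> 0" by metis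
    qed
    then have "\<phi> y \<le> exp y * \<phi> 0" by (simp add: exp_minus field_simps)
    also have "\<dots> \<le> exp (2 * pi) * \<phi> 0" using y' pos[of 0] pi_gt3 by (intro mult_right_mono) auto
    finally show "Re (l (Complex x y)) \<le> exp (2 * pi) * Re (l (of_real x))" by (simp add: \<phi>_def complex_of_real_def)
    have "exp 0 * \<phi> 0 \<le> exp y * \<phi> y"
    proof (rule DERIV_nonneg_imp_nondecreasing[OF y'(1)])
      fix t assume t: "0 \<le> t" "t \<le> y"
      then have "((\<lambda>t. exp t * \<phi> t) has_real_derivative exp t * (- Im (deriv l (Complex x t))) + exp t * \<phi> t) (at t)"
        using y' by (auto intro!: derivative_eq_intros d simp: algebra_simps)
      moreover have "exp t * (- Im (deriv l (Complex x t))) + exp t * \<phi> t = exp t * (\<phi> t - Im (deriv l (Complex x t)))"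
        by (simp add: algebra_simps)
      moreover have "exp t * (\<phi> t - Im (deriv l (Complex x t))) \<ge> 0"
        using bd[of t] t y' by (intro mult_nonneg_nonneg) auto
      ultimately show "\<exists>y. ((\<lambda>t. exp t * \<phi> t) has_real_derivative y) (at t) \<and> 0 \<le> y" by metis
    qed
    then have "\<phi> 0 \<le> exp y * \<phi> y" by simp
    also have "\<dots> \<le> exp (2 * pi) * \<phi> y" using y' pos[of y] by (intro mult_right_mono) auto
    finally show "Re (l (of_real x)) \<le> exp (2 * pi) * Re (l (Complex x y))" by (simp add: \<phi>_def complex_of_real_def)
  qed
  \<comment> \<open>One factor exp (2 pi) leads from the vertical integral to the point on the real
    axis, the other from there to the rest of the segment. The integral itself grows at most with
    slope \<open>C\<close>.\<close>
  define K where "K = exp (2 * pi) * (exp (2 * pi) * (norm (m b) + C))"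
  have K: "K \<ge> 0" using C by (simp add: K_def)
  have main: "Re (l (Complex x y)) \<le> K * (1 - x)" if x: "x < b" and y: "y \<in> {0..2 * pi}" for x y
  proof -
    have b0: "b \<le> 0" using pi_gt3 by (simp add: b_def X_def min_def)
    have xX: "x < X" using x pi_gt3 by (simp add: b_def)
    have cont: "continuous_on {0..2 * pi} (\<lambda>y. l (Complex x y))"
      by (rule continuous_on_compose2[OF holomorphic_on_imp_continuous_on[OF l(1)]])
        (use sub[OF xX] in \<open>auto simp: Complex_eq intro!: continuous_intros\<close>)
    have i1: "((\<lambda>y. Re (l (Complex x y))) has_integral Re (m x)) {0..2 * pi}"
      using has_integral_linear[OF integrable_integral[OF integrable_continuous_real[OF cont]] bounded_linear_Re]
      by (simp add: m_def o_def)
    have i2: "((\<lambda>y. exp (- (2 * pi)) * Re (l (of_real x))) has_integral (2 * pi) * (exp (- (2 * pi)) * Re (l (of_real x)))) {0..2 * pi}"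
      using has_integral_const_real[of "exp (- (2 * pi)) * Re (l (of_real x))" 0 "2 * pi"] pi_gt3 by simp
    have "(2 * pi) * (exp (- (2 * pi)) * Re (l (of_real x))) \<le> Re (m x)"
    proof (rule has_integral_le[OF i2 i1])
      fix y assume "y \<in> {0..2 * pi}"
      from harnack(2)[OF x this] show "exp (- (2 * pi)) * Re (l (of_real x)) \<le> Re (l (Complex x y))"
        by (simp add: exp_minus field_simps)
    qed
    moreover have pos0: "Re (l (of_real x)) > 0" using Rel[OF sub[OF xX, of 0]] pi_gt3 by (simp add: complex_of_real_def)
    moreover have "1 * (exp (- (2 * pi)) * Re (l (of_real x))) \<le> (2 * pi) * (exp (- (2 * pi)) * Re (l (of_real x)))"
      using pi_gt3 pos0 by (intro mult_right_mono) auto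
    ultimately have "exp (- (2 * pi)) * Re (l (of_real x)) \<le> Re (m x)" by linarith
    then have 1: "Re (l (of_real x)) \<le> exp (2 * pi) * Re (m x)" by (simp add: exp_minus field_simps)
    have "Re (m x) \<le> norm (m x)" by (rule complex_Re_le_cmod)
    also have "\<dots> \<le> norm (m b) + C * (b - x)" using mb[OF x] norm_triangle_ineq3[of "m x" "m b"] by (simp add: norm_minus_commute abs_le_iff)
    also have "\<dots> \<le> norm (m b) * (1 - x) + C * (1 - x)"
    proof (rule add_mono)
      show "norm (m b) \<le> norm (m b) * (1 - x)" using mult_left_mono[of 1 "1 - x" "norm (m b)"] x b0 by simp
      show "C * (b - x) \<le> C * (1 - x)" using C b0 by (intro mult_left_mono) auto
    qed
    also have "\<dots> = (norm (m b) + C) * (1 - x)" by (simp add: algebra_simps)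
    finally have 2: "Re (m x) \<le> (norm (m b) + C) * (1 - x)" .
    have "Re (l (Complex x y)) \<le> exp (2 * pi) * Re (l (of_real x))" by (rule harnack(1)[OF x y])
    also have "\<dots> \<le> exp (2 * pi) * (exp (2 * pi) * Re (m x))" using 1 by (intro mult_left_mono) auto
    also have "\<dots> \<le> exp (2 * pi) * (exp (2 * pi) * ((norm (m b) + C) * (1 - x)))" using 2 by (intro mult_left_mono) auto
    finally show ?thesis by (simp add: K_def mult_ac)
  qed
  have fin: "norm (u \<zeta>) \<le> exp (K * (1 - Re \<zeta>)) \<and> norm (v \<zeta>) \<le> exp (K * (1 - Re \<zeta>))"
    if \<zeta>: "Re \<zeta> < b" "0 \<le> Im \<zeta>" "Im \<zeta> \<le> 2 * pi" for \<zeta>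
  proof -
    have zV: "\<zeta> \<in> V" using sub[of "Re \<zeta>" "Im \<zeta>"] \<zeta> pi_gt3 by (simp add: b_def)
    have "Re (l \<zeta>) \<le> K * (1 - Re \<zeta>)" using main[of "Re \<zeta>" "Im \<zeta>"] \<zeta> by simp
    then have "norm (u \<zeta>) \<le> exp (K * (1 - Re \<zeta>))" using l(2)[OF zV] by (simp add: norm_exp_eq_Re)
    then show ?thesis using vu(1)[of \<zeta>] zV VS by auto
  qed
  have "X \<le> X1" "X \<le> 0" by (auto simp: X_def)
  then have "b \<le> min X0 0" using X1(1) pi_gt3 by (simp add: b_def)
  with K fin show ?thesis by blast
qed

section \<open>Single-valued functions on the punctured disc\<close>

text \<open>A function with period \<open>turn\<close> depends on the exponential only, so that any
  branch of the logarithm may be inserted into it.\<close>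

lemma periodic_exp_cong:
  assumes per: "\<And>\<zeta>. Re \<zeta> < X0 \<Longrightarrow> \<phi> (\<zeta> + turn) = \<phi> \<zeta>" and eq: "exp a = exp b" and a: "Re a < X0"
  shows "\<phi> a = \<phi> b"
proof -
  have nat: "\<phi> (\<zeta> + of_nat n * turn) = \<phi> \<zeta>" if "Re \<zeta> < X0" for n \<zeta>
  proof (induction n)
    case (Suc n)
    have "\<phi> (\<zeta> + of_nat (Suc n) * turn) = \<phi> ((\<zeta> + of_nat n * turn) + turn)" by (simp add: algebra_simps)
    also have "\<dots> = \<phi> \<zeta>" using per[of "\<zeta> + of_nat n * turn"] that Suc by simp
    finally show ?case .
  qed simp
  obtain n :: int where n: "a = b + of_int n * turn"
    using eq by (auto simp: exp_eq turn_def algebra_simps)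
  have Re: "Re b < X0" using a n by simp
  show ?thesis
  proof (cases "n \<ge> 0")
    case True
    then show ?thesis using nat[OF Re, of "nat n"] n by simp
  next
    case False
    then have "b = a + of_nat (nat (- n)) * turn" using n by (simp add: algebra_simps)
    then show ?thesis using nat[OF a, of "nat (- n)"] by simp
  qed
qed

text \<open>The principal logarithm jumps across its cut, but near each point it can be replaced by
  a holomorphic branch without changing the composition.\<close>

lemma periodic_Ln_holomorphic:
  assumes hol: "\<phi> holomorphic_on {\<zeta>. Re \<zeta> < ln \<epsilon>}" and eps: "\<epsilon> > 0"
    and per: "\<And>\<zeta>. Re \<zeta> < ln \<epsilon> \<Longrightarrow> \<phi> (\<zeta> + turn) = \<phi> \<zeta>"
  shows "(\<lambda>z. \<phi> (Ln z)) holomorphic_on Dstar \<epsilon>"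
proof -
  have "(\<lambda>z. \<phi> (Ln z)) field_differentiable at z0" if z0: "z0 \<in> Dstar \<epsilon>" for z0
  proof -
    have z00: "z0 \<noteq> 0" using z0 by (auto simp: Dstar_def)
    define U where "U = Dstar \<epsilon> \<inter> (\<lambda>z. z / z0) -` (- \<real>\<^sub>\<le>\<^sub>0)"
    have "open ((\<lambda>z. z / z0) -` (- \<real>\<^sub>\<le>\<^sub>0))"
      using z00 by (intro open_vimage continuous_intros) (auto simp: open_Compl)
    then have U: "open U" "z0 \<in> U" using z0 z00 by (auto simp: U_def)
    define L where "L z = Ln (z / z0) + Ln z0" for z
    have expL: "exp (L z) = z" if "z \<in> U" for z
      using that z00 by (auto simp: U_def Dstar_def L_def exp_add)
    have Lhol: "L holomorphic_on U"
      unfolding L_def using z00 by (intro holomorphic_intros) (auto simp: U_def)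
    have ReL: "Re (L z) < ln \<epsilon>" if "z \<in> U" for z
    proof -
      have "norm z = exp (Re (L z))" using expL[OF that] by (metis norm_exp_eq_Re)
      moreover have "norm z < \<epsilon>" using that by (auto simp: U_def Dstar_def)
      ultimately show ?thesis using eps by (metis exp_less_cancel_iff exp_ln)
    qed
    have "(\<lambda>z. \<phi> (L z)) holomorphic_on U"
      by (rule holomorphic_on_compose_gen[OF Lhol hol, unfolded o_def]) (use ReL in auto)
    moreover have "\<phi> (L z) = \<phi> (Ln z)" if "z \<in> U" for z
      by (rule periodic_exp_cong[of "ln \<epsilon>" \<phi>, OF per _ ReL[OF that]])
        (use expL[OF that] that in \<open>auto simp: U_def Dstar_def\<close>)
    ultimately have "(\<lambda>z. \<phi> (Ln z)) holomorphic_on U" by (simp cong: holomorphic_cong)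
    then show ?thesis using U by (rule holomorphic_on_imp_differentiable_at)
  qed
  then show ?thesis using open_Dstar by (simp add: holomorphic_on_def field_differentiable_at_within)
qed

text \<open>Riemann's theorem on removable singularities, applied to z^N times the function.\<close>

lemma not_essential_polynomially_bounded:
  assumes hol: "\<phi> holomorphic_on Dstar \<epsilon>" and eps: "\<epsilon> > 0"
    and bd: "\<forall>\<^sub>F z in at 0. norm (z ^ N * \<phi> z) \<le> C"
  shows "isolated_singularity_at \<phi> 0" "not_essential \<phi> 0"
proof -
  have D: "Dstar \<epsilon> = ball 0 \<epsilon> - {0}" by (auto simp: Dstar_def)
  show iso: "isolated_singularity_at \<phi> 0"
    by (rule isolated_singularity_at_holomorphic[of _ "ball 0 \<epsilon>"]) (use hol D eps in auto)
  have h: "(\<lambda>z. z ^ N * \<phi> z) holomorphic_on ball 0 \<epsilon> - {0}"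
    using hol D by (intro holomorphic_intros) auto
  have "\<exists>g. g holomorphic_on ball 0 \<epsilon> \<and> (\<forall>z\<in>ball 0 \<epsilon> - {0}. g z = z ^ N * \<phi> z)"
    using holomorphic_on_extend_bounded[OF h] bd eps by (auto simp: interior_open)
  then obtain g where g: "g holomorphic_on ball 0 \<epsilon>" "\<And>z. z \<in> ball 0 \<epsilon> - {0} \<Longrightarrow> g z = z ^ N * \<phi> z" by blast
  have ga: "g analytic_on {0}" using g(1) eps by (meson analytic_at centre_in_ball open_ball)
  have za: "(\<lambda>z. z ^ N) analytic_on {0::complex}" by (intro analytic_intros)
  have "not_essential (\<lambda>z. g z / z ^ N) 0"
    by (intro not_essential_divide not_essential_analytic isolated_singularity_at_analytic ga za)
  moreover have "\<forall>\<^sub>F z in at 0. g z / z ^ N = \<phi> z"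
  proof -
    have "\<forall>\<^sub>F z in at 0. z \<in> ball 0 \<epsilon> - {0::complex}"
      using eps by (intro eventually_at_in_open) auto
    then show ?thesis by eventually_elim (use g(2) in auto)
  qed
  ultimately show "not_essential \<phi> 0" by (rule not_essential_transform)
qed

lemma eventually_neq_of_deriv_nonzero:
  assumes "f field_differentiable at z" "f z \<noteq> 0 \<or> deriv f z \<noteq> 0"
  shows "\<forall>\<^sub>F w in at z. f w \<noteq> (0::complex)"
proof (cases "f z = 0")
  case False
  have "isCont f z" using assms(1) field_differentiable_imp_continuous_at by blast
  then have "(f \<longlongrightarrow> f z) (at z)" by (simp add: isCont_def)
  then show ?thesis using False by (rule tendsto_imp_eventually_ne)
next
  case True
  have "((\<lambda>w. (f w - f z) / (w - z)) \<longlongrightarrow> deriv f z) (at z)"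
    using field_differentiable_derivI[OF assms(1)] by (simp add: has_field_derivative_iff)
  then have "\<forall>\<^sub>F w in at z. (f w - f z) / (w - z) \<noteq> 0"
    using True assms(2) by (intro tendsto_imp_eventually_ne) auto
  then show ?thesis by eventually_elim (use True in auto)
qed

text \<open>\<open>u / v\<close> is many-valued. Expanded by v it has the numerator u v, which a
  turn preserves if \<open>\<tau>\<close> = 0 and otherwise increases by \<open>turn * v^2\<close>;
  the term with the coordinate compensates for this increase.\<close>

definition sv_num :: "complex \<Rightarrow> (complex \<Rightarrow> complex) \<Rightarrow> (complex \<Rightarrow> complex) \<Rightarrow> complex \<Rightarrow> complex" where
  "sv_num \<tau> u v \<zeta> = u \<zeta> * v \<zeta> - (if \<tau> = 0 then 0 else \<zeta> * (v \<zeta>)\<^sup>2)"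

text \<open>A turn multiplies v^2 by the square of the conjugate of \<open>\<mu>\<close>; the
  exponential cancels this when \<open>exp (\<gamma> * turn) = \<mu>^2\<close>.\<close>

definition sv_den :: "real \<Rightarrow> (complex \<Rightarrow> complex) \<Rightarrow> complex \<Rightarrow> complex" where
  "sv_den \<gamma> v \<zeta> = exp (of_real \<gamma> * \<zeta>) * (v \<zeta>)\<^sup>2"

section \<open>Reality, growth and poles of the single-valued quotient\<close>

context
  fixes \<epsilon> :: real and u v :: "complex \<Rightarrow> complex" and w \<mu> \<tau> :: complex and \<gamma> :: real
  assumes mf: "monodromy_form (ln \<epsilon>) u v w \<mu> \<tau>" and eps: "\<epsilon> > 0"
    and \<gamma>: "0 \<le> \<gamma>" "exp (of_real \<gamma> * turn) = \<mu>\<^sup>2"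
begin

lemma mu_cnj: "\<mu> * cnj \<mu> = 1" "cnj \<mu> * \<mu> = 1"
  using mf_norm[OF mf] by (simp_all flip: complex_norm_square add: mult.commute)

lemma sv_periodic:
  assumes "Re \<zeta> < ln \<epsilon>"
  shows "sv_num \<tau> u v (\<zeta> + turn) = sv_num \<tau> u v \<zeta>" "sv_den \<gamma> v (\<zeta> + turn) = sv_den \<gamma> v \<zeta>"
proof -
  note sh = mf_shift[OF mf assms]
  have "sv_den \<gamma> v (\<zeta> + turn) = exp (of_real \<gamma> * \<zeta>) * (\<mu> * cnj \<mu>)\<^sup>2 * (v \<zeta>)\<^sup>2"
    unfolding sv_den_def sh distrib_left exp_add \<gamma>(2) by (simp add: power_mult_distrib)
  then show "sv_den \<gamma> v (\<zeta> + turn) = sv_den \<gamma> v \<zeta>" by (simp add: mu_cnj sv_den_def)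
  have uv: "u (\<zeta> + turn) * v (\<zeta> + turn) = (\<mu> * cnj \<mu>) * ((u \<zeta> + \<tau> * v \<zeta>) * v \<zeta>)"
    unfolding sh by (simp add: algebra_simps)
  show "sv_num \<tau> u v (\<zeta> + turn) = sv_num \<tau> u v \<zeta>"
  proof (cases "\<tau> = 0")
    case True
    then show ?thesis using uv by (simp add: sv_num_def mu_cnj)
  next
    case False
    then have t: "\<tau> = turn" "cnj \<mu> = \<mu>" using mf_cases[OF mf] by auto
    have "(v (\<zeta> + turn))\<^sup>2 = (\<mu> * cnj \<mu>) * (v \<zeta>)\<^sup>2" unfolding sh t(2) by (simp add: power2_eq_square)
    then show ?thesis using uv False by (simp add: sv_num_def mu_cnj t(1) power2_eq_square algebra_simps)
  qed
qed

lemma sv_holomorphic: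
  "sv_num \<tau> u v holomorphic_on {\<zeta>. Re \<zeta> < ln \<epsilon>}" "sv_den \<gamma> v holomorphic_on {\<zeta>. Re \<zeta> < ln \<epsilon>}"
  unfolding sv_num_def[abs_def] sv_den_def[abs_def]
  by (cases "\<tau> = 0"; auto intro!: holomorphic_intros mf_hol[OF mf])+

lemma sv_cnj:
  assumes "Re \<zeta> < ln \<epsilon>"
  shows "sv_num \<tau> u v (cnj \<zeta>) = cnj (sv_num \<tau> u v \<zeta>)" "sv_den \<gamma> v (cnj \<zeta>) = cnj (sv_den \<gamma> v \<zeta>)"
  using mf assms unfolding monodromy_form_def sv_num_def sv_den_def by (auto simp: exp_cnj)

text \<open>On both half axes the logarithm and its conjugate have the same exponential, so
  periodicity together with reflection symmetry makes the value real.\<close>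

lemma sv_real:
  assumes s: "0 < \<bar>s\<bar>" "\<bar>s\<bar> < \<epsilon>"
  shows "sv_num \<tau> u v (Ln (of_real s)) \<in> \<real>" "sv_den \<gamma> v (Ln (of_real s)) \<in> \<real>"
proof -
  have Re: "Re (Ln (of_real s)) < ln \<epsilon>" using s by simp
  have eq: "exp (cnj (Ln (of_real s))) = exp (Ln (of_real s))" using s by (simp flip: exp_cnj)
  have "sv_num \<tau> u v (cnj (Ln (of_real s))) = sv_num \<tau> u v (Ln (of_real s))" "sv_den \<gamma> v (cnj (Ln (of_real s))) = sv_den \<gamma> v (Ln (of_real s))"
    using periodic_exp_cong[of "ln \<epsilon>" "sv_num \<tau> u v", OF sv_periodic(1) eq] periodic_exp_cong[of "ln \<epsilon>" "sv_den \<gamma> v", OF sv_periodic(2) eq] Re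
    by simp_all
  then show "sv_num \<tau> u v (Ln (of_real s)) \<in> \<real>" "sv_den \<gamma> v (Ln (of_real s)) \<in> \<real>"
    using sv_cnj[OF Re] by (auto simp: Reals_cnj_iff)
qed

lemma sv_Ln_holomorphic:
  "(\<lambda>z. sv_num \<tau> u v (Ln z)) holomorphic_on Dstar \<epsilon>" "(\<lambda>z. sv_den \<gamma> v (Ln z)) holomorphic_on Dstar \<epsilon>"
  using periodic_Ln_holomorphic[OF sv_holomorphic(1) eps sv_periodic(1)]
    periodic_Ln_holomorphic[OF sv_holomorphic(2) eps sv_periodic(2)] by auto

lemma sv_bounded:
  obtains N C where "\<forall>\<^sub>F z in at 0. norm (z ^ N * sv_num \<tau> u v (Ln z)) \<le> C" "\<forall>\<^sub>F z in at 0. norm (z ^ N * sv_den \<gamma> v (Ln z)) \<le> C"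
proof -
  obtain K X where K: "K \<ge> 0" "X \<le> min (ln \<epsilon>) 0" and bd: "\<And>\<zeta>. Re \<zeta> < X \<Longrightarrow> 0 \<le> Im \<zeta> \<Longrightarrow> Im \<zeta> \<le> 2 * pi \<Longrightarrow>
     norm (u \<zeta>) \<le> exp (K * (1 - Re \<zeta>)) \<and> norm (v \<zeta>) \<le> exp (K * (1 - Re \<zeta>))"
    using monodromy_form_growth[OF mf] by blast
  \<comment> \<open>The part \<open>2 * K\<close> bounds products of two solutions, and
    \<open>2 * pi\<close> absorbs the factor \<open>\<zeta>\<close> in the parabolic
    numerator.\<close>
  define N where "N = nat \<lceil>2 * K + 2 * pi\<rceil>"
  have N: "2 * K + 2 * pi \<le> real N" unfolding N_def by linarith
  have bds: "norm (sv_num \<tau> u v \<zeta>) \<le> exp (real N * (1 - Re \<zeta>))" "norm (sv_den \<gamma> v \<zeta>) \<le> exp (real N * (1 - Re \<zeta>))"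
    if \<zeta>: "Re \<zeta> < X" "0 \<le> Im \<zeta>" "Im \<zeta> \<le> 2 * pi" for \<zeta>
  proof -
    let ?x = "Re \<zeta>" and ?e = "exp (2 * K * (1 - Re \<zeta>))"
    have x0: "?x < 0" using \<zeta> K by simp
    have e2: "exp (K * (1 - ?x)) * exp (K * (1 - ?x)) = ?e" by (simp flip: exp_add)
    have uv: "norm (u \<zeta> * v \<zeta>) \<le> ?e" "norm ((v \<zeta>)\<^sup>2) \<le> ?e"
      unfolding e2[symmetric] power2_eq_square norm_mult using bd[OF \<zeta>] by (auto intro!: mult_mono)
    have eN: "?e * exp (2 * pi * (1 - ?x)) \<le> exp (real N * (1 - ?x))"
    proof -
      have "?e * exp (2 * pi * (1 - ?x)) = exp ((2 * K + 2 * pi) * (1 - ?x))"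
        by (simp add: algebra_simps flip: exp_add)
      also have "\<dots> \<le> exp (real N * (1 - ?x))" using N x0 by (simp add: mult_right_mono)
      finally show ?thesis .
    qed
    have e1: "1 \<le> exp (2 * pi * (1 - ?x))" using x0 by simp
    have "norm (exp (of_real \<gamma> * \<zeta>)) \<le> 1" using \<gamma> x0 by (simp add: norm_exp_eq_Re mult_nonneg_nonpos)
    then have "norm (sv_den \<gamma> v \<zeta>) \<le> 1 * ?e" unfolding sv_den_def norm_mult using uv(2) by (intro mult_mono) auto
    also have "\<dots> \<le> ?e * exp (2 * pi * (1 - ?x))" using mult_left_mono[OF e1, of ?e] by simp
    finally show "norm (sv_den \<gamma> v \<zeta>) \<le> exp (real N * (1 - ?x))" using eN by linarith
    have "norm \<zeta> \<le> - ?x + 2 * pi" using cmod_le[of \<zeta>] x0 \<zeta> by auto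
    also have "1 + (- ?x + 2 * pi) \<le> exp (- ?x + 2 * pi)" by (rule exp_ge_add_one_self)
    finally have "1 + norm \<zeta> \<le> exp (- ?x + 2 * pi)" by simp
    also have "\<dots> \<le> exp (2 * pi * (1 - ?x))"
    proof -
      have "1 * (- ?x) \<le> 2 * pi * (- ?x)" using x0 pi_gt3 by (intro mult_right_mono) auto
      then show ?thesis by (simp add: algebra_simps)
    qed
    finally have z: "1 + norm \<zeta> \<le> exp (2 * pi * (1 - ?x))" .
    have "norm (sv_num \<tau> u v \<zeta>) \<le> norm (u \<zeta> * v \<zeta>) + norm \<zeta> * norm ((v \<zeta>)\<^sup>2)"
      unfolding sv_num_def using norm_triangle_ineq4[of "u \<zeta> * v \<zeta>" "\<zeta> * (v \<zeta>)\<^sup>2"] by (auto simp: norm_mult)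
    also have "\<dots> \<le> ?e + norm \<zeta> * ?e" using uv by (intro add_mono mult_left_mono) auto
    also have "\<dots> = ?e * (1 + norm \<zeta>)" by (simp add: algebra_simps)
    also have "\<dots> \<le> ?e * exp (2 * pi * (1 - ?x))" using z by (intro mult_left_mono) auto
    finally show "norm (sv_num \<tau> u v \<zeta>) \<le> exp (real N * (1 - ?x))" using eN by linarith
  qed
  have ev: "\<forall>\<^sub>F z in at 0. norm (z ^ N * \<phi> (Ln z)) \<le> exp N"
    if per: "\<And>\<zeta>. Re \<zeta> < ln \<epsilon> \<Longrightarrow> \<phi> (\<zeta> + turn) = \<phi> \<zeta>"
      and b: "\<And>\<zeta>. Re \<zeta> < X \<Longrightarrow> 0 \<le> Im \<zeta> \<Longrightarrow> Im \<zeta> \<le> 2 * pi \<Longrightarrow> norm (\<phi> \<zeta>) \<le> exp (real N * (1 - Re \<zeta>))" for \<phi>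
  proof -
    have "\<forall>\<^sub>F z in at 0. z \<in> ball 0 (exp X) - {0::complex}" by (intro eventually_at_in_open) auto
    then show ?thesis
    proof eventually_elim
      case (elim z)
      \<comment> \<open>The growth bounds are known for arguments from 0 to 2 pi only; periodicity
        allows this logarithm instead of the principal one.\<close>
      define \<zeta> where "\<zeta> = Complex (ln (norm z)) (Arg2pi z)"
      have z0: "norm z > 0" using elim by auto
      have exp\<zeta>: "exp \<zeta> = z"
      proof -
        have "exp \<zeta> = of_real (norm z) * exp (\<i> * of_real (Arg2pi z))"
          using z0 by (simp add: \<zeta>_def Complex_eq exp_add exp_of_real)
        then show ?thesis using Arg2pi_eq[of z] by simp
      qed
      have Re: "Re \<zeta> < X" using elim z0 ln_less_cancel_iff[of "norm z" "exp X"] by (simp add: \<zeta>_def)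
      have "norm (\<phi> \<zeta>) \<le> exp (real N * (1 - Re \<zeta>))"
        using Arg2pi[of z] by (intro b Re) (auto simp: \<zeta>_def)
      moreover have "\<phi> \<zeta> = \<phi> (Ln z)"
        by (rule periodic_exp_cong[of "ln \<epsilon>" \<phi>, OF per]) (use Re K exp\<zeta> z0 in auto)
      ultimately have "norm (z ^ N * \<phi> (Ln z)) \<le> norm z ^ N * exp (real N * (1 - ln (norm z)))"
        by (simp add: norm_mult norm_power \<zeta>_def mult_left_mono)
      also have "norm z ^ N = exp (real N * ln (norm z))" using z0 by (simp add: exp_of_nat_mult)
      also have "\<dots> * exp (real N * (1 - ln (norm z))) = exp N" by (simp add: algebra_simps flip: exp_add)
      finally show ?case .
    qed
  qed
  show ?thesis using that[OF ev[OF sv_periodic(1) bds(1)] ev[OF sv_periodic(2) bds(2)]] by blast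
qed

lemma sv_not_essential:
  "isolated_singularity_at (\<lambda>z. sv_num \<tau> u v (Ln z)) 0" "not_essential (\<lambda>z. sv_num \<tau> u v (Ln z)) 0"
  "isolated_singularity_at (\<lambda>z. sv_den \<gamma> v (Ln z)) 0" "not_essential (\<lambda>z. sv_den \<gamma> v (Ln z)) 0"
  using sv_bounded not_essential_polynomially_bounded[OF sv_Ln_holomorphic(1) eps]
    not_essential_polynomially_bounded[OF sv_Ln_holomorphic(2) eps] by metis+

text \<open>Zeros of v are simple, because the Wronskian does not vanish.\<close>

lemma mf_den_eventually_nonzero:
  assumes "z \<in> Dplus \<epsilon>"
  shows "\<forall>\<^sub>F w in at z. v (Ln w) \<noteq> 0"
proof -
  have zn: "z \<notin> \<real>\<^sub>\<le>\<^sub>0" and z0: "z \<noteq> 0" using assms by (auto simp: Dplus_def complex_nonpos_Reals_iff)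
  have Re: "Re (Ln z) < ln \<epsilon>" using assms z0 eps by (simp add: Dplus_def)
  have "(v has_field_derivative deriv v (Ln z)) (at (Ln z))"
    by (rule holomorphic_derivI[OF mf_hol(2)[OF mf] open_halfspace_Re_lt]) (use Re in simp)
  from DERIV_chain2[OF this has_field_derivative_Ln[OF zn]]
  have d: "((\<lambda>z. v (Ln z)) has_field_derivative deriv v (Ln z) * inverse z) (at z)" .
  show ?thesis
  proof (rule eventually_neq_of_deriv_nonzero)
    show "(\<lambda>z. v (Ln z)) field_differentiable at z" using d field_differentiable_def by blast
    have "w \<noteq> 0" using mf by (simp add: monodromy_form_def)
    then have "v (Ln z) \<noteq> 0 \<or> deriv v (Ln z) \<noteq> 0"
      using mf_wronskian[OF mf Re] by (auto simp: wronskian_def)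
    then show "v (Ln z) \<noteq> 0 \<or> deriv (\<lambda>z. v (Ln z)) z \<noteq> 0"
      using DERIV_imp_deriv[OF d] z0 by auto
  qed
qed

text \<open>At removable points the quotient receives its limit as value. The identities therefore
  hold on punctured neighbourhoods, and reality passes to the limit because the real line is
  closed.\<close>

lemma sv_quotient:
  fixes F
  defines "F \<equiv> remove_sings (\<lambda>z. sv_num \<tau> u v (Ln z) / sv_den \<gamma> v (Ln z))"
  shows "F nicely_meromorphic_on Dstar \<epsilon>"
    "\<And>s::real. 0 < \<bar>s\<bar> \<Longrightarrow> \<bar>s\<bar> < \<epsilon> \<Longrightarrow> \<not> is_pole F (of_real s) \<Longrightarrow> F (of_real s) \<in> \<real>"
    "not_essential F 0"
    "\<And>z. z \<in> Dplus \<epsilon> \<Longrightarrow> \<forall>\<^sub>F w in at z. v (Ln w) \<noteq> 0 \<and>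
       u (Ln w) / v (Ln w) = (if \<tau> = 0 then exp (of_real \<gamma> * Ln w) * F w else exp (of_real \<gamma> * Ln w) * F w + Ln w)"
proof -
  let ?G = "\<lambda>z. sv_num \<tau> u v (Ln z) / sv_den \<gamma> v (Ln z)"
  have mero: "?G meromorphic_on Dstar \<epsilon>"
    using sv_Ln_holomorphic
    by (intro meromorphic_on_divide analytic_on_imp_meromorphic_on) (simp_all add: analytic_on_open)
  show nm: "F nicely_meromorphic_on Dstar \<epsilon>"
    unfolding F_def by (rule remove_sings_nicely_meromorphic[OF mero])
  have iso0: "isolated_singularity_at ?G 0" "not_essential ?G 0"
    by (intro isolated_singularity_at_divide not_essential_divide sv_not_essential)+
  then show "not_essential F 0" unfolding F_def by (rule not_essential_remove_sings)
  have ev: "\<forall>\<^sub>F w in at z. F w = ?G w" if "z \<in> Dstar \<epsilon>" for z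
    unfolding F_def by (rule eventually_remove_sings_eq_at) (rule meromorphic_on_isolated_singularity[OF meromorphic_on_subset[OF mero]], use that in simp)
  show "F (of_real s) \<in> \<real>" if s: "0 < \<bar>s\<bar>" "\<bar>s\<bar> < \<epsilon>" "\<not> is_pole F (of_real s)" for s
  proof -
    have sD: "complex_of_real s \<in> Dstar \<epsilon>" using s by (auto simp: Dstar_def)
    have "F analytic_on {of_real s}" by (rule nicely_meromorphic_on_imp_analytic_at[OF nm sD s(3)])
    then have "(F \<longlongrightarrow> F (of_real s)) (at (of_real s))"
      using analytic_at_imp_isCont isCont_def by blast
    moreover have fl: "filterlim complex_of_real (at (of_real s)) (at s)"
      by (auto simp: filterlim_at eventually_at_filter intro!: tendsto_intros)
    ultimately have lim: "((\<lambda>t. F (of_real t)) \<longlongrightarrow> F (of_real s)) (at s)"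
      by (rule filterlim_compose)
    have "\<forall>\<^sub>F t in at s. F (of_real t) = ?G (of_real t)"
      using fl ev[OF sD] by (auto simp: filterlim_iff)
    moreover have "\<forall>\<^sub>F t in at s. t \<in> {t. 0 < \<bar>t\<bar>} \<inter> {t. \<bar>t\<bar> < \<epsilon>}"
      using s by (intro eventually_at_in_open' open_Int open_Collect_less continuous_intros) auto
    ultimately have "\<forall>\<^sub>F t in at s. F (of_real t) \<in> \<real>"
      by eventually_elim (use sv_real in \<open>auto intro!: Reals_divide\<close>)
    then show ?thesis
      by (rule Lim_in_closed_set[OF closed_complex_Reals _ _ lim]) simp
  qed
  show "\<forall>\<^sub>F w in at z. v (Ln w) \<noteq> 0 \<and>
       u (Ln w) / v (Ln w) = (if \<tau> = 0 then exp (of_real \<gamma> * Ln w) * F w else exp (of_real \<gamma> * Ln w) * F w + Ln w)"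
    if z: "z \<in> Dplus \<epsilon>" for z
  proof -
    have zD: "z \<in> Dstar \<epsilon>" using z by (auto simp: Dplus_def Dstar_def)
    show ?thesis using ev[OF zD] mf_den_eventually_nonzero[OF z]
    proof eventually_elim
      case (elim w)
      have eF: "exp (of_real \<gamma> * Ln w) * F w = sv_num \<tau> u v (Ln w) / (v (Ln w))\<^sup>2"
        unfolding elim(1) by (simp add: sv_den_def)
      show ?case unfolding eF using elim(2)
        by (cases "\<tau> = 0") (simp_all add: sv_num_def power2_eq_square diff_divide_distrib)
    qed
  qed
qed

(* Near 0 the square of v is a power of z times a nonvanishing holomorphic function of z, and
   v''/v = q' + q^2 for the logarithmic derivative q = v'/v. *)
lemma ode_coefficient_bounded:
  assumes ode: "ode_sol R {\<zeta>. Re \<zeta> < ln \<epsilon>} v"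
  shows "\<exists>C X. \<forall>\<zeta>. Re \<zeta> < X \<longrightarrow> norm (R \<zeta>) \<le> C"
proof -
  let ?H = "{\<zeta>. Re \<zeta> < ln \<epsilon>}" and ?f = "\<lambda>z. sv_den \<gamma> v (Ln z)"
  have oH: "open ?H" by (rule open_halfspace_Re_lt)
  have fexp: "?f (exp \<zeta>) = sv_den \<gamma> v \<zeta>" if "Re \<zeta> < ln \<epsilon>" for \<zeta>
    using periodic_exp_cong[of "ln \<epsilon>" "sv_den \<gamma> v", OF sv_periodic(2), of \<zeta> "Ln (exp \<zeta>)"] that by simp
  have "\<exists>\<^sub>F z in at 0. ?f z \<noteq> 0"
  proof (rule ccontr)
    assume "\<not> ?thesis"
    then have "\<forall>\<^sub>F z in at 0. ?f z = 0" by (simp add: frequently_def)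
    then obtain d where d: "d > 0" "\<And>z. z \<noteq> 0 \<Longrightarrow> norm z < d \<Longrightarrow> ?f z = 0"
      by (auto simp: eventually_at)
    define Y where "Y = min (ln d) (ln \<epsilon>)"
    \<comment> \<open>Then v vanishes on a half plane, which the nonzero Wronskian forbids. So the
      order of the single-valued function at 0 is finite.\<close>
    have v0: "v \<zeta> = 0" if "Re \<zeta> < Y" for \<zeta>
    proof -
      have "norm (exp \<zeta>) < d" using that d(1) unfolding Y_def norm_exp_eq_Re by (metis exp_less_cancel_iff exp_ln min_less_iff_conj)
      then have "sv_den \<gamma> v \<zeta> = 0" using d(2)[of "exp \<zeta>"] fexp[of \<zeta>] that by (simp add: Y_def)
      then show ?thesis by (simp add: sv_den_def)
    qed
    let ?z = "complex_of_real (Y - 1)"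
    have "deriv v ?z = deriv (\<lambda>_. 0) ?z"
      by (intro deriv_cong_ev eventually_mono[OF eventually_nhds_in_open[OF open_halfspace_Re_lt[of Y]]]) (auto simp: v0)
    moreover have "wronskian u v ?z = w" by (rule mf_wronskian[OF mf]) (simp add: Y_def)
    ultimately have "w = 0" using v0[of ?z] by (simp add: wronskian_def)
    then show False using mf by (simp add: monodromy_form_def)
  qed
  from zorder_exist[OF sv_not_essential(3,4) this]
  obtain r where r: "r > 0" "zor_poly ?f 0 holomorphic_on cball 0 r"
    and fP: "\<And>z. z \<in> cball 0 r - {0} \<Longrightarrow> ?f z = zor_poly ?f 0 z * z powi zorder ?f 0 \<and> zor_poly ?f 0 z \<noteq> 0"
    and g00: "zor_poly ?f 0 0 \<noteq> 0" by auto
  define g m where "g = zor_poly ?f 0" and "m = zorder ?f 0"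
  have ghol: "g holomorphic_on ball 0 r" unfolding g_def using r(2) ball_subset_cball holomorphic_on_subset by blast
  have g0: "g z \<noteq> 0" if "z \<in> ball 0 r" for z
    using fP[of z] g00 that by (cases "z = 0") (auto simp: g_def)
  \<comment> \<open>The logarithmic derivative of v in the coordinate \<open>\<zeta>\<close>, as a
    function of z: half that of v^2 = exp ((m - \<open>\<gamma>\<close>) \<open>\<zeta>\<close>)
    g(z). It is holomorphic at 0.\<close>
  define B where "B z = (of_int m - of_real \<gamma>) / 2 + z * deriv g z / (2 * g z)" for z
  have Bhol: "B holomorphic_on ball 0 r"
    unfolding B_def using g0 by (intro holomorphic_intros holomorphic_deriv ghol) auto
  have comp: "bounded ((\<lambda>z. z * deriv B z + (B z)\<^sup>2) ` cball 0 (r / 2))"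
  proof (intro compact_imp_bounded compact_continuous_image compact_cball)
    have "(\<lambda>z. z * deriv B z + (B z)\<^sup>2) holomorphic_on ball 0 r"
      by (intro holomorphic_intros holomorphic_deriv Bhol) auto
    then show "continuous_on (cball 0 (r / 2)) (\<lambda>z. z * deriv B z + (B z)\<^sup>2)"
      by (rule holomorphic_on_imp_continuous_on[THEN continuous_on_subset]) (use r in auto)
  qed
  then obtain C where C: "\<And>z. z \<in> cball 0 (r / 2) \<Longrightarrow> norm (z * deriv B z + (B z)\<^sup>2) \<le> C"
    unfolding bounded_iff by blast
  define X where "X = min (ln \<epsilon>) (ln (r / 2))"
  have inr: "exp \<zeta> \<in> cball 0 (r / 2) - {0}" if "Re \<zeta> < X" for \<zeta>
  proof -
    have "exp (Re \<zeta>) < exp (ln (r / 2))" using that by (simp add: X_def)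
    then show ?thesis using r(1) by (simp add: norm_exp_eq_Re)
  qed
  have vsq: "(v \<zeta>)\<^sup>2 = exp ((of_int m - of_real \<gamma>) * \<zeta>) * g (exp \<zeta>)" if \<zeta>: "Re \<zeta> < X" for \<zeta>
  proof -
    have "sv_den \<gamma> v \<zeta> = g (exp \<zeta>) * exp \<zeta> powi m"
      using fP[of "exp \<zeta>"] inr[OF \<zeta>] r(1) fexp[of \<zeta>] \<zeta> by (simp add: X_def g_def m_def)
    also have "exp \<zeta> powi m = exp (of_int m * \<zeta>)" by (simp add: exp_power_int)
    finally have "exp (of_real \<gamma> * \<zeta>) * (v \<zeta>)\<^sup>2 = g (exp \<zeta>) * exp (of_int m * \<zeta>)" by (simp add: sv_den_def)
    then show ?thesis by (simp add: left_diff_distrib exp_diff field_simps)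
  qed
  have v0: "v \<zeta> \<noteq> 0" if \<zeta>: "Re \<zeta> < X" for \<zeta>
    using vsq[OF \<zeta>] g0[of "exp \<zeta>"] inr[OF \<zeta>] r(1) by auto
  have q: "deriv v \<zeta> = B (exp \<zeta>) * v \<zeta>" if \<zeta>: "Re \<zeta> < X" for \<zeta>
  proof -
    have zr: "exp \<zeta> \<in> ball 0 r" using inr[OF \<zeta>] r(1) by auto
    have dv: "(v has_field_derivative deriv v \<zeta>) (at \<zeta>)"
      by (rule holomorphic_derivI[OF mf_hol(2)[OF mf] oH]) (use \<zeta> in \<open>simp add: X_def\<close>)
    have dg: "((\<lambda>\<zeta>. g (exp \<zeta>)) has_field_derivative deriv g (exp \<zeta>) * exp \<zeta>) (at \<zeta>)"
      by (rule DERIV_chain2[OF holomorphic_derivI[OF ghol open_ball zr] DERIV_exp])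
    have 1: "((\<lambda>\<zeta>. (v \<zeta>)\<^sup>2) has_field_derivative 2 * v \<zeta> * deriv v \<zeta>) (at \<zeta>)"
      using dv by (auto intro!: derivative_eq_intros)
    have "((\<lambda>\<zeta>. exp ((of_int m - of_real \<gamma>) * \<zeta>) * g (exp \<zeta>)) has_field_derivative
        exp ((of_int m - of_real \<gamma>) * \<zeta>) * (deriv g (exp \<zeta>) * exp \<zeta>) + exp ((of_int m - of_real \<gamma>) * \<zeta>) * (of_int m - of_real \<gamma>) * g (exp \<zeta>)) (at \<zeta>)"
      using dg by (auto intro!: derivative_eq_intros)
    then have "((\<lambda>\<zeta>. (v \<zeta>)\<^sup>2) has_field_derivative
        exp ((of_int m - of_real \<gamma>) * \<zeta>) * (deriv g (exp \<zeta>) * exp \<zeta>) + exp ((of_int m - of_real \<gamma>) * \<zeta>) * (of_int m - of_real \<gamma>) * g (exp \<zeta>)) (at \<zeta>)"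
      by (rule has_field_derivative_transform_within_open[OF _ open_halfspace_Re_lt[of X]]) (use \<zeta> vsq in auto)
    from DERIV_unique[OF 1 this]
    have e: "2 * v \<zeta> * deriv v \<zeta> = exp ((of_int m - of_real \<gamma>) * \<zeta>) * ((of_int m - of_real \<gamma>) * g (exp \<zeta>) + exp \<zeta> * deriv g (exp \<zeta>))"
      by (simp add: distrib_left mult_ac)
    have "(of_int m - of_real \<gamma>) * g (exp \<zeta>) + exp \<zeta> * deriv g (exp \<zeta>) = g (exp \<zeta>) * (2 * B (exp \<zeta>))"
      unfolding B_def using g0[OF zr] by (simp add: field_simps)
    with e have "2 * v \<zeta> * deriv v \<zeta> = (v \<zeta>)\<^sup>2 * (2 * B (exp \<zeta>))"
      unfolding vsq[OF \<zeta>] by (simp add: mult.assoc)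
    then show ?thesis using v0[OF \<zeta>] by (simp add: power2_eq_square)
  qed
  \<comment> \<open>Differentiation in \<open>\<zeta>\<close> is z d/dz, so the derivative of the
    logarithmic derivative is \<open>z * deriv B z\<close>, bounded near 0.\<close>
  have "R \<zeta> = exp \<zeta> * deriv B (exp \<zeta>) + (B (exp \<zeta>))\<^sup>2" if \<zeta>: "Re \<zeta> < X" for \<zeta>
  proof -
    have zr: "exp \<zeta> \<in> ball 0 r" using inr[OF \<zeta>] r(1) by auto
    have dv: "(v has_field_derivative deriv v \<zeta>) (at \<zeta>)"
      by (rule holomorphic_derivI[OF mf_hol(2)[OF mf] oH]) (use \<zeta> in \<open>simp add: X_def\<close>)
    have "((\<lambda>\<zeta>. B (exp \<zeta>)) has_field_derivative deriv B (exp \<zeta>) * exp \<zeta>) (at \<zeta>)"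
      by (rule DERIV_chain2[OF holomorphic_derivI[OF Bhol open_ball zr] DERIV_exp])
    from DERIV_mult[OF this dv]
    have "((\<lambda>\<zeta>. B (exp \<zeta>) * v \<zeta>) has_field_derivative B (exp \<zeta>) * deriv v \<zeta> + deriv B (exp \<zeta>) * exp \<zeta> * v \<zeta>) (at \<zeta>)"
      by (simp add: mult_ac add_ac)
    then have "(deriv v has_field_derivative B (exp \<zeta>) * deriv v \<zeta> + deriv B (exp \<zeta>) * exp \<zeta> * v \<zeta>) (at \<zeta>)"
      by (rule has_field_derivative_transform_within_open[OF _ open_halfspace_Re_lt[of X]]) (use \<zeta> q in auto)
    then have "deriv (deriv v) \<zeta> = (exp \<zeta> * deriv B (exp \<zeta>) + (B (exp \<zeta>))\<^sup>2) * v \<zeta>"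
      using q[OF \<zeta>] by (subst DERIV_imp_deriv) (auto simp: power2_eq_square algebra_simps)
    moreover have "deriv (deriv v) \<zeta> = R \<zeta> * v \<zeta>" using ode \<zeta> by (auto simp: ode_sol_def X_def)
    ultimately show ?thesis using v0[OF \<zeta>] by simp
  qed
  then have "norm (R \<zeta>) \<le> C" if "Re \<zeta> < X" for \<zeta> using C[of "exp \<zeta>"] inr[OF that] that by auto
  then show ?thesis by blast
qed

end

section \<open>The Schwarzian of a developing map\<close>

lemma has_derivative_cmod_square:
  assumes "(a has_field_derivative a') (at z)"
  shows "((\<lambda>z. (cmod (a z))\<^sup>2) has_derivative (\<lambda>h. 2 * Re (cnj (a z) * a' * h))) (at z)"
proof -
  have d: "(a has_derivative (\<lambda>h. a' * h)) (at z)" using assms by (simp add: has_field_derivative_def)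
  note r = bounded_linear.has_derivative[OF bounded_linear_Re d] bounded_linear.has_derivative[OF bounded_linear_Im d]
  have "((\<lambda>z. (Re (a z))\<^sup>2 + (Im (a z))\<^sup>2) has_derivative (\<lambda>h. 2 * Re (cnj (a z) * a' * h))) (at z)"
    by (rule derivative_eq_intros r refl)+ (auto simp: algebra_simps)
  then show ?thesis by (simp add: cmod_power2)
qed

context
  fixes K :: real and U :: "complex set" and g :: "complex \<Rightarrow> complex" and z :: complex
  assumes U: "open U" "z \<in> U" and hol: "g holomorphic_on U"
    and nz: "\<And>w. w \<in> U \<Longrightarrow> deriv g w \<noteq> 0"
    and pos: "\<And>w. w \<in> U \<Longrightarrow> 1 + K * (cmod (g w))\<^sup>2 > 0"
begin

text \<open>For real v one has dv = Re (2 v_z dz), so the coefficient of h is 2 v_z. It is computed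
  from ln 4 + ln |g'|^2 - 2 ln (1 + K |g|^2).\<close>

lemma conformal_factor_derivative:
  assumes w: "w \<in> U"
  shows "((\<lambda>z. ln (4 * (cmod (deriv g z))\<^sup>2 / (1 + K * (cmod (g z))\<^sup>2)\<^sup>2)) has_derivative
    (\<lambda>h. Re ((2 * deriv (deriv g) w / deriv g w - 4 * K * cnj (g w) * deriv g w / of_real (1 + K * (cmod (g w))\<^sup>2)) * h))) (at w)"
proof -
  define N where "N z = 1 + K * (cmod (g z))\<^sup>2" for z
  have N: "N w > 0" using pos[OF w] by (simp add: N_def)
  have g': "(g has_field_derivative deriv g w) (at w)" "(deriv g has_field_derivative deriv (deriv g) w) (at w)"
    using holomorphic_derivI[OF hol U(1) w] holomorphic_derivI[OF holomorphic_deriv[OF hol U(1)] U(1) w] by auto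
  have dN: "(N has_derivative (\<lambda>h. K * (2 * Re (cnj (g w) * deriv g w * h)))) (at w)"
  proof -
    have "((\<lambda>z. 1 + K * (cmod (g z))\<^sup>2) has_derivative (\<lambda>h. 0 + K * (2 * Re (cnj (g w) * deriv g w * h)))) (at w)"
      by (intro has_derivative_add has_derivative_const has_derivative_mult_right has_derivative_cmod_square g'(1))
    then show ?thesis by (simp add: N_def[abs_def])
  qed
  have dg: "((\<lambda>z. (cmod (deriv g z))\<^sup>2) has_derivative (\<lambda>h. 2 * Re (cnj (deriv g w) * deriv (deriv g) w * h))) (at w)"
    by (rule has_derivative_cmod_square[OF g'(2)])
  have gp: "(cmod (deriv g w))\<^sup>2 > 0" using nz[OF w] by simp
  have d: "((\<lambda>z. ln 4 + ln ((cmod (deriv g z))\<^sup>2) - 2 * ln (N z)) has_derivative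
     (\<lambda>h. 2 * Re (cnj (deriv g w) * deriv (deriv g) w * h) * inverse ((cmod (deriv g w))\<^sup>2) - 2 * (K * (2 * Re (cnj (g w) * deriv g w * h)) * inverse (N w)))) (at w)"
    by (rule derivative_eq_intros dg dN gp N refl | simp)+
  have "(\<lambda>h. 2 * Re (cnj (deriv g w) * deriv (deriv g) w * h) * inverse ((cmod (deriv g w))\<^sup>2) - 2 * (K * (2 * Re (cnj (g w) * deriv g w * h)) * inverse (N w)))
     = (\<lambda>h. Re ((2 * deriv (deriv g) w / deriv g w - 4 * K * cnj (g w) * deriv g w / of_real (N w)) * h))" (is "?L = ?R")
  proof
    fix h
    have Re_mult: "Re (of_real c * x) = c * Re x" for c x by simp
    have "deriv (deriv g) w / deriv g w = cnj (deriv g w) * deriv (deriv g) w / of_real ((cmod (deriv g w))\<^sup>2)"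
      using nz[OF w] unfolding complex_norm_square by (simp add: divide_simps)
    then have "2 * (deriv (deriv g) w / deriv g w) * h = of_real (2 * inverse ((cmod (deriv g w))\<^sup>2)) * (cnj (deriv g w) * deriv (deriv g) w * h)"
      by (simp add: divide_inverse mult_ac)
    then have "Re (2 * deriv (deriv g) w / deriv g w * h) = Re (of_real (2 * inverse ((cmod (deriv g w))\<^sup>2)) * (cnj (deriv g w) * deriv (deriv g) w * h))"
      by (simp only: times_divide_eq_right)
    also have "\<dots> = 2 * inverse ((cmod (deriv g w))\<^sup>2) * Re (cnj (deriv g w) * deriv (deriv g) w * h)"
      by (rule Re_mult)
    finally have 1: "Re (2 * deriv (deriv g) w / deriv g w * h) = 2 * inverse ((cmod (deriv g w))\<^sup>2) * Re (cnj (deriv g w) * deriv (deriv g) w * h)" .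
    have "4 * K * cnj (g w) * deriv g w / of_real (N w) * h = of_real (4 * K * inverse (N w)) * (cnj (g w) * deriv g w * h)"
      by (simp add: field_simps)
    then have 2: "Re (4 * K * cnj (g w) * deriv g w / of_real (N w) * h) = 4 * K * inverse (N w) * Re (cnj (g w) * deriv g w * h)"
      by (simp only: Re_mult)
    show "?L h = ?R h" unfolding left_diff_distrib minus_complex.simps 1 2 by (simp add: algebra_simps)
  qed
  with d have d: "((\<lambda>z. ln 4 + ln ((cmod (deriv g z))\<^sup>2) - 2 * ln (N z)) has_derivative ?R) (at w)" by simp
  show ?thesis
    unfolding N_def[symmetric]
  proof (rule has_derivative_transform_within_open[OF d U(1) w])
    fix z assume z: "z \<in> U"
    have "N z > 0" "(cmod (deriv g z))\<^sup>2 > 0" using pos[OF z] nz[OF z] by (simp_all add: N_def)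
    then show "ln 4 + ln ((cmod (deriv g z))\<^sup>2) - 2 * ln (N z) = ln (4 * (cmod (deriv g z))\<^sup>2 / (N z)\<^sup>2)"
      by (simp add: ln_div ln_mult ln_realpow)
  qed
qed

text \<open>The terms with K cancel in v_zz - v_z^2 / 2. Symmetry of the mixed derivatives comes out
  of the same computation, and is stated here for later use on the boundary.\<close>

lemma schwarzian_map_eq_schwarzian:
  fixes v vs vt vss vst vts vtt :: "complex \<Rightarrow> real"
  assumes v: "\<And>w. w \<in> U \<Longrightarrow> v w = ln (4 * (cmod (deriv g w))\<^sup>2 / (1 + K * (cmod (g w))\<^sup>2)\<^sup>2)"
    and d1: "\<And>w. w \<in> U \<Longrightarrow> (v has_derivative (\<lambda>h. Re h * vs w + Im h * vt w)) (at w)"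
    and d2s: "(vs has_derivative (\<lambda>h. Re h * vss z + Im h * vst z)) (at z)"
    and d2t: "(vt has_derivative (\<lambda>h. Re h * vts z + Im h * vtt z)) (at z)"
  shows "schwarzian_map vs vt vss vst vts vtt z =
      deriv (\<lambda>w. deriv (deriv g) w / deriv g w) z - (deriv (deriv g) z / deriv g z)\<^sup>2 / 2"
    and "vst z = vts z"
proof -
  define \<phi> where "\<phi> w = deriv (deriv g) w / deriv g w" for w
  define N where "N w = complex_of_real (1 + K * (cmod (g w))\<^sup>2)" for w
  define p where "p w = 2 * \<phi> w - 4 * K * (cnj (g w) * deriv g w / N w)" for w
  have p_eq: "p w = complex_of_real (vs w) - \<i> * vt w" if w: "w \<in> U" for w
  proof -
    have "(v has_derivative (\<lambda>h. Re (p w * h))) (at w)"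
    proof (rule has_derivative_transform_within_open[OF _ U(1) w])
      show "((\<lambda>z. ln (4 * (cmod (deriv g z))\<^sup>2 / (1 + K * (cmod (g z))\<^sup>2)\<^sup>2)) has_derivative (\<lambda>h. Re (p w * h))) (at w)"
        using conformal_factor_derivative[OF w] by (simp add: p_def \<phi>_def N_def mult.assoc)
    qed (simp add: v)
    from has_derivative_unique[OF this d1[OF w]]
    have "Re (p w * h) = Re h * vs w + Im h * vt w" for h by metis
    from this[of 1] this[of \<i>] show ?thesis by (simp add: complex_eq_iff)
  qed
  have N0: "N z \<noteq> 0" using pos[OF U(2)] unfolding N_def by (metis less_irrefl of_real_eq_0_iff)
  have g': "(g has_field_derivative deriv g z) (at z)" "(deriv g has_field_derivative deriv (deriv g) z) (at z)"
    using holomorphic_derivI[OF hol U] holomorphic_derivI[OF holomorphic_deriv[OF hol U(1)] U] by auto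
  have \<phi>hol: "\<phi> holomorphic_on U"
    unfolding \<phi>_def using nz by (intro holomorphic_intros holomorphic_deriv hol U(1)) auto
  have d\<phi>: "(\<phi> has_derivative (\<lambda>h. deriv \<phi> z * h)) (at z)"
    using holomorphic_derivI[OF \<phi>hol U] by (simp add: has_field_derivative_def)
  have dg: "(g has_derivative (\<lambda>h. deriv g z * h)) (at z)" "(deriv g has_derivative (\<lambda>h. deriv (deriv g) z * h)) (at z)"
    using g' by (auto simp: has_field_derivative_def)
  have dc: "((\<lambda>w. cnj (g w)) has_derivative (\<lambda>h. cnj (deriv g z * h))) (at z)"
    by (rule bounded_linear.has_derivative[OF bounded_linear_cnj dg(1)])
  have dN: "(N has_derivative (\<lambda>h. K * (cnj (g z) * deriv g z * h + g z * cnj (deriv g z * h)))) (at z)"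
  proof -
    have "((\<lambda>w. 1 + K * (g w * cnj (g w))) has_derivative (\<lambda>h. K * (cnj (g z) * deriv g z * h + g z * cnj (deriv g z * h)))) (at z)"
      by (rule derivative_eq_intros dg dc refl)+ (auto simp: algebra_simps)
    then show ?thesis unfolding N_def of_real_add of_real_mult complex_norm_square by simp
  qed
  \<comment> \<open>\<open>A\<close> and \<open>B\<close> are the derivatives of \<open>p\<close> =
    2 v_z in z and in the conjugate of z. That \<open>B\<close> is real, being half the Laplacian of
    v, is what equates the mixed partial derivatives.\<close>
  define A where "A = 2 * deriv \<phi> z - 4 * K * (cnj (g z) * deriv (deriv g) z / N z - K * (cnj (g z))\<^sup>2 * (deriv g z)\<^sup>2 / (N z)\<^sup>2)"
  define B where "B = - 4 * K * (cmod (deriv g z))\<^sup>2 * (1 / (1 + K * (cmod (g z))\<^sup>2) - K * (cmod (g z))\<^sup>2 / (1 + K * (cmod (g z))\<^sup>2)\<^sup>2)"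
  have Bc: "complex_of_real B = - 4 * K * (deriv g z * cnj (deriv g z)) * (1 / N z - K * (g z * cnj (g z)) / (N z)\<^sup>2)"
    unfolding B_def N_def complex_norm_square[symmetric] by simp
  have dp: "(p has_derivative (\<lambda>h. A * h + of_real B * cnj h)) (at z)"
  proof -
    have "(p has_derivative (\<lambda>h. 2 * (deriv \<phi> z * h) - 4 * K *
      (((cnj (g z) * (deriv (deriv g) z * h) + cnj (deriv g z * h) * deriv g z) * N z
       - cnj (g z) * deriv g z * (K * (cnj (g z) * deriv g z * h + g z * cnj (deriv g z * h)))) / (N z * N z)))) (at z)"
      unfolding p_def
      by (intro has_derivative_diff has_derivative_mult_right d\<phi> has_derivative_divide'[OF has_derivative_mult[OF dc dg(2)] dN N0])
    also have "(\<lambda>h. 2 * (deriv \<phi> z * h) - 4 * K *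
      (((cnj (g z) * (deriv (deriv g) z * h) + cnj (deriv g z * h) * deriv g z) * N z
       - cnj (g z) * deriv g z * (K * (cnj (g z) * deriv g z * h + g z * cnj (deriv g z * h)))) / (N z * N z)))
       = (\<lambda>h. A * h + of_real B * cnj h)"
      unfolding A_def Bc using N0 by (auto simp: fun_eq_iff divide_simps) (simp add: power2_eq_square algebra_simps)
    finally show ?thesis .
  qed
  have dq: "((\<lambda>w. complex_of_real (vs w) - \<i> * vt w) has_derivative
      (\<lambda>h. complex_of_real (Re h * vss z + Im h * vst z) - \<i> * complex_of_real (Re h * vts z + Im h * vtt z))) (at z)"
    by (intro has_derivative_diff has_derivative_mult_right has_derivative_of_real d2s d2t)
  have "((\<lambda>w. complex_of_real (vs w) - \<i> * vt w) has_derivative (\<lambda>h. A * h + of_real B * cnj h)) (at z)"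
    by (rule has_derivative_transform_within_open[OF dp U]) (simp add: p_eq)
  from has_derivative_unique[OF this dq]
  have eq: "A * h + of_real B * cnj h = complex_of_real (Re h * vss z + Im h * vst z) - \<i> * complex_of_real (Re h * vts z + Im h * vtt z)" for h
    by metis
  have e1: "A + of_real B = of_real (vss z) - \<i> * of_real (vts z)" using eq[of 1] by simp
  have e2: "A * \<i> - of_real B * \<i> = of_real (vst z) - \<i> * of_real (vtt z)" using eq[of \<i>] by simp
  have "Im A = - vts z" using arg_cong[OF e1, of Im] by simp
  moreover have "- Im A = vst z" using arg_cong[OF e2, of Re] by simp
  ultimately show "vst z = vts z" by simp
  have A2: "complex_of_real (vss z) - \<i> * vst z - \<i> * vts z - vtt z = 2 * A"
    using arg_cong[OF e1, of Re] arg_cong[OF e1, of Im] arg_cong[OF e2, of Re] arg_cong[OF e2, of Im]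
    by (simp add: complex_eq_iff)
  have "schwarzian_map vs vt vss vst vts vtt z = A / 2 - (p z / 2)\<^sup>2 / 2"
    unfolding schwarzian_map_def A2 p_eq[OF U(2)] by simp
  also have "\<dots> = deriv \<phi> z - (\<phi> z)\<^sup>2 / 2"
  proof -
    have gg: "deriv (deriv g) z = \<phi> z * deriv g z" using nz[OF U(2)] by (simp add: \<phi>_def)
    show ?thesis unfolding A_def p_def gg using N0
      by (simp add: divide_simps power2_eq_square) (simp add: algebra_simps)
  qed
  finally show "schwarzian_map vs vt vss vst vts vtt z =
      deriv (\<lambda>w. deriv (deriv g) w / deriv g w) z - (deriv (deriv g) z / deriv g z)\<^sup>2 / 2"
    by (simp add: \<phi>_def[abs_def])
qed

end

section \<open>Reflection of the Schwarzian map\<close>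

lemma Dstar_closed_half_subset:
  assumes "z \<in> Dstar \<epsilon>" "0 \<le> Im z"
  shows "z \<in> Dplus_closed_punct \<epsilon>"
proof -
  have z: "z \<noteq> 0" "norm z < \<epsilon>" using assms by (auto simp: Dstar_def)
  have "z \<in> closure (Dplus \<epsilon>)"
  proof (subst closure_approachable, intro allI impI)
    fix e :: real assume e: "e > 0"
    define t where "t = min e (\<epsilon> - norm z) / 2"
    have t: "t > 0" "t < e" "t < \<epsilon> - norm z" using e z by (auto simp: t_def min_def)
    have "norm (z + of_real t * \<i>) \<le> norm z + t" using norm_triangle_ineq[of z "of_real t * \<i>"] t by (simp add: norm_mult)
    then have "z + of_real t * \<i> \<in> Dplus \<epsilon>" using t assms by (simp add: Dplus_def)
    moreover have "dist (z + of_real t * \<i>) z < e" using t by (simp add: dist_norm norm_mult)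
    ultimately show "\<exists>y\<in>Dplus \<epsilon>. dist y z < e" by blast
  qed
  then show ?thesis using z by (simp add: Dplus_closed_punct_def)
qed

lemma Dplus_subset_closed_punct: "Dplus \<epsilon> \<subseteq> Dplus_closed_punct \<epsilon>"
proof
  fix z assume z: "z \<in> Dplus \<epsilon>"
  then have "z \<in> closure (Dplus \<epsilon>)" using closure_subset by blast
  moreover have "z \<noteq> 0" using z by (auto simp: Dplus_def)
  ultimately show "z \<in> Dplus_closed_punct \<epsilon>" by (simp add: Dplus_closed_punct_def)
qed

lemma developing_map_eventually_not_pole:
  assumes "developing_map K (Dplus \<epsilon>) v g" "z \<in> Dplus \<epsilon>"
  shows "\<forall>\<^sub>F w in at z. w \<in> Dplus \<epsilon> \<and> \<not> is_pole g w"
proof -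
  have "g meromorphic_on Dplus \<epsilon>"
    using assms(1) by (simp add: developing_map_def nicely_meromorphic_on_def)
  then have "g meromorphic_on {z}" by (rule meromorphic_on_subset) (use assms(2) in simp)
  then have "isolated_singularity_at g z" by (rule meromorphic_on_isolated_singularity)
  then have "\<forall>\<^sub>F w in at z. g analytic_on {w}" by (simp add: isolated_singularity_at_altdef)
  moreover have "\<forall>\<^sub>F w in at z. w \<in> Dplus \<epsilon> - {z}" using assms(2) by (intro eventually_at_in_open) auto
  ultimately show ?thesis
    by eventually_elim (auto simp: not_is_pole_holomorphic analytic_at)
qed

lemma developing_map_regular_neighbourhood:
  assumes dev: "developing_map K (Dplus \<epsilon>) v g" and K: "K \<in> {-1, 0, 1}"
    and z: "z \<in> Dplus \<epsilon>" "\<not> is_pole g z"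
  obtains r where "r > 0" "ball z r \<subseteq> Dplus \<epsilon>" "g holomorphic_on ball z r"
    "\<And>w. w \<in> ball z r \<Longrightarrow> \<not> is_pole g w" "\<And>w. w \<in> ball z r \<Longrightarrow> deriv g w \<noteq> 0"
    "\<And>w. w \<in> ball z r \<Longrightarrow> 1 + K * (cmod (g w))\<^sup>2 > 0"
    "\<And>w. w \<in> ball z r \<Longrightarrow> v w = ln (4 * (cmod (deriv g w))\<^sup>2 / (1 + K * (cmod (g w))\<^sup>2)\<^sup>2)"
proof -
  have "g analytic_on {z}"
    using dev z by (intro nicely_meromorphic_on_imp_analytic_at[of g "Dplus \<epsilon>"]) (auto simp: developing_map_def)
  then obtain A where A: "open A" "z \<in> A" "g holomorphic_on A" by (auto simp: analytic_at)
  have "open (A \<inter> Dplus \<epsilon>)" "z \<in> A \<inter> Dplus \<epsilon>" using A z by auto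
  then obtain r where r: "r > 0" "ball z r \<subseteq> A \<inter> Dplus \<epsilon>" by (meson open_contains_ball)
  have np: "\<not> is_pole g w" if "w \<in> ball z r" for w
    using not_is_pole_holomorphic[OF A(1) _ A(3)] r that by blast
  show ?thesis
  proof (rule that[OF r(1)])
    show "ball z r \<subseteq> Dplus \<epsilon>" "g holomorphic_on ball z r" using r A holomorphic_on_subset by blast+
    fix w assume w: "w \<in> ball z r"
    then have wD: "w \<in> Dplus \<epsilon>" using r by auto
    show "\<not> is_pole g w" by (rule np[OF w])
    then show "deriv g w \<noteq> 0" "v w = ln (4 * (cmod (deriv g w))\<^sup>2 / (1 + K * (cmod (g w))\<^sup>2)\<^sup>2)"
      using dev wD by (auto simp: developing_map_def)
    show "1 + K * (cmod (g w))\<^sup>2 > 0"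
    proof (cases "K \<le> 0")
      case True
      then show ?thesis using dev wD by (auto simp: developing_map_def)
    next
      case False
      then have "K = 1" using K by auto
      then show ?thesis by (simp add: add_pos_nonneg)
    qed
  qed
qed

text \<open>Differentiating the boundary condition along the axis gives v_ts = v_t v_s / 2, which
  says that Q has imaginary part zero. In the interior Q is the Schwarzian derivative off the poles
  of g, and at the poles its continuity removes the singularity.\<close>

lemma schwarzian_map_reflection:
  fixes K c1 c2 \<epsilon> :: real
    and v vs vt vss vst vts vtt :: "complex \<Rightarrow> real"
  defines "Q \<equiv> schwarzian_map vs vt vss vst vts vtt"
  assumes K: "K \<in> {-1, 0, 1}"
    and d1: "\<forall>z\<in>Dplus_closed_punct \<epsilon>.
              (v has_derivative (\<lambda>h. Re h * vs z + Im h * vt z)) (at z within Dplus_closed_punct \<epsilon>)"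
    and d2s: "\<forall>z\<in>Dplus_closed_punct \<epsilon>.
              (vs has_derivative (\<lambda>h. Re h * vss z + Im h * vst z)) (at z within Dplus_closed_punct \<epsilon>)"
    and d2t: "\<forall>z\<in>Dplus_closed_punct \<epsilon>.
              (vt has_derivative (\<lambda>h. Re h * vts z + Im h * vtt z)) (at z within Dplus_closed_punct \<epsilon>)"
    and c2: "continuous_on (Dplus_closed_punct \<epsilon>) vss" "continuous_on (Dplus_closed_punct \<epsilon>) vst"
            "continuous_on (Dplus_closed_punct \<epsilon>) vts" "continuous_on (Dplus_closed_punct \<epsilon>) vtt"
    and bc1: "\<forall>s::real. 0 < s \<and> s < \<epsilon> \<longrightarrow> vt (complex_of_real s) = c1 * exp (v (complex_of_real s) / 2)"
    and bc2: "\<forall>s::real. 0 < - s \<and> - s < \<epsilon> \<longrightarrow> vt (complex_of_real s) = c2 * exp (v (complex_of_real s) / 2)"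
    and dev: "developing_map K (Dplus \<epsilon>) v g"
  shows "(\<lambda>z. if 0 \<le> Im z then Q z else cnj (Q (cnj z))) holomorphic_on Dstar \<epsilon>"
    and "\<And>z. z \<in> Dstar \<epsilon> \<Longrightarrow> z \<in> \<real> \<Longrightarrow> Q z \<in> \<real>"
    and "\<And>z. z \<in> Dplus \<epsilon> \<Longrightarrow> \<not> is_pole g z \<Longrightarrow>
       Q z = deriv (\<lambda>w. deriv (deriv g) w / deriv g w) z - (deriv (deriv g) z / deriv g z)\<^sup>2 / 2"
proof -
  let ?S = "Dplus_closed_punct \<epsilon>"
  have within: "at z within ?S = at z" if "z \<in> Dplus \<epsilon>" for z
    by (rule at_within_open_subset[OF that open_Dplus Dplus_subset_closed_punct])
  have inS: "z \<in> ?S" if "z \<in> Dplus \<epsilon>" for z using that Dplus_subset_closed_punct by blast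
  have reg: "Q w = deriv (\<lambda>w. deriv (deriv g) w / deriv g w) w - (deriv (deriv g) w / deriv g w)\<^sup>2 / 2 \<and> vst w = vts w"
    if w: "w \<in> Dplus \<epsilon>" "\<not> is_pole g w" for w
  proof -
    obtain r where r: "r > 0" "ball w r \<subseteq> Dplus \<epsilon>" "g holomorphic_on ball w r"
      and r': "\<And>z. z \<in> ball w r \<Longrightarrow> deriv g z \<noteq> 0" "\<And>z. z \<in> ball w r \<Longrightarrow> 1 + K * (cmod (g z))\<^sup>2 > 0"
       "\<And>z. z \<in> ball w r \<Longrightarrow> v z = ln (4 * (cmod (deriv g z))\<^sup>2 / (1 + K * (cmod (g z))\<^sup>2)\<^sup>2)"
      using developing_map_regular_neighbourhood[OF dev K w] by metis
    have d1': "(v has_derivative (\<lambda>h. Re h * vs z + Im h * vt z)) (at z)" if "z \<in> ball w r" for z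
      using d1 inS[of z] within[of z] r(2) that by (metis subsetD)
    have d2': "(vs has_derivative (\<lambda>h. Re h * vss w + Im h * vst w)) (at w)"
      "(vt has_derivative (\<lambda>h. Re h * vts w + Im h * vtt w)) (at w)"
      using d2s d2t inS[OF w(1)] within[OF w(1)] by auto
    have "w \<in> ball w r" using r(1) by simp
    note eq = schwarzian_map_eq_schwarzian[where U = "ball w r" and z = w and g = g and K = K and v = v
        and vs = vs and vt = vt and vss = vss and vst = vst and vts = vts and vtt = vtt, OF open_ball this r(3) r'(1) r'(2) r'(3) d1' d2']
    show ?thesis unfolding Q_def by (rule conjI[OF eq])
  qed
  then show "Q z = deriv (\<lambda>w. deriv (deriv g) w / deriv g w) z - (deriv (deriv g) z / deriv g z)\<^sup>2 / 2"
    if "z \<in> Dplus \<epsilon>" "\<not> is_pole g z" for z using that by blast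
  have contQ: "continuous_on ?S Q"
  proof -
    have "continuous_on ?S vs"
      by (rule has_derivative_continuous_on[where f' = "\<lambda>z h. Re h * vss z + Im h * vst z"]) (use d2s in blast)
    moreover have "continuous_on ?S vt"
      by (rule has_derivative_continuous_on[where f' = "\<lambda>z h. Re h * vts z + Im h * vtt z"]) (use d2t in blast)
    ultimately show ?thesis unfolding Q_def schwarzian_map_def by (intro continuous_intros c2) auto
  qed
  have regdiff: "Q field_differentiable at z" if z: "z \<in> Dplus \<epsilon>" "\<not> is_pole g z" for z
  proof -
    obtain r where r: "r > 0" "ball z r \<subseteq> Dplus \<epsilon>" "g holomorphic_on ball z r"
      and r': "\<And>w. w \<in> ball z r \<Longrightarrow> \<not> is_pole g w" "\<And>w. w \<in> ball z r \<Longrightarrow> deriv g w \<noteq> 0"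
      using developing_map_regular_neighbourhood[OF dev K z] by metis
    have "(\<lambda>w. deriv (\<lambda>w. deriv (deriv g) w / deriv g w) w - (deriv (deriv g) w / deriv g w)\<^sup>2 / 2) holomorphic_on ball z r"
      using r' by (intro holomorphic_intros holomorphic_deriv r(3)) auto
    then have "Q holomorphic_on ball z r"
      by (rule holomorphic_transform) (use reg r' r(2) in auto)
    then show ?thesis using r(1) by (intro holomorphic_on_imp_differentiable_at[of Q "ball z r"]) auto
  qed
  have Qhol: "Q holomorphic_on Dplus \<epsilon>"
  proof -
    have "Q field_differentiable at z" if z: "z \<in> Dplus \<epsilon>" for z
    proof -
      obtain d where d: "d > 0" "\<And>w. w \<noteq> z \<Longrightarrow> dist w z < d \<Longrightarrow> w \<in> Dplus \<epsilon> \<and> \<not> is_pole g w"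
        using developing_map_eventually_not_pole[OF dev z] by (auto simp: eventually_at)
      have sub: "ball z d \<subseteq> Dplus \<epsilon>" using d(2) z by (metis dist_commute mem_ball subsetI)
      have "Q holomorphic_on ball z d"
      proof (rule no_isolated_singularity[of "ball z d" Q "{z}"])
        show "continuous_on (ball z d) Q"
          using contQ sub Dplus_subset_closed_punct continuous_on_subset by blast
        show "Q holomorphic_on ball z d - {z}"
          using regdiff d(2) by (force simp: holomorphic_on_def dist_commute intro: field_differentiable_at_within)
      qed auto
      then show ?thesis using d(1) by (intro holomorphic_on_imp_differentiable_at[of Q "ball z d"]) auto
    qed
    then show ?thesis by (simp add: holomorphic_on_def field_differentiable_at_within)
  qed
  \<comment> \<open>Regular points are dense in the closed half disc, so the symmetry of the second
    derivatives reaches the boundary by continuity.\<close>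
  define D0 where "D0 = {z \<in> Dplus \<epsilon>. \<not> is_pole g z}"
  have "Dplus \<epsilon> \<subseteq> closure D0"
  proof
    fix z assume z: "z \<in> Dplus \<epsilon>"
    show "z \<in> closure D0"
    proof (subst closure_approachable, intro allI impI)
      fix e :: real assume e: "e > 0"
      obtain d where d: "d > 0" "\<And>w. w \<noteq> z \<Longrightarrow> dist w z < d \<Longrightarrow> w \<in> Dplus \<epsilon> \<and> \<not> is_pole g w"
        using developing_map_eventually_not_pole[OF dev z] by (auto simp: eventually_at)
      let ?w = "z + of_real (min d e / 2)"
      have "?w \<noteq> z" "dist ?w z < d" "dist ?w z < e" using d e by (auto simp: dist_norm)
      then show "\<exists>y\<in>D0. dist y z < e" using d(2)[of ?w] by (auto simp: D0_def)
    qed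
  qed
  then have "closure (Dplus \<epsilon>) \<subseteq> closure D0" by (simp add: closure_minimal)
  then have Scl: "?S \<subseteq> closure D0" by (auto simp: Dplus_closed_punct_def)
  have D0S: "D0 \<subseteq> ?S" using Dplus_subset_closed_punct by (auto simp: D0_def)
  have sym: "vst z = vts z" if z: "z \<in> ?S" for z
  proof (cases "z \<in> D0")
    case True
    then show ?thesis using reg by (auto simp: D0_def)
  next
    case False
    then have "z islimpt D0" using Scl z by (auto simp: closure_def)
    then have nb: "at z within D0 \<noteq> bot" by (simp add: trivial_limit_within)
    have "continuous_on ?S (\<lambda>z. vst z - vts z)" by (intro continuous_intros c2)
    then have "((\<lambda>z. vst z - vts z) \<longlongrightarrow> vst z - vts z) (at z within D0)"
      using z D0S tendsto_within_subset unfolding continuous_on by blast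
    moreover have "((\<lambda>z. vst z - vts z) \<longlongrightarrow> 0) (at z within D0)"
      by (rule tendsto_eventually) (use reg in \<open>auto simp: eventually_at_filter D0_def\<close>)
    ultimately have "vst z - vts z = 0" using tendsto_unique[OF nb] by blast
    then show ?thesis by simp
  qed
  have boundary: "Q (of_real s) \<in> \<real>" if s: "0 < \<bar>s\<bar>" "\<bar>s\<bar> < \<epsilon>" for s :: real
  proof -
    define I where "I = (if s > 0 then {0<..<\<epsilon>} else {-\<epsilon><..<0})"
    define c where "c = (if s > 0 then c1 else c2)"
    have I: "open I" "s \<in> I" using s by (auto simp: I_def)
    have IS: "of_real ` I \<subseteq> ?S"
      using Dstar_closed_half_subset[of _ \<epsilon>] by (auto simp: I_def Dstar_def split: if_splits)
    have sS: "of_real s \<in> ?S" using IS I by auto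
    have vtc: "vt (of_real t) = c * exp (v (of_real t) / 2)" if "t \<in> I" for t
      using bc1 bc2 that by (auto simp: I_def c_def split: if_splits)
    have der: "((\<lambda>t. f (of_real t)) has_real_derivative a) (at s)"
      if "(f has_derivative (\<lambda>h. Re h * a + Im h * b)) (at (of_real s) within ?S)" for f :: "complex \<Rightarrow> real" and a b
    proof -
      have f: "(f has_derivative (\<lambda>h. Re h * a + Im h * b)) (at (of_real s) within of_real ` I)"
        using that IS by (rule has_derivative_subset)
      have "(complex_of_real has_derivative of_real) (at s within I)"
        by (rule has_derivative_at_withinI) (auto intro!: derivative_eq_intros)
      from has_derivative_in_compose[OF this f]
      have "((\<lambda>t. f (of_real t)) has_derivative (\<lambda>h. h * a)) (at s within I)" by simp
      then show ?thesis using at_within_open[OF I(2,1)] by (simp add: has_field_derivative_def mult_commute_abs)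
    qed
    have dv: "((\<lambda>t. v (of_real t)) has_real_derivative vs (of_real s)) (at s)" using d1 sS by (intro der) blast
    have dvt: "((\<lambda>t. vt (of_real t)) has_real_derivative vts (of_real s)) (at s)" using d2t sS by (intro der) blast
    have "((\<lambda>t. c * exp (v (of_real t) / 2)) has_real_derivative c * exp (v (of_real s) / 2) * (vs (of_real s) / 2)) (at s)"
      by (auto intro!: derivative_eq_intros dv)
    then have "((\<lambda>t. vt (of_real t)) has_real_derivative c * exp (v (of_real s) / 2) * (vs (of_real s) / 2)) (at s)"
      by (rule has_field_derivative_transform_within_open[OF _ I]) (simp add: vtc)
    \<comment> \<open>For symmetric mixed derivatives Im Q = vs vt / 4 - vts / 2.\<close>
    from DERIV_unique[OF dvt this] have "vts (of_real s) = vt (of_real s) * vs (of_real s) / 2"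
      using vtc[OF I(2)] by simp
    then have "Im (Q (of_real s)) = 0"
      unfolding Q_def schwarzian_map_def using sym[OF sS] by (simp add: power2_eq_square field_simps)
    then show ?thesis by (simp add: complex_is_Real_iff)
  qed
  show real: "Q z \<in> \<real>" if "z \<in> Dstar \<epsilon>" "z \<in> \<real>" for z
    using boundary[of "Re z"] that by (auto simp: Dstar_def elim!: Reals_cases)
  show "(\<lambda>z. if 0 \<le> Im z then Q z else cnj (Q (cnj z))) holomorphic_on Dstar \<epsilon>"
  proof (rule Schwarz_reflection)
    show "cnj ` Dstar \<epsilon> \<subseteq> Dstar \<epsilon>" by (auto simp: Dstar_def)
    show "Q holomorphic_on Dstar \<epsilon> \<inter> {z. 0 < Im z}"
      by (rule holomorphic_on_subset[OF Qhol]) (auto simp: Dstar_def Dplus_def)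
    show "continuous_on (Dstar \<epsilon> \<inter> {z. 0 \<le> Im z}) Q"
      by (rule continuous_on_subset[OF contQ]) (use Dstar_closed_half_subset in auto)
  qed (use real in auto)
qed

section \<open>Representation by solutions of the linear equation\<close>

lemma ode_sol_cnj:
  assumes S: "open S" "cnj ` S \<subseteq> S" and y: "ode_sol R S y" and R: "\<And>z. z \<in> S \<Longrightarrow> R (cnj z) = cnj (R z)"
  shows "ode_sol R S (\<lambda>z. cnj (y (cnj z)))"
    and "\<And>z. z \<in> S \<Longrightarrow> deriv (\<lambda>z. cnj (y (cnj z))) z = cnj (deriv y (cnj z))"
proof -
  have yh: "y holomorphic_on S" using y by (simp add: ode_sol_def)
  have cS: "cnj z \<in> S" if "z \<in> S" for z using S(2) that by blast
  have d: "((\<lambda>z. cnj (f (cnj z))) has_field_derivative cnj (deriv f (cnj z))) (at z)"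
    if "f holomorphic_on S" "z \<in> S" for f z
    using has_field_derivative_cnj_cnj[OF holomorphic_derivI[OF that(1) S(1) cS[OF that(2)], of UNIV]] by (simp add: o_def)
  show d1: "deriv (\<lambda>z. cnj (y (cnj z))) z = cnj (deriv y (cnj z))" if "z \<in> S" for z
    by (rule DERIV_imp_deriv[OF d[OF yh that]])
  have "deriv (deriv (\<lambda>z. cnj (y (cnj z)))) z = R z * cnj (y (cnj z))" if z: "z \<in> S" for z
  proof -
    have "deriv (deriv (\<lambda>z. cnj (y (cnj z)))) z = deriv (\<lambda>z. cnj (deriv y (cnj z))) z"
      by (intro deriv_cong_ev eventually_mono[OF eventually_nhds_in_open[OF S(1) z]] d1) auto
    also have "\<dots> = cnj (deriv (deriv y) (cnj z))"
      by (rule DERIV_imp_deriv[OF d[OF holomorphic_deriv[OF yh S(1)] z]])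
    also have "\<dots> = cnj (R (cnj z) * y (cnj z))" using y cS[OF z] by (simp add: ode_sol_def)
    finally show ?thesis using R[OF z] by simp
  qed
  moreover have "(\<lambda>z. cnj (y (cnj z))) holomorphic_on S"
    using d[OF yh] holomorphic_on_open[OF S(1)] by blast
  ultimately show "ode_sol R S (\<lambda>z. cnj (y (cnj z)))" by (simp add: ode_sol_def)
qed

lemma ode_sol_shift:
  assumes S: "open S" "\<And>z. z \<in> S \<Longrightarrow> z + c \<in> S" and y: "ode_sol R S y" and R: "\<And>z. z \<in> S \<Longrightarrow> R (z + c) = R z"
  shows "ode_sol R S (\<lambda>z. y (z + c))"
proof -
  have yh: "y holomorphic_on S" using y by (simp add: ode_sol_def)
  have d: "((\<lambda>z. f (z + c)) has_field_derivative deriv f (z + c)) (at z)"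
    if "f holomorphic_on S" "z \<in> S" for f z
  proof -
    have "((\<lambda>z. z + c) has_field_derivative 1) (at z)" by (auto intro!: derivative_eq_intros)
    from DERIV_chain2[OF holomorphic_derivI[OF that(1) S(1) S(2)[OF that(2)], of UNIV] this] show ?thesis by simp
  qed
  have d1: "deriv (\<lambda>z. y (z + c)) z = deriv y (z + c)" if "z \<in> S" for z
    by (rule DERIV_imp_deriv[OF d[OF yh that]])
  have "deriv (deriv (\<lambda>z. y (z + c))) z = R z * y (z + c)" if z: "z \<in> S" for z
  proof -
    have "deriv (deriv (\<lambda>z. y (z + c))) z = deriv (\<lambda>z. deriv y (z + c)) z"
      by (intro deriv_cong_ev eventually_mono[OF eventually_nhds_in_open[OF S(1) z]] d1) auto
    also have "\<dots> = deriv (deriv y) (z + c)"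
      by (rule DERIV_imp_deriv[OF d[OF holomorphic_deriv[OF yh S(1)] z]])
    also have "\<dots> = R (z + c) * y (z + c)" using y S(2)[OF z] by (simp add: ode_sol_def)
    finally show ?thesis using R[OF z] by simp
  qed
  moreover have "(\<lambda>z. y (z + c)) holomorphic_on S"
    using d[OF yh] holomorphic_on_open[OF S(1)] by blast
  ultimately show ?thesis by (simp add: ode_sol_def)
qed

lemma ode_sol_lincomb:
  assumes "open S" "ode_sol R S u" "ode_sol R S v"
  shows "ode_sol R S (\<lambda>z. a * u z + b * v z)"
proof -
  have h: "u holomorphic_on S" "v holomorphic_on S" using assms by (auto simp: ode_sol_def)
  note fd = holomorphic_on_imp_differentiable_at[OF _ assms(1)]
  have d1: "deriv (\<lambda>z. a * u z + b * v z) z = a * deriv u z + b * deriv v z" if "z \<in> S" for z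
    using fd[OF h(1) that] fd[OF h(2) that] by (rule deriv_linear_combination)
  have "deriv (deriv (\<lambda>z. a * u z + b * v z)) z = R z * (a * u z + b * v z)" if z: "z \<in> S" for z
  proof -
    have "deriv (deriv (\<lambda>z. a * u z + b * v z)) z = deriv (\<lambda>z. a * deriv u z + b * deriv v z) z"
      by (intro deriv_cong_ev eventually_mono[OF eventually_nhds_in_open[OF assms(1) z]] d1) auto
    also have "\<dots> = a * deriv (deriv u) z + b * deriv (deriv v) z"
      using fd[OF holomorphic_deriv[OF h(1) assms(1)] z] fd[OF holomorphic_deriv[OF h(2) assms(1)] z]
      by (rule deriv_linear_combination)
    finally show ?thesis using assms z by (simp add: ode_sol_def algebra_simps)
  qed
  then show ?thesis using h by (auto simp: ode_sol_def intro!: holomorphic_intros)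
qed

text \<open>The basis is normalised at a real point, so the reflection of each member solves the
  same equation with the same initial values and coincides with it.\<close>

lemma exists_real_basis:
  assumes R: "R holomorphic_on {\<zeta>. Re \<zeta> < X0}"
    and cn: "\<And>\<zeta>. Re \<zeta> < X0 \<Longrightarrow> R (cnj \<zeta>) = cnj (R \<zeta>)" and per: "\<And>\<zeta>. Re \<zeta> < X0 \<Longrightarrow> R (\<zeta> + turn) = R \<zeta>"
  obtains y1 y2 a11 a12 a21 a22 where "ode_sol R {\<zeta>. Re \<zeta> < X0} y1" "ode_sol R {\<zeta>. Re \<zeta> < X0} y2"
    "\<And>\<zeta>. Re \<zeta> < X0 \<Longrightarrow> wronskian y1 y2 \<zeta> = 1"
    "\<And>\<zeta>. Re \<zeta> < X0 \<Longrightarrow> y1 (cnj \<zeta>) = cnj (y1 \<zeta>) \<and> y2 (cnj \<zeta>) = cnj (y2 \<zeta>)"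
    "\<And>\<zeta>. Re \<zeta> < X0 \<Longrightarrow> y1 (\<zeta> + turn) = a11 * y1 \<zeta> + a12 * y2 \<zeta>"
    "\<And>\<zeta>. Re \<zeta> < X0 \<Longrightarrow> y2 (\<zeta> + turn) = a21 * y1 \<zeta> + a22 * y2 \<zeta>"
proof -
  let ?H = "{\<zeta>. Re \<zeta> < X0}"
  define a where "a = complex_of_real (X0 - 1)"
  have H: "convex ?H" "open ?H" "connected ?H"
    by (simp_all add: convex_halfspace_Re_lt open_halfspace_Re_lt convex_connected)
  have a: "a \<in> ?H" and cnja: "cnj a = a" by (simp_all add: a_def)
  obtain y1 where y1: "ode_sol R ?H y1" "y1 a = 1" "deriv y1 a = 0" using ode_sol_exists[OF H(1,2) a R] by blast
  obtain y2 where y2: "ode_sol R ?H y2" "y2 a = 0" "deriv y2 a = 1" using ode_sol_exists[OF H(1,2) a R] by blast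
  have Wa: "wronskian y1 y2 a = 1" by (simp add: wronskian_def y1 y2)
  have comb: "y \<zeta> = y a * y1 \<zeta> + deriv y a * y2 \<zeta>" if "ode_sol R ?H y" "Re \<zeta> < X0" for y \<zeta>
    using ode_sol_combination[OF y1(1) y2(1) that(1) H(2,3) a Wa] that(2) by (simp add: wronskian_def y1 y2)
  have cH: "cnj ` ?H \<subseteq> ?H" by auto
  have cnj_eq: "cnj (y (cnj \<zeta>)) = cnj (y a) * y1 \<zeta> + cnj (deriv y a) * y2 \<zeta>" if "ode_sol R ?H y" "Re \<zeta> < X0" for y \<zeta>
    using comb[OF ode_sol_cnj(1)[OF H(2) cH that(1)] that(2)] ode_sol_cnj(2)[OF H(2) cH that(1) _ a] cn by (simp add: cnja)
  show ?thesis
  proof (rule that[OF y1(1) y2(1)])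
    fix \<zeta> assume z: "Re \<zeta> < X0"
    show "wronskian y1 y2 \<zeta> = 1" using wronskian_const[OF y1(1) y2(1) H(2,3) _ a, of \<zeta>] Wa z by simp
    have "cnj (y1 (cnj \<zeta>)) = y1 \<zeta>" "cnj (y2 (cnj \<zeta>)) = y2 \<zeta>"
      using cnj_eq[OF y1(1) z] cnj_eq[OF y2(1) z] by (simp_all add: y1 y2)
    then show "y1 (cnj \<zeta>) = cnj (y1 \<zeta>) \<and> y2 (cnj \<zeta>) = cnj (y2 \<zeta>)" by (metis complex_cnj_cnj)
    have sh: "ode_sol R ?H (\<lambda>z. y (z + turn))" if "ode_sol R ?H y" for y
      using that by (intro ode_sol_shift H(2)) (auto simp: per)
    show "y1 (\<zeta> + turn) = y1 (a + turn) * y1 \<zeta> + deriv (\<lambda>z. y1 (z + turn)) a * y2 \<zeta>" by (rule comb[OF sh[OF y1(1)] z])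
    show "y2 (\<zeta> + turn) = y2 (a + turn) * y1 \<zeta> + deriv (\<lambda>z. y2 (z + turn)) a * y2 \<zeta>" by (rule comb[OF sh[OF y2(1)] z])
  qed
qed

(* If G' = exp l then exp (- l / 2) and G exp (- l / 2) solve the equation whose coefficient is
   - {G, .} / 2; for G = g o exp this coefficient is 1/4 - z^2 {g, z} / 2. *)
lemma local_quotient_of_solutions:
  assumes g: "g holomorphic_on ball z0 r" and r: "r > 0" and nz: "\<And>w. w \<in> ball z0 r \<Longrightarrow> deriv g w \<noteq> 0"
    and z0: "exp \<zeta>0 = z0"
    and R: "\<And>\<zeta>. \<zeta> \<in> H \<Longrightarrow> exp \<zeta> \<in> ball z0 r \<Longrightarrow> R \<zeta> = 1 / 4 - (exp \<zeta>)\<^sup>2 *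
        (deriv (\<lambda>w. deriv (deriv g) w / deriv g w) (exp \<zeta>) - (deriv (deriv g) (exp \<zeta>) / deriv g (exp \<zeta>))\<^sup>2 / 2) / 2"
    and y: "ode_sol R H y1" "ode_sol R H y2" and H: "open H" "\<zeta>0 \<in> H"
    and W: "\<And>\<zeta>. \<zeta> \<in> H \<Longrightarrow> wronskian y1 y2 \<zeta> = 1"
  obtains a b c d \<rho> where "a * d - b * c \<noteq> 0" "\<rho> > 0" "ball \<zeta>0 \<rho> \<subseteq> H"
    "\<And>\<zeta>. \<zeta> \<in> ball \<zeta>0 \<rho> \<Longrightarrow> g (exp \<zeta>) * (c * y1 \<zeta> + d * y2 \<zeta>) = a * y1 \<zeta> + b * y2 \<zeta>"
proof -
  have "open (H \<inter> exp -` ball z0 r)" using H(1) by (intro open_Int open_vimage continuous_intros) auto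
  moreover have "\<zeta>0 \<in> H \<inter> exp -` ball z0 r" using H z0 r by simp
  ultimately obtain \<rho> where \<rho>: "\<rho> > 0" "ball \<zeta>0 \<rho> \<subseteq> H \<inter> exp -` ball z0 r" by (meson open_contains_ball)
  define V where "V = ball \<zeta>0 \<rho>"
  have V: "open V" "connected V" "\<zeta>0 \<in> V" "V \<subseteq> H" "\<And>\<zeta>. \<zeta> \<in> V \<Longrightarrow> exp \<zeta> \<in> ball z0 r"
    using \<rho> by (auto simp: V_def)
  define \<phi> where "\<phi> w = deriv (deriv g) w / deriv g w" for w
  have \<phi>h: "\<phi> holomorphic_on ball z0 r"
    unfolding \<phi>_def using nz by (intro holomorphic_intros holomorphic_deriv g) auto
  define G where "G \<zeta> = g (exp \<zeta>)" for \<zeta>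
  define G' where "G' \<zeta> = deriv g (exp \<zeta>) * exp \<zeta>" for \<zeta>
  have dG: "(G has_field_derivative G' \<zeta>) (at \<zeta>)" if "\<zeta> \<in> V" for \<zeta>
    unfolding G_def G'_def by (rule DERIV_chain2[OF holomorphic_derivI[OF g open_ball V(5)[OF that]] DERIV_exp])
  have dgh: "deriv g holomorphic_on ball z0 r" by (intro holomorphic_deriv g) auto
  have dG': "(G' has_field_derivative G' \<zeta> * (\<phi> (exp \<zeta>) * exp \<zeta> + 1)) (at \<zeta>)" if "\<zeta> \<in> V" for \<zeta>
  proof -
    have "((\<lambda>\<zeta>. deriv g (exp \<zeta>)) has_field_derivative deriv (deriv g) (exp \<zeta>) * exp \<zeta>) (at \<zeta>)"
      by (rule DERIV_chain2[OF holomorphic_derivI[OF dgh open_ball V(5)[OF that]] DERIV_exp])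
    from DERIV_mult[OF this DERIV_exp]
    have "(G' has_field_derivative deriv (deriv g) (exp \<zeta>) * exp \<zeta> * exp \<zeta> + exp \<zeta> * deriv g (exp \<zeta>)) (at \<zeta>)"
      unfolding G'_def .
    moreover have "deriv (deriv g) (exp \<zeta>) * exp \<zeta> * exp \<zeta> + exp \<zeta> * deriv g (exp \<zeta>) = G' \<zeta> * (\<phi> (exp \<zeta>) * exp \<zeta> + 1)"
      unfolding G'_def \<phi>_def using nz[OF V(5)[OF that]] by (simp add: field_simps)
    ultimately show ?thesis by simp
  qed
  have G'h: "G' holomorphic_on V" using dG' holomorphic_on_open[OF V(1)] by blast
  have G'0: "G' \<zeta> \<noteq> 0" if "\<zeta> \<in> V" for \<zeta> using nz[OF V(5)[OF that]] by (simp add: G'_def)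
  have "contractible V" unfolding V_def by (intro convex_imp_contractible) simp
  then obtain l where l: "l holomorphic_on V" "\<And>\<zeta>. \<zeta> \<in> V \<Longrightarrow> G' \<zeta> = exp (l \<zeta>)"
    using contractible_imp_holomorphic_log[OF G'h _ G'0] by blast
  define l' where "l' \<zeta> = \<phi> (exp \<zeta>) * exp \<zeta> + 1" for \<zeta>
  have dl: "(l has_field_derivative l' \<zeta>) (at \<zeta>)" if z: "\<zeta> \<in> V" for \<zeta>
  proof -
    have d: "(l has_field_derivative deriv l \<zeta>) (at \<zeta>)" by (rule holomorphic_derivI[OF l(1) V(1) z])
    then have "((\<lambda>\<zeta>. exp (l \<zeta>)) has_field_derivative exp (l \<zeta>) * deriv l \<zeta>) (at \<zeta>)"
      by (auto intro!: derivative_eq_intros)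
    then have "(G' has_field_derivative exp (l \<zeta>) * deriv l \<zeta>) (at \<zeta>)"
      by (rule has_field_derivative_transform_within_open[OF _ V(1) z]) (simp add: l(2))
    from DERIV_unique[OF this dG'[OF z]] have "deriv l \<zeta> = l' \<zeta>" by (simp add: l(2)[OF z] l'_def)
    then show ?thesis using d by simp
  qed
  have dl': "(l' has_field_derivative deriv \<phi> (exp \<zeta>) * exp \<zeta> * exp \<zeta> + \<phi> (exp \<zeta>) * exp \<zeta>) (at \<zeta>)" if z: "\<zeta> \<in> V" for \<zeta>
  proof -
    have "((\<lambda>\<zeta>. \<phi> (exp \<zeta>)) has_field_derivative deriv \<phi> (exp \<zeta>) * exp \<zeta>) (at \<zeta>)"
      by (rule DERIV_chain2[OF holomorphic_derivI[OF \<phi>h open_ball V(5)[OF z]] DERIV_exp])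
    then show ?thesis unfolding l'_def by (auto intro!: derivative_eq_intros simp: algebra_simps)
  qed
  define Y where "Y \<zeta> = exp (- l \<zeta> / 2)" for \<zeta>
  have dY: "(Y has_field_derivative - l' \<zeta> / 2 * Y \<zeta>) (at \<zeta>)" if z: "\<zeta> \<in> V" for \<zeta>
    unfolding Y_def using dl[OF z] by (auto intro!: derivative_eq_intros)
  have Y2: "Y \<zeta> * Y \<zeta> * G' \<zeta> = 1" if z: "\<zeta> \<in> V" for \<zeta>
    unfolding l(2)[OF z] Y_def by (simp flip: exp_add)
  \<comment> \<open>The right-hand side is the square of \<open>l'\<close> over 4 minus half the
    derivative of \<open>l'\<close>, that is minus half the Schwarzian of \<open>G\<close>. The
    constant 1 / 4 stems from the summand 1 in \<open>l'\<close>.\<close>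
  have RV: "R \<zeta> = (l' \<zeta>)\<^sup>2 / 4 - (deriv \<phi> (exp \<zeta>) * exp \<zeta> * exp \<zeta> + \<phi> (exp \<zeta>) * exp \<zeta>) / 2" if z: "\<zeta> \<in> V" for \<zeta>
  proof -
    have "\<zeta> \<in> H" using V(4) z by blast
    from R[OF this V(5)[OF z]]
    have Req: "R \<zeta> = 1 / 4 - (exp \<zeta>)\<^sup>2 * (deriv \<phi> (exp \<zeta>) - (\<phi> (exp \<zeta>))\<^sup>2 / 2) / 2"
      by (simp add: \<phi>_def[abs_def])
    show ?thesis unfolding Req l'_def by (simp add: power2_eq_square field_simps)
  qed
  have derY: "deriv Y \<zeta> = - l' \<zeta> / 2 * Y \<zeta>" if "\<zeta> \<in> V" for \<zeta> by (rule DERIV_imp_deriv[OF dY[OF that]])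
  have ddY: "((\<lambda>\<zeta>. - l' \<zeta> / 2 * Y \<zeta>) has_field_derivative R \<zeta> * Y \<zeta>) (at \<zeta>)" if z: "\<zeta> \<in> V" for \<zeta>
    unfolding RV[OF z] using dY[OF z] dl'[OF z] by (auto intro!: derivative_eq_intros simp: power2_eq_square field_simps)
  have solY: "ode_sol R V Y"
  proof -
    have "deriv (deriv Y) \<zeta> = R \<zeta> * Y \<zeta>" if z: "\<zeta> \<in> V" for \<zeta>
    proof -
      have "deriv (deriv Y) \<zeta> = deriv (\<lambda>\<zeta>. - l' \<zeta> / 2 * Y \<zeta>) \<zeta>"
        by (intro deriv_cong_ev eventually_mono[OF eventually_nhds_in_open[OF V(1) z]] derY) auto
      then show ?thesis using DERIV_imp_deriv[OF ddY[OF z]] by simp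
    qed
    moreover have "Y holomorphic_on V" using dY holomorphic_on_open[OF V(1)] by blast
    ultimately show ?thesis by (simp add: ode_sol_def)
  qed
  define Z where "Z \<zeta> = G \<zeta> * Y \<zeta>" for \<zeta>
  have dZ: "(Z has_field_derivative G' \<zeta> * Y \<zeta> + G \<zeta> * (- l' \<zeta> / 2 * Y \<zeta>)) (at \<zeta>)" if z: "\<zeta> \<in> V" for \<zeta>
    unfolding Z_def using dG[OF z] dY[OF z] by (auto intro!: derivative_eq_intros)
  have derZ: "deriv Z \<zeta> = G' \<zeta> * Y \<zeta> + G \<zeta> * (- l' \<zeta> / 2 * Y \<zeta>)" if "\<zeta> \<in> V" for \<zeta> by (rule DERIV_imp_deriv[OF dZ[OF that]])
  have solZ: "ode_sol R V Z"
  proof -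
    have "deriv (deriv Z) \<zeta> = R \<zeta> * Z \<zeta>" if z: "\<zeta> \<in> V" for \<zeta>
    proof -
      have "deriv (deriv Z) \<zeta> = deriv (\<lambda>\<zeta>. G' \<zeta> * Y \<zeta> + G \<zeta> * (- l' \<zeta> / 2 * Y \<zeta>)) \<zeta>"
        by (intro deriv_cong_ev eventually_mono[OF eventually_nhds_in_open[OF V(1) z]] derZ) auto
      moreover have "((\<lambda>\<zeta>. G' \<zeta> * Y \<zeta> + G \<zeta> * (- l' \<zeta> / 2 * Y \<zeta>)) has_field_derivative
          (G' \<zeta> * l' \<zeta> * Y \<zeta> + (- l' \<zeta> / 2 * Y \<zeta>) * G' \<zeta>) + (G' \<zeta> * (- l' \<zeta> / 2 * Y \<zeta>) + R \<zeta> * Y \<zeta> * G \<zeta>)) (at \<zeta>)"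
        using dG'[OF z] by (intro DERIV_add DERIV_mult dG[OF z] dY[OF z] ddY[OF z]) (simp add: l'_def)
      ultimately show ?thesis by (simp add: DERIV_imp_deriv Z_def)
    qed
    moreover have "Z holomorphic_on V" using dZ holomorphic_on_open[OF V(1)] by blast
    ultimately show ?thesis by (simp add: ode_sol_def)
  qed
  have yV: "ode_sol R V y1" "ode_sol R V y2"
    using y V(4) holomorphic_on_subset by (auto simp: ode_sol_def)
  have W0: "wronskian y1 y2 \<zeta>0 = 1" by (rule W[OF H(2)])
  define a b c d where "a = wronskian Z y2 \<zeta>0" and "b = wronskian y1 Z \<zeta>0"
    and "c = wronskian Y y2 \<zeta>0" and "d = wronskian y1 Y \<zeta>0"
  have Zeq: "Z \<zeta> = a * y1 \<zeta> + b * y2 \<zeta>" and Yeq: "Y \<zeta> = c * y1 \<zeta> + d * y2 \<zeta>" if "\<zeta> \<in> V" for \<zeta>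
    using ode_sol_combination[OF yV solZ V(1-3) W0] ode_sol_combination[OF yV solY V(1-3) W0] that
    by (auto simp: a_def b_def c_def d_def)
  \<comment> \<open>The coefficient matrix is invertible, since the Wronskian of \<open>Y\<close>
    and \<open>Z\<close> equals Y^2 G' = 1.\<close>
  have "(c * b - d * a) * wronskian y1 y2 \<zeta>0 = Y \<zeta>0 * deriv Z \<zeta>0 - deriv Y \<zeta>0 * Z \<zeta>0"
  proof -
    have fd: "y1 field_differentiable at \<zeta>0" "y2 field_differentiable at \<zeta>0"
      using yV V holomorphic_on_imp_differentiable_at by (auto simp: ode_sol_def)
    have "deriv Z \<zeta>0 = deriv (\<lambda>\<zeta>. a * y1 \<zeta> + b * y2 \<zeta>) \<zeta>0" "deriv Y \<zeta>0 = deriv (\<lambda>\<zeta>. c * y1 \<zeta> + d * y2 \<zeta>) \<zeta>0"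
      by (intro deriv_cong_ev eventually_mono[OF eventually_nhds_in_open[OF V(1,3)]] Zeq Yeq; simp)+
    then have "wronskian Y Z \<zeta>0 = wronskian (\<lambda>\<zeta>. c * y1 \<zeta> + d * y2 \<zeta>) (\<lambda>\<zeta>. a * y1 \<zeta> + b * y2 \<zeta>) \<zeta>0"
      using Zeq[OF V(3)] Yeq[OF V(3)] by (simp add: wronskian_def)
    also have "\<dots> = (c * b - d * a) * wronskian y1 y2 \<zeta>0" by (rule wronskian_linear_combination[OF fd])
    finally show ?thesis by (simp add: wronskian_def)
  qed
  also have "\<dots> = Y \<zeta>0 * Y \<zeta>0 * G' \<zeta>0" unfolding derY[OF V(3)] derZ[OF V(3)] by (simp add: Z_def algebra_simps)
  also have "\<dots> = 1" by (rule Y2[OF V(3)])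
  finally have "c * b - d * a = 1" using W0 by simp
  then have "a * d - b * c \<noteq> 0" by (auto simp: algebra_simps)
  moreover have "g (exp \<zeta>) * (c * y1 \<zeta> + d * y2 \<zeta>) = a * y1 \<zeta> + b * y2 \<zeta>" if "\<zeta> \<in> V" for \<zeta>
    using Zeq[OF that] Yeq[OF that] by (simp add: Z_def G_def)
  ultimately show ?thesis using that[of a d b c \<rho>] \<rho> by (auto simp: V_def)
qed

section \<open>The developing map as a global quotient on the half disc\<close>

lemma connected_Dplus: "connected (Dplus \<epsilon>)"
proof -
  have "Dplus \<epsilon> = ball 0 \<epsilon> \<inter> {z. 0 < Im z}" by (auto simp: Dplus_def)
  then show ?thesis by (simp add: convex_Int convex_halfspace_Im_gt convex_connected)
qed

lemma Ln_Dplus: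
  assumes "z \<in> Dplus \<epsilon>" "\<epsilon> > 0"
  shows "z \<noteq> 0" "z \<notin> \<real>\<^sub>\<le>\<^sub>0" "Re (Ln z) < ln \<epsilon>" "0 < Im (Ln z)" "Im (Ln z) < pi"
proof -
  show z: "z \<noteq> 0" "z \<notin> \<real>\<^sub>\<le>\<^sub>0" using assms by (auto simp: Dplus_def complex_nonpos_Reals_iff)
  show "Re (Ln z) < ln \<epsilon>" using assms z by (simp add: Dplus_def)
  show "0 < Im (Ln z)" "Im (Ln z) < pi"
    using Im_Ln_pos_lt_imp[of z] Im_Ln_pos_lt[OF z(1)] assms by (auto simp: Dplus_def)
qed

lemma holomorphic_Ln_Dplus:
  assumes "\<epsilon> > 0" "y holomorphic_on {\<zeta>. Re \<zeta> < ln \<epsilon>}"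
  shows "(\<lambda>z. y (Ln z)) holomorphic_on Dplus \<epsilon>"
proof (rule holomorphic_on_compose_gen[OF _ assms(2), unfolded o_def])
  show "Ln holomorphic_on Dplus \<epsilon>" using Ln_Dplus[OF _ assms(1)] by (intro holomorphic_intros) auto
qed (use Ln_Dplus[OF _ assms(1)] in auto)

text \<open>The formula on one small disc is continued by the identity theorem, in a form cleared of
  denominators. At a regular point of g a zero of the denominator would also be a zero of the
  numerator, hence a common zero of both solutions.\<close>

lemma developing_map_quotient:
  assumes eps: "\<epsilon> > 0" and K: "K \<in> {-1, 0, 1}" and dev: "developing_map K (Dplus \<epsilon>) v g"
    and R: "\<And>\<zeta>. Re \<zeta> < ln \<epsilon> \<Longrightarrow> exp \<zeta> \<in> Dplus \<epsilon> \<Longrightarrow> \<not> is_pole g (exp \<zeta>) \<Longrightarrow> R \<zeta> = 1 / 4 - (exp \<zeta>)\<^sup>2 *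
        (deriv (\<lambda>w. deriv (deriv g) w / deriv g w) (exp \<zeta>) - (deriv (deriv g) (exp \<zeta>) / deriv g (exp \<zeta>))\<^sup>2 / 2) / 2"
    and y: "ode_sol R {\<zeta>. Re \<zeta> < ln \<epsilon>} y1" "ode_sol R {\<zeta>. Re \<zeta> < ln \<epsilon>} y2"
    and W: "\<And>\<zeta>. Re \<zeta> < ln \<epsilon> \<Longrightarrow> wronskian y1 y2 \<zeta> = 1"
  obtains a b c d where "a * d - b * c \<noteq> 0"
    "\<And>z. z \<in> Dplus \<epsilon> \<Longrightarrow> \<not> is_pole g z \<Longrightarrow> c * y1 (Ln z) + d * y2 (Ln z) \<noteq> 0"
    "\<And>z. z \<in> Dplus \<epsilon> \<Longrightarrow> \<not> is_pole g z \<Longrightarrow> g z * (c * y1 (Ln z) + d * y2 (Ln z)) = a * y1 (Ln z) + b * y2 (Ln z)"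
proof -
  let ?H = "{\<zeta>. Re \<zeta> < ln \<epsilon>}"
  have oH: "open ?H" by (rule open_halfspace_Re_lt)
  have yh: "y1 holomorphic_on ?H" "y2 holomorphic_on ?H" using y by (auto simp: ode_sol_def)
  have gm: "g nicely_meromorphic_on Dplus \<epsilon>" "g meromorphic_on Dplus \<epsilon>"
    using dev by (auto simp: developing_map_def nicely_meromorphic_on_def)
  have "\<i> * of_real (\<epsilon> / 2) \<in> Dplus \<epsilon>" using eps by (simp add: Dplus_def norm_mult)
  from eventually_happens'[OF _ developing_map_eventually_not_pole[OF dev this]]
  obtain z0 where z0: "z0 \<in> Dplus \<epsilon>" "\<not> is_pole g z0" by auto
  obtain r where r: "r > 0" "ball z0 r \<subseteq> Dplus \<epsilon>" "g holomorphic_on ball z0 r"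
      and r': "\<And>w. w \<in> ball z0 r \<Longrightarrow> \<not> is_pole g w" "\<And>w. w \<in> ball z0 r \<Longrightarrow> deriv g w \<noteq> 0"
    using developing_map_regular_neighbourhood[OF dev K z0] by metis
  have L0: "exp (Ln z0) = z0" "Ln z0 \<in> ?H" using Ln_Dplus[OF z0(1) eps] by auto
  have Rloc: "R \<zeta> = 1 / 4 - (exp \<zeta>)\<^sup>2 *
        (deriv (\<lambda>w. deriv (deriv g) w / deriv g w) (exp \<zeta>) - (deriv (deriv g) (exp \<zeta>) / deriv g (exp \<zeta>))\<^sup>2 / 2) / 2"
    if "\<zeta> \<in> ?H" "exp \<zeta> \<in> ball z0 r" for \<zeta>
    using R[of \<zeta>] that r(2) r'(1) by auto
  have W': "wronskian y1 y2 \<zeta> = 1" if "\<zeta> \<in> ?H" for \<zeta> using W that by simp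
  obtain a b c d \<rho> where D: "a * d - b * c \<noteq> 0" and \<rho>: "\<rho> > 0" "ball (Ln z0) \<rho> \<subseteq> ?H"
    and loc: "\<And>\<zeta>. \<zeta> \<in> ball (Ln z0) \<rho> \<Longrightarrow> g (exp \<zeta>) * (c * y1 \<zeta> + d * y2 \<zeta>) = a * y1 \<zeta> + b * y2 \<zeta>"
    by (rule local_quotient_of_solutions[where R = R and H = ?H and ?y1.0 = y1 and ?y2.0 = y2,
          OF r(3) r(1) r'(2) L0(1) Rloc y oH L0(2) W']) (assumption | blast)+
  define G1 G2 where "G1 z = a * y1 (Ln z) + b * y2 (Ln z)" and "G2 z = c * y1 (Ln z) + d * y2 (Ln z)" for z
  have Gh: "G1 holomorphic_on Dplus \<epsilon>" "G2 holomorphic_on Dplus \<epsilon>"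
    unfolding G1_def G2_def by (intro holomorphic_intros holomorphic_Ln_Dplus[OF eps] yh)+
  define \<Psi> where "\<Psi> z = g z * G2 z - G1 z" for z
  have \<Psi>m: "\<Psi> meromorphic_on Dplus \<epsilon>"
    unfolding \<Psi>_def using Gh
    by (intro meromorphic_on_diff meromorphic_on_mult gm analytic_on_imp_meromorphic_on) (simp_all add: analytic_on_open)
  have \<Psi>an: "\<Psi> analytic_on {z}" if "z \<in> Dplus \<epsilon>" "\<not> is_pole g z" for z
  proof -
    have "G1 analytic_on {z}" "G2 analytic_on {z}"
      using Gh that by (auto simp: analytic_at intro: exI[of _ "Dplus \<epsilon>"])
    moreover have "g analytic_on {z}" by (rule nicely_meromorphic_on_imp_analytic_at[OF gm(1) that])
    ultimately show ?thesis unfolding \<Psi>_def by (intro analytic_intros)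
  qed
  have "(Ln \<longlongrightarrow> Ln z0) (at z0)"
    using Ln_Dplus(2)[OF z0(1) eps] by (intro tendsto_intros) auto
  then have "\<forall>\<^sub>F z in at z0. Ln z \<in> ball (Ln z0) \<rho>" using \<rho>(1) by (intro topological_tendstoD) auto
  then have "\<forall>\<^sub>F z in at z0. remove_sings \<Psi> z = 0"
    using developing_map_eventually_not_pole[OF dev z0(1)]
  proof eventually_elim
    case (elim z)
    have "exp (Ln z) = z" using Ln_Dplus(1)[of z \<epsilon>] elim eps by simp
    then have "\<Psi> z = 0" using loc[OF elim(1)] by (simp add: \<Psi>_def G1_def G2_def)
    moreover have "\<Psi> analytic_on {z}" using \<Psi>an elim by blast
    ultimately show ?case by simp
  qed
  then have freq: "\<exists>\<^sub>F z in at z0. remove_sings \<Psi> z = 0"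
    by (intro eventually_frequently) auto
  have zero: "\<Psi> z = 0" if z: "z \<in> Dplus \<epsilon>" "\<not> is_pole g z" for z
    using frequently_eq_meromorphic_imp_constant[OF freq remove_sings_nicely_meromorphic[OF \<Psi>m] open_Dplus connected_Dplus z0(1) z(1)]
      \<Psi>an[OF z] by simp
  show ?thesis
  proof (rule that[OF D])
    fix z assume z: "z \<in> Dplus \<epsilon>" "\<not> is_pole g z"
    show eq: "g z * (c * y1 (Ln z) + d * y2 (Ln z)) = a * y1 (Ln z) + b * y2 (Ln z)"
      using zero[OF z] by (simp add: \<Psi>_def G1_def G2_def)
    show "c * y1 (Ln z) + d * y2 (Ln z) \<noteq> 0"
    proof
      assume 0: "c * y1 (Ln z) + d * y2 (Ln z) = 0"
      then have 1: "a * y1 (Ln z) + b * y2 (Ln z) = 0" using eq by simp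
      have "(a * d - b * c) * y1 (Ln z) = d * (a * y1 (Ln z) + b * y2 (Ln z)) - b * (c * y1 (Ln z) + d * y2 (Ln z))"
        "(a * d - b * c) * y2 (Ln z) = a * (c * y1 (Ln z) + d * y2 (Ln z)) - c * (a * y1 (Ln z) + b * y2 (Ln z))"
        by (simp_all add: algebra_simps)
      then have "y1 (Ln z) = 0" "y2 (Ln z) = 0" using D 0 1 by simp_all
      then show False using W[OF Ln_Dplus(3)[OF z(1) eps]] by (simp add: wronskian_def)
    qed
  qed
qed

lemma norm_lincomb_square_le:
  fixes a b x y :: complex
  shows "(norm (a * x + b * y))\<^sup>2 \<le> ((norm a)\<^sup>2 + (norm b)\<^sup>2) * ((norm x)\<^sup>2 + (norm y)\<^sup>2)"
proof -
  have "norm (a * x + b * y) \<le> norm a * norm x + norm b * norm y"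
    by (rule order_trans[OF norm_triangle_ineq]) (simp add: norm_mult)
  then have "(norm (a * x + b * y))\<^sup>2 \<le> (norm a * norm x + norm b * norm y)\<^sup>2" by (rule power_mono) simp
  also have "\<dots> \<le> ((norm a)\<^sup>2 + (norm b)\<^sup>2) * ((norm x)\<^sup>2 + (norm y)\<^sup>2)"
    using zero_le_power2[of "norm a * norm y - norm b * norm x"] by (simp add: power2_eq_square algebra_simps)
  finally show ?thesis .
qed

(* In all three geometries exp v dominates four times the squared spherical derivative of g. *)
lemma spherical_area_finite:
  assumes eps: "\<epsilon> > 0" and K: "K \<in> {-1, 0, 1}" and dev: "developing_map K (Dplus \<epsilon>) v g"
    and cont: "continuous_on (Dplus \<epsilon>) v" and fin: "(\<lambda>z. exp (v z)) integrable_on Dplus \<epsilon>"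
    and yh: "y1 holomorphic_on {\<zeta>. Re \<zeta> < ln \<epsilon>}" "y2 holomorphic_on {\<zeta>. Re \<zeta> < ln \<epsilon>}"
    and W: "\<And>\<zeta>. Re \<zeta> < ln \<epsilon> \<Longrightarrow> wronskian y1 y2 \<zeta> = 1"
    and D: "a * d - b * c \<noteq> 0"
    and den: "\<And>z. z \<in> Dplus \<epsilon> \<Longrightarrow> \<not> is_pole g z \<Longrightarrow> c * y1 (Ln z) + d * y2 (Ln z) \<noteq> 0"
    and quot: "\<And>z. z \<in> Dplus \<epsilon> \<Longrightarrow> \<not> is_pole g z \<Longrightarrow> g z * (c * y1 (Ln z) + d * y2 (Ln z)) = a * y1 (Ln z) + b * y2 (Ln z)"
  shows "(\<integral>\<^sup>+z\<in>Dplus \<epsilon>. ennreal ((1 / (norm z * ((norm (y1 (Ln z)))\<^sup>2 + (norm (y2 (Ln z)))\<^sup>2)))\<^sup>2) \<partial>lborel) < \<infinity>"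
proof -
  let ?H = "{\<zeta>. Re \<zeta> < ln \<epsilon>}"
  have oH: "open ?H" by (rule open_halfspace_Re_lt)
  define N where "N \<zeta> = (norm (y1 \<zeta>))\<^sup>2 + (norm (y2 \<zeta>))\<^sup>2" for \<zeta>
  have N0: "N \<zeta> > 0" if "Re \<zeta> < ln \<epsilon>" for \<zeta>
  proof -
    have "y1 \<zeta> \<noteq> 0 \<or> y2 \<zeta> \<noteq> 0" using W[OF that] by (auto simp: wronskian_def)
    then show ?thesis unfolding N_def by (rule norm_square_sum_pos)
  qed
  define M where "M = (norm a)\<^sup>2 + (norm b)\<^sup>2 + (norm c)\<^sup>2 + (norm d)\<^sup>2"
  define E where "E = norm (a * d - b * c)"
  have E: "E > 0" using D by (simp add: E_def)
  \<comment> \<open>As |G1|^2 + |G2|^2 \<le> M N, the spherical derivative of g is at least E / (|z|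
    M N), and exp v is at least four times its square.\<close>
  define C where "C = M\<^sup>2 / (4 * E\<^sup>2)"
  have C: "C \<ge> 0" by (simp add: C_def)
  have pw: "(1 / (norm z * N (Ln z)))\<^sup>2 \<le> C * exp (v z)" if z: "z \<in> Dplus \<epsilon>" "\<not> is_pole g z" for z
  proof -
    note L = Ln_Dplus[OF z(1) eps]
    obtain r where r: "r > 0" "ball z r \<subseteq> Dplus \<epsilon>" "g holomorphic_on ball z r"
      and r': "\<And>w. w \<in> ball z r \<Longrightarrow> \<not> is_pole g w" "\<And>w. w \<in> ball z r \<Longrightarrow> deriv g w \<noteq> 0"
        "\<And>w. w \<in> ball z r \<Longrightarrow> 1 + K * (cmod (g w))\<^sup>2 > 0"
        "\<And>w. w \<in> ball z r \<Longrightarrow> v w = ln (4 * (cmod (deriv g w))\<^sup>2 / (1 + K * (cmod (g w))\<^sup>2)\<^sup>2)"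
      using developing_map_regular_neighbourhood[OF dev K z] by metis
    have zb: "z \<in> ball z r" using r(1) by simp
    define G1 G2 where "G1 w = a * y1 (Ln w) + b * y2 (Ln w)" and "G2 w = c * y1 (Ln w) + d * y2 (Ln w)" for w
    have G2: "G2 z \<noteq> 0" using den[OF z] by (simp add: G2_def)
    have dy: "((\<lambda>w. y1 (Ln w)) has_field_derivative deriv y1 (Ln z) * inverse z) (at z)"
      "((\<lambda>w. y2 (Ln w)) has_field_derivative deriv y2 (Ln z) * inverse z) (at z)"
      using L by (auto intro!: DERIV_chain2[OF holomorphic_derivI[OF yh(1) oH] has_field_derivative_Ln]
          DERIV_chain2[OF holomorphic_derivI[OF yh(2) oH] has_field_derivative_Ln])
    have dG: "(G1 has_field_derivative (a * deriv y1 (Ln z) + b * deriv y2 (Ln z)) * inverse z) (at z)"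
      "(G2 has_field_derivative (c * deriv y1 (Ln z) + d * deriv y2 (Ln z)) * inverse z) (at z)"
      unfolding G1_def G2_def using dy by (auto intro!: derivative_eq_intros simp: algebra_simps)
    have "((\<lambda>w. G1 w / G2 w) has_field_derivative
        ((a * deriv y1 (Ln z) + b * deriv y2 (Ln z)) * inverse z * G2 z - G1 z * ((c * deriv y1 (Ln z) + d * deriv y2 (Ln z)) * inverse z)) / (G2 z * G2 z)) (at z)"
      by (rule DERIV_divide[OF dG G2])
    moreover have "(a * deriv y1 (Ln z) + b * deriv y2 (Ln z)) * inverse z * G2 z - G1 z * ((c * deriv y1 (Ln z) + d * deriv y2 (Ln z)) * inverse z)
       = - (a * d - b * c) * wronskian y1 y2 (Ln z) * inverse z"
      by (simp add: G1_def G2_def wronskian_def algebra_simps)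
    ultimately have "((\<lambda>w. G1 w / G2 w) has_field_derivative - (a * d - b * c) * inverse z / (G2 z * G2 z)) (at z)"
      using W[OF L(3)] by simp
    then have "(g has_field_derivative - (a * d - b * c) * inverse z / (G2 z * G2 z)) (at z)"
    proof (rule has_field_derivative_transform_within_open[OF _ open_ball zb])
      fix w assume w: "w \<in> ball z r"
      then show "G1 w / G2 w = g w"
        using den[of w] quot[of w] r'(1)[OF w] r(2) by (auto simp: G1_def G2_def divide_simps)
    qed
    then have "deriv g z = - (a * d - b * c) * inverse z / (G2 z * G2 z)" by (rule DERIV_imp_deriv)
    then have g': "norm (deriv g z) = E / (norm z * (norm (G2 z))\<^sup>2)"
      by (simp add: E_def norm_divide norm_mult norm_inverse power2_eq_square divide_inverse norm_minus_commute)
    have gq: "norm (g z) = norm (G1 z) / norm (G2 z)"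
    proof -
      have "g z = G1 z / G2 z" using quot[OF z] G2 by (simp add: G1_def G2_def divide_simps)
      then show ?thesis by (simp add: norm_divide)
    qed
    have GN: "(norm (G1 z))\<^sup>2 + (norm (G2 z))\<^sup>2 \<le> M * N (Ln z)"
      using norm_lincomb_square_le[of a "y1 (Ln z)" b "y2 (Ln z)"] norm_lincomb_square_le[of c "y1 (Ln z)" d "y2 (Ln z)"]
      by (simp add: M_def N_def G1_def G2_def algebra_simps)
    have S0: "(norm (G1 z))\<^sup>2 + (norm (G2 z))\<^sup>2 > 0" using G2 by (simp add: add_nonneg_pos)
    have MN: "M * N (Ln z) > 0" using S0 GN by linarith
    have M0: "M > 0" using MN N0[OF L(3)] zero_less_mult_pos2 by blast
    have le: "E / (norm z * (M * N (Ln z))) \<le> E / (norm z * ((norm (G1 z))\<^sup>2 + (norm (G2 z))\<^sup>2))"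
      using E L(1) GN S0 M0 N0[OF L(3)] by (intro divide_left_mono mult_left_mono mult_pos_pos) auto
    have one: "1 + (norm (g z))\<^sup>2 = ((norm (G1 z))\<^sup>2 + (norm (G2 z))\<^sup>2) / (norm (G2 z))\<^sup>2"
      using G2 by (simp add: gq power_divide divide_simps)
    have sph: "norm (deriv g z) / (1 + (norm (g z))\<^sup>2) = E / (norm z * ((norm (G1 z))\<^sup>2 + (norm (G2 z))\<^sup>2))"
      unfolding g' one using G2 by simp
    have pos: "0 < 1 + K * (cmod (g z))\<^sup>2" by (rule r'(3)[OF zb])
    have Kle: "1 + K * (cmod (g z))\<^sup>2 \<le> 1 + (cmod (g z))\<^sup>2"
      using K mult_right_mono[of K 1 "(cmod (g z))\<^sup>2"] by auto
    have "4 * (E / (norm z * (M * N (Ln z))))\<^sup>2 \<le> 4 * (norm (deriv g z) / (1 + (norm (g z))\<^sup>2))\<^sup>2"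
      unfolding sph using le E MN by (intro mult_left_mono power_mono) auto
    also have "\<dots> \<le> 4 * (norm (deriv g z) / (1 + K * (cmod (g z))\<^sup>2))\<^sup>2"
      using Kle pos by (intro mult_left_mono power_mono divide_left_mono mult_pos_pos) (auto simp: add_pos_nonneg)
    also have "\<dots> = exp (v z)"
    proof -
      have "4 * (cmod (deriv g z))\<^sup>2 / (1 + K * (cmod (g z))\<^sup>2)\<^sup>2 > 0" using r'(2)[OF zb] pos by simp
      then show ?thesis using r'(4)[OF zb] by (simp add: power_divide)
    qed
    finally have "4 * (E / (norm z * (M * N (Ln z))))\<^sup>2 \<le> exp (v z)" .
    then have "C * (4 * (E / (norm z * (M * N (Ln z))))\<^sup>2) \<le> C * exp (v z)" using C by (rule mult_left_mono)
    moreover have "C * (4 * (E / (norm z * (M * N (Ln z))))\<^sup>2) = (1 / (norm z * N (Ln z)))\<^sup>2"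
      using E M0 by (simp add: C_def power_divide power_mult_distrib)
    ultimately show ?thesis by simp
  qed
  have contN: "continuous_on (Dplus \<epsilon>) (\<lambda>z. (1 / (norm z * N (Ln z)))\<^sup>2)"
  proof -
    have "continuous_on (Dplus \<epsilon>) (\<lambda>z. y1 (Ln z))" "continuous_on (Dplus \<epsilon>) (\<lambda>z. y2 (Ln z))"
      by (intro holomorphic_on_imp_continuous_on holomorphic_Ln_Dplus[OF eps] yh)+
    moreover have "\<forall>z\<in>Dplus \<epsilon>. norm z * ((norm (y1 (Ln z)))\<^sup>2 + (norm (y2 (Ln z)))\<^sup>2) \<noteq> 0"
      using N0[OF Ln_Dplus(3)[OF _ eps]] Ln_Dplus(1)[OF _ eps] unfolding N_def
      by (metis less_irrefl mult_eq_0_iff norm_eq_zero)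
    ultimately show ?thesis unfolding N_def by (intro continuous_intros) auto
  qed
  \<comment> \<open>At the isolated poles of g the estimate follows from continuity of both
    sides.\<close>
  have pw': "(1 / (norm z * N (Ln z)))\<^sup>2 \<le> C * exp (v z)" if z: "z \<in> Dplus \<epsilon>" for z
  proof (rule tendsto_le[of "at z"])
    have c: "continuous_on (Dplus \<epsilon>) (\<lambda>z. C * exp (v z))" by (intro continuous_intros cont)
    show "((\<lambda>z. C * exp (v z)) \<longlongrightarrow> C * exp (v z)) (at z)"
      using c z by (simp add: continuous_on_eq_continuous_at isCont_def)
    show "((\<lambda>z. (1 / (norm z * N (Ln z)))\<^sup>2) \<longlongrightarrow> (1 / (norm z * N (Ln z)))\<^sup>2) (at z)"
      using contN z by (simp add: continuous_on_eq_continuous_at isCont_def)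
    show "\<forall>\<^sub>F w in at z. (1 / (norm w * N (Ln w)))\<^sup>2 \<le> C * exp (v w)"
      using developing_map_eventually_not_pole[OF dev z] by eventually_elim (use pw in auto)
  qed simp
  have "(\<lambda>z. exp (v z)) absolutely_integrable_on Dplus \<epsilon>"
    using fin by (rule nonnegative_absolutely_integrable_1) simp
  then have "integrable lebesgue (\<lambda>z. indicator (Dplus \<epsilon>) z *\<^sub>R exp (v z))" by (simp add: set_integrable_def)
  then have "(\<integral>\<^sup>+z. ennreal (norm (indicator (Dplus \<epsilon>) z *\<^sub>R exp (v z))) \<partial>lebesgue) < \<infinity>"
    by (simp add: integrable_iff_bounded)
  then have f: "(\<integral>\<^sup>+z. ennreal (norm (indicator (Dplus \<epsilon>) z *\<^sub>R exp (v z))) \<partial>lborel) < \<infinity>"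
    by (simp only: nn_integral_completion)
  have m: "(\<lambda>z. ennreal (norm (indicator (Dplus \<epsilon>) z *\<^sub>R exp (v z)))) \<in> borel_measurable lborel"
  proof -
    have "(\<lambda>z. indicator (Dplus \<epsilon>) z *\<^sub>R exp (v z)) \<in> borel_measurable borel"
      using cont by (intro borel_measurable_continuous_on_indicator continuous_intros) auto
    then show ?thesis by simp
  qed
  have "(\<integral>\<^sup>+z\<in>Dplus \<epsilon>. ennreal ((1 / (norm z * N (Ln z)))\<^sup>2) \<partial>lborel) \<le>
      (\<integral>\<^sup>+z. ennreal C * ennreal (norm (indicator (Dplus \<epsilon>) z *\<^sub>R exp (v z))) \<partial>lborel)"
    using pw' C by (intro nn_integral_mono) (auto simp: indicator_def ennreal_mult'[symmetric] intro!: ennreal_leI)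
  also have "\<dots> = ennreal C * (\<integral>\<^sup>+z. ennreal (norm (indicator (Dplus \<epsilon>) z *\<^sub>R exp (v z))) \<partial>lborel)"
    by (rule nn_integral_cmult[OF m])
  also have "\<dots> < \<infinity>" using f by (simp add: ennreal_mult_less_top)
  finally show ?thesis by (simp add: N_def)
qed

text \<open>The limit is the value of a Moebius transformation at 0: finite for nonzero
  \<open>c\<close>, infinity otherwise.\<close>

lemma quotient_limit:
  fixes a b c d :: complex and g h :: "complex \<Rightarrow> complex"
  assumes D: "a * d - b * c \<noteq> 0" and h: "(h \<longlongrightarrow> 0) F"
    and g: "\<forall>\<^sub>F z in F. c + d * h z \<noteq> 0 \<and> g z = (a + b * h z) / (c + d * h z)"
  shows "(\<exists>L. (g \<longlongrightarrow> L) F) \<or> filterlim g at_infinity F"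
proof (cases "c = 0")
  case False
  have "((\<lambda>z. (a + b * h z) / (c + d * h z)) \<longlongrightarrow> (a + b * 0) / (c + d * 0)) F"
    using False by (intro tendsto_intros h) auto
  moreover have "\<forall>\<^sub>F z in F. (a + b * h z) / (c + d * h z) = g z" using g by eventually_elim auto
  ultimately have "(g \<longlongrightarrow> (a + b * 0) / (c + d * 0)) F" by (rule Lim_transform_eventually)
  then show ?thesis by blast
next
  case True
  then have a: "a \<noteq> 0" using D by auto
  have "((\<lambda>z. a + b * h z) \<longlongrightarrow> a + b * 0) F" by (intro tendsto_intros h)
  then have num: "((\<lambda>z. a + b * h z) \<longlongrightarrow> a) F" by simp
  have "((\<lambda>z. c + d * h z) \<longlongrightarrow> c + d * 0) F" by (intro tendsto_intros h)
  moreover have "\<forall>\<^sub>F z in F. c + d * h z \<noteq> 0" using g by eventually_elim simp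
  ultimately have den: "filterlim (\<lambda>z. c + d * h z) (at 0) F" using True by (simp add: filterlim_at)
  have inf: "filterlim (\<lambda>z. (a + b * h z) / (c + d * h z)) at_infinity F"
    by (rule filterlim_divide_at_infinity[OF num den a])
  have "\<forall>\<^sub>F z in F. (a + b * h z) / (c + d * h z) = g z" using g by eventually_elim simp
  from filterlim_cong[OF refl refl this] have "filterlim g at_infinity F" using inf by simp
  then show ?thesis by blast
qed

theorem theorem5p1:
  fixes K c1 c2 \<epsilon> :: real
    and v vs vt vss vst vts vtt :: "complex \<Rightarrow> real"
    and g :: "complex \<Rightarrow> complex"
  assumes K: "K \<in> {-1, 0, 1}"
    and eps: "\<epsilon> > 0"
    and d1: "\<forall>z\<in>Dplus_closed_punct \<epsilon>.
              (v has_derivative (\<lambda>h. Re h * vs z + Im h * vt z)) (at z within Dplus_closed_punct \<epsilon>)"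
    and d2s: "\<forall>z\<in>Dplus_closed_punct \<epsilon>.
              (vs has_derivative (\<lambda>h. Re h * vss z + Im h * vst z)) (at z within Dplus_closed_punct \<epsilon>)"
    and d2t: "\<forall>z\<in>Dplus_closed_punct \<epsilon>.
              (vt has_derivative (\<lambda>h. Re h * vts z + Im h * vtt z)) (at z within Dplus_closed_punct \<epsilon>)"
    and c2: "continuous_on (Dplus_closed_punct \<epsilon>) vss" "continuous_on (Dplus_closed_punct \<epsilon>) vst"
            "continuous_on (Dplus_closed_punct \<epsilon>) vts" "continuous_on (Dplus_closed_punct \<epsilon>) vtt"
    and pde: "\<forall>z\<in>Dplus \<epsilon>. vss z + vtt z + 2 * K * exp (v z) = 0"
    and bc1: "\<forall>s::real. 0 < s \<and> s < \<epsilon> \<longrightarrow> vt (complex_of_real s) = c1 * exp (v (complex_of_real s) / 2)"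
    and bc2: "\<forall>s::real. 0 < - s \<and> - s < \<epsilon> \<longrightarrow> vt (complex_of_real s) = c2 * exp (v (complex_of_real s) / 2)"
    and fin: "(\<lambda>z. exp (v z)) integrable_on Dplus \<epsilon>"
    and dev: "developing_map K (Dplus \<epsilon>) v g"
  shows "(\<exists>\<psi> F. is_mobius \<psi>
            \<and> F nicely_meromorphic_on Dstar \<epsilon>
            \<and> (\<forall>s::real. 0 < \<bar>s\<bar> \<and> \<bar>s\<bar> < \<epsilon> \<longrightarrow> \<not> is_pole F (complex_of_real s)
                   \<longrightarrow> F (complex_of_real s) \<in> \<real>)
            \<and> not_essential F 0
            \<and> ((\<exists>\<gamma>::real. 0 \<le> \<gamma> \<and> \<gamma> < 1 \<and>
                   (\<forall>z\<in>Dplus \<epsilon>. \<forall>\<^sub>F w in at z. g w = \<psi> (w powr complex_of_real \<gamma> * F w)))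
               \<or> (\<forall>z\<in>Dplus \<epsilon>. \<forall>\<^sub>F w in at z. g w = \<psi> (F w + Ln w))))
       \<and> ((\<exists>L. (g \<longlongrightarrow> L) (at 0 within (Dplus \<epsilon> - {z. is_pole g z})))
          \<or> filterlim g at_infinity (at 0 within (Dplus \<epsilon> - {z. is_pole g z})))
       \<and> (\<exists>h. h holomorphic_on ball 0 \<epsilon> \<and>
            (\<forall>z\<in>Dplus \<epsilon>. z\<^sup>2 * schwarzian_map vs vt vss vst vts vtt z = h z))"
proof -
  let ?S = "Dplus_closed_punct \<epsilon>" and ?H = "{\<zeta>. Re \<zeta> < ln \<epsilon>}"
  define Q where "Q = schwarzian_map vs vt vss vst vts vtt"
  define Qe where "Qe z = (if 0 \<le> Im z then Q z else cnj (Q (cnj z)))" for z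
  note refl = schwarzian_map_reflection[OF K d1 d2s d2t c2 bc1 bc2 dev, folded Q_def]
  have Qhol: "Qe holomorphic_on Dstar \<epsilon>" using refl(1) by (simp add: Qe_def[abs_def])
  have Qcnj: "Qe (cnj z) = cnj (Qe z)" if "z \<in> Dstar \<epsilon>" for z
  proof (cases "Im z = 0")
    case True
    then have "z \<in> \<real>" by (simp add: complex_is_Real_iff)
    then show ?thesis using refl(2)[OF that] by (simp add: Qe_def Reals_cnj_iff)
  qed (auto simp: Qe_def)
  have expD: "exp \<zeta> \<in> Dstar \<epsilon>" if "Re \<zeta> < ln \<epsilon>" for \<zeta>
  proof -
    have "exp (Re \<zeta>) < exp (ln \<epsilon>)" using that by simp
    then show ?thesis using eps by (simp add: Dstar_def norm_exp_eq_Re)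
  qed
  \<comment> \<open>In the coordinate log z the Schwarzian of the developing map is z^2 Q - 1/2; the
    coefficient of the linear equation is minus half of it.\<close>
  define R where "R \<zeta> = 1 / 4 - (exp \<zeta>)\<^sup>2 * Qe (exp \<zeta>) / 2" for \<zeta>
  have Rhol: "R holomorphic_on ?H"
  proof -
    have "(\<lambda>\<zeta>. Qe (exp \<zeta>)) holomorphic_on ?H"
      by (rule holomorphic_on_compose_gen[OF _ Qhol, unfolded o_def]) (use expD in \<open>auto intro!: holomorphic_intros\<close>)
    then show ?thesis unfolding R_def by (intro holomorphic_intros) auto
  qed
  have Rcnj: "R (cnj \<zeta>) = cnj (R \<zeta>)" if "Re \<zeta> < ln \<epsilon>" for \<zeta>
    using Qcnj[OF expD[OF that]] by (simp add: R_def exp_cnj)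
  have Rper: "R (\<zeta> + turn) = R \<zeta>" for \<zeta> by (simp add: R_def exp_add)
  obtain y1 y2 a11 a12 a21 a22 where y: "ode_sol R ?H y1" "ode_sol R ?H y2"
    and W: "\<And>\<zeta>. Re \<zeta> < ln \<epsilon> \<Longrightarrow> wronskian y1 y2 \<zeta> = 1"
    and yreal: "\<And>\<zeta>. Re \<zeta> < ln \<epsilon> \<Longrightarrow> y1 (cnj \<zeta>) = cnj (y1 \<zeta>) \<and> y2 (cnj \<zeta>) = cnj (y2 \<zeta>)"
    and ysh: "\<And>\<zeta>. Re \<zeta> < ln \<epsilon> \<Longrightarrow> y1 (\<zeta> + turn) = a11 * y1 \<zeta> + a12 * y2 \<zeta>"
      "\<And>\<zeta>. Re \<zeta> < ln \<epsilon> \<Longrightarrow> y2 (\<zeta> + turn) = a21 * y1 \<zeta> + a22 * y2 \<zeta>"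
    using exists_real_basis[OF Rhol Rcnj Rper] by blast
  have yh: "y1 holomorphic_on ?H" "y2 holomorphic_on ?H" using y by (auto simp: ode_sol_def)
  have Rg: "R \<zeta> = 1 / 4 - (exp \<zeta>)\<^sup>2 *
        (deriv (\<lambda>w. deriv (deriv g) w / deriv g w) (exp \<zeta>) - (deriv (deriv g) (exp \<zeta>) / deriv g (exp \<zeta>))\<^sup>2 / 2) / 2"
    if "exp \<zeta> \<in> Dplus \<epsilon>" "\<not> is_pole g (exp \<zeta>)" for \<zeta>
  proof -
    have "Qe (exp \<zeta>) = Q (exp \<zeta>)" using that(1) by (simp add: Qe_def Dplus_def)
    then show ?thesis unfolding R_def by (simp only: refl(3)[OF that])
  qed
  obtain a b c d where D: "a * d - b * c \<noteq> 0"
    and den: "\<And>z. z \<in> Dplus \<epsilon> \<Longrightarrow> \<not> is_pole g z \<Longrightarrow> c * y1 (Ln z) + d * y2 (Ln z) \<noteq> 0"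
    and quot: "\<And>z. z \<in> Dplus \<epsilon> \<Longrightarrow> \<not> is_pole g z \<Longrightarrow> g z * (c * y1 (Ln z) + d * y2 (Ln z)) = a * y1 (Ln z) + b * y2 (Ln z)"
    by (rule developing_map_quotient[where R = R and ?y1.0 = y1 and ?y2.0 = y2, OF eps K dev Rg y W]) (assumption | blast)+
  have contv: "continuous_on (Dplus \<epsilon>) v"
  proof (rule continuous_on_subset[OF _ Dplus_subset_closed_punct])
    show "continuous_on ?S v"
      by (rule has_derivative_continuous_on[where f' = "\<lambda>z h. Re h * vs z + Im h * vt z"]) (use d1 in blast)
  qed
  note area = spherical_area_finite[OF eps K dev contv fin yh W D den quot]
  have bl: "blowup y1 y2"
    unfolding blowup_def
  proof
    fix M
    \<comment> \<open>The summand 1 ensures \<open>C \<ge> 1\<close>; the rest is the squared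
      Frobenius norm of the matrix of a turn.\<close>
    let ?C = "1 + ((norm a11)\<^sup>2 + (norm a12)\<^sup>2 + (norm a21)\<^sup>2 + (norm a22)\<^sup>2)"
    have "\<exists>X\<le>ln \<epsilon>. \<forall>\<zeta>. Re \<zeta> < X \<and> - pi \<le> Im \<zeta> \<and> Im \<zeta> \<le> 3 * pi \<longrightarrow> M \<le> (norm (y1 \<zeta>))\<^sup>2 + (norm (y2 \<zeta>))\<^sup>2"
    proof (rule finite_area_imp_large_norm[where C = ?C, OF eps yh W _ _ _ area])
      fix \<zeta> assume z: "Re \<zeta> < ln \<epsilon>"
      show "(norm (y1 (cnj \<zeta>)))\<^sup>2 + (norm (y2 (cnj \<zeta>)))\<^sup>2 = (norm (y1 \<zeta>))\<^sup>2 + (norm (y2 \<zeta>))\<^sup>2"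
        using yreal[OF z] by simp
      let ?N = "(norm (y1 \<zeta>))\<^sup>2 + (norm (y2 \<zeta>))\<^sup>2"
      have "(norm (y1 (\<zeta> + turn)))\<^sup>2 + (norm (y2 (\<zeta> + turn)))\<^sup>2 \<le>
          ((norm a11)\<^sup>2 + (norm a12)\<^sup>2) * ?N + ((norm a21)\<^sup>2 + (norm a22)\<^sup>2) * ?N"
        unfolding ysh[OF z] by (intro add_mono norm_lincomb_square_le)
      also have "\<dots> = (?C - 1) * ?N" by (simp add: algebra_simps)
      also have "\<dots> \<le> ?C * ?N" by (intro mult_right_mono) auto
      finally show "(norm (y1 (\<zeta> + 2 * of_real pi * \<i>)))\<^sup>2 + (norm (y2 (\<zeta> + 2 * of_real pi * \<i>)))\<^sup>2 \<le> ?C * ?N"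
        by (simp only: turn_def)
    qed auto
    then show "\<exists>X. \<forall>\<zeta>\<in>left_strip X. M \<le> (norm (y1 \<zeta>))\<^sup>2 + (norm (y2 \<zeta>))\<^sup>2"
      unfolding left_strip_def by blast
  qed
  obtain p q r s k \<mu> \<tau> where
    mf: "monodromy_form (ln \<epsilon>) (\<lambda>z. p * y1 z + q * y2 z) (\<lambda>z. r * y1 z + s * y2 z) k \<mu> \<tau>" and det: "p * s - q * r \<noteq> 0"
    using exists_monodromy_form[OF yh W yreal bl ysh] by blast
  define u' v' where "u' z = p * y1 z + q * y2 z" and "v' z = r * y1 z + s * y2 z" for z
  have mf: "monodromy_form (ln \<epsilon>) u' v' k \<mu> \<tau>" using mf by (simp add: u'_def[abs_def] v'_def[abs_def])
  \<comment> \<open>The coefficients of g in terms of \<open>u'\<close> and \<open>v'\<close>, up to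
    the determinant \<open>p * s - q * r\<close>, which cancels in the quotient.\<close>
  define A B C E where "A = a * s - b * r" and "B = b * p - a * q" and "C = c * s - d * r" and "E = d * p - c * q"
  have AE: "A * E - B * C \<noteq> 0"
  proof -
    have "A * E - B * C = (a * d - b * c) * (p * s - q * r)" by (simp add: A_def B_def C_def E_def algebra_simps)
    then show ?thesis using D det by simp
  qed
  have lin: "A * u' z + B * v' z = (p * s - q * r) * (a * y1 z + b * y2 z)"
    "C * u' z + E * v' z = (p * s - q * r) * (c * y1 z + d * y2 z)" for z
    by (simp_all add: A_def B_def C_def E_def u'_def v'_def algebra_simps)
  have geq: "C * u' (Ln z) + E * v' (Ln z) \<noteq> 0" "g z = (A * u' (Ln z) + B * v' (Ln z)) / (C * u' (Ln z) + E * v' (Ln z))"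
    if "z \<in> Dplus \<epsilon>" "\<not> is_pole g z" for z
    unfolding lin using den[OF that] quot[OF that] det by (simp_all add: divide_simps)
  \<comment> \<open>The argument of \<open>\<mu>^2\<close> in [0, 2 pi), measured in turns, whence
    the range [0, 1).\<close>
  define \<gamma> where "\<gamma> = Arg2pi (\<mu>\<^sup>2) / (2 * pi)"
  have \<gamma>: "0 \<le> \<gamma>" "\<gamma> < 1" using Arg2pi[of "\<mu>\<^sup>2"] pi_gt3 by (auto simp: \<gamma>_def)
  have \<gamma>exp: "exp (of_real \<gamma> * turn) = \<mu>\<^sup>2"
  proof -
    have "of_real \<gamma> * turn = \<i> * of_real (Arg2pi (\<mu>\<^sup>2))" by (simp add: \<gamma>_def turn_def)
    then show ?thesis using Arg2pi_eq[of "\<mu>\<^sup>2"] mf_norm[OF mf] by (simp add: norm_power)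
  qed
  define F where "F = remove_sings (\<lambda>z. sv_num \<tau> u' v' (Ln z) / sv_den \<gamma> v' (Ln z))"
  note svF = sv_quotient[OF mf eps \<gamma>(1) \<gamma>exp, folded F_def]
  define \<psi> where "\<psi> = mobius A B C E"
  have g\<psi>: "\<forall>\<^sub>F w in at z. g w = \<psi> (if \<tau> = 0 then w powr of_real \<gamma> * F w else F w + Ln w)" if z: "z \<in> Dplus \<epsilon>" for z
    using svF(4)[OF z] developing_map_eventually_not_pole[OF dev z]
  proof eventually_elim
    case (elim w)
    define f where "f = u' (Ln w) / v' (Ln w)"
    have w0: "w \<noteq> 0" using Ln_Dplus(1)[of w \<epsilon>] elim eps by simp
    have v0: "v' (Ln w) \<noteq> 0" using elim by simp
    have "f = (if \<tau> = 0 then w powr of_real \<gamma> * F w else F w + Ln w)"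
    proof (cases "\<tau> = 0")
      case True
      then show ?thesis using elim w0 by (simp add: f_def powr_def)
    next
      case False
      \<comment> \<open>In the parabolic case \<open>\<mu>\<close> is 1 or -1, so the exponent is 0
        and the exponential factor disappears.\<close>
      then have "cnj \<mu> = \<mu>" using mf_cases[OF mf] by auto
      then have "\<mu>\<^sup>2 = 1" using mu_cnj(1)[OF mf eps \<gamma>(1) \<gamma>exp] by (simp add: power2_eq_square)
      then have "\<gamma> = 0" by (simp add: \<gamma>_def Arg2pi_eq_0)
      then show ?thesis using elim False by (simp add: f_def)
    qed
    moreover have "g w = \<psi> f"
    proof -
      have fv: "u' (Ln w) = f * v' (Ln w)" using v0 by (simp add: f_def)
      have "g w = (A * (f * v' (Ln w)) + B * v' (Ln w)) / (C * (f * v' (Ln w)) + E * v' (Ln w))"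
        using geq(2)[of w] elim(2) unfolding fv by blast
      then have "g w = ((A * f + B) * v' (Ln w)) / ((C * f + E) * v' (Ln w))"
        by (simp add: distrib_right mult.assoc)
      then show ?thesis using v0 by (simp add: \<psi>_def mobius_def)
    qed
    ultimately show ?case by simp
  qed
  have part1: "\<exists>\<psi> F. is_mobius \<psi>
            \<and> F nicely_meromorphic_on Dstar \<epsilon>
            \<and> (\<forall>s::real. 0 < \<bar>s\<bar> \<and> \<bar>s\<bar> < \<epsilon> \<longrightarrow> \<not> is_pole F (complex_of_real s)
                   \<longrightarrow> F (complex_of_real s) \<in> \<real>)
            \<and> not_essential F 0
            \<and> ((\<exists>\<gamma>::real. 0 \<le> \<gamma> \<and> \<gamma> < 1 \<and>
                   (\<forall>z\<in>Dplus \<epsilon>. \<forall>\<^sub>F w in at z. g w = \<psi> (w powr complex_of_real \<gamma> * F w)))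
               \<or> (\<forall>z\<in>Dplus \<epsilon>. \<forall>\<^sub>F w in at z. g w = \<psi> (F w + Ln w)))"
  proof (intro exI conjI)
    show "is_mobius \<psi>" using AE by (auto simp: is_mobius_def \<psi>_def)
    show "F nicely_meromorphic_on Dstar \<epsilon>" "not_essential F 0" by (rule svF)+
    show "\<forall>s::real. 0 < \<bar>s\<bar> \<and> \<bar>s\<bar> < \<epsilon> \<longrightarrow> \<not> is_pole F (complex_of_real s) \<longrightarrow> F (complex_of_real s) \<in> \<real>"
      using svF(2) by blast
    show "(\<exists>\<gamma>::real. 0 \<le> \<gamma> \<and> \<gamma> < 1 \<and>
                   (\<forall>z\<in>Dplus \<epsilon>. \<forall>\<^sub>F w in at z. g w = \<psi> (w powr complex_of_real \<gamma> * F w)))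
               \<or> (\<forall>z\<in>Dplus \<epsilon>. \<forall>\<^sub>F w in at z. g w = \<psi> (F w + Ln w))"
    proof (cases "\<tau> = 0")
      case True
      then have "\<forall>z\<in>Dplus \<epsilon>. \<forall>\<^sub>F w in at z. g w = \<psi> (w powr complex_of_real \<gamma> * F w)" using g\<psi> by simp
      then show ?thesis using \<gamma> by blast
    next
      case False
      then show ?thesis using g\<psi> by simp
    qed
  qed
  let ?F = "at 0 within (Dplus \<epsilon> - {z. is_pole g z})"
  have near0: "\<forall>\<^sub>F z in ?F. Ln z \<in> left_strip X \<and> z \<in> Dplus \<epsilon> \<and> \<not> is_pole g z" for X
  proof -
    have "\<forall>\<^sub>F z in at (0::complex). z \<in> ball 0 (exp X) - {0}" by (intro eventually_at_in_open) auto
    then have "\<forall>\<^sub>F z in ?F. z \<in> ball 0 (exp X) - {0}" by (rule filter_leD[OF at_le, rotated]) simp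
    moreover have "\<forall>\<^sub>F z in ?F. z \<in> Dplus \<epsilon> - {z. is_pole g z}" by (simp add: eventually_at_filter)
    ultimately show ?thesis
    proof eventually_elim
      case (elim z)
      then have zD: "z \<in> Dplus \<epsilon>" by simp
      have "Re (Ln z) < X" using elim ln_less_cancel_iff[of "norm z" "exp X"] by simp
      then show ?case using Ln_Dplus[OF zD eps] elim by (auto simp: left_strip_def)
    qed
  qed
  \<comment> \<open>For the limit at the puncture g is expressed through the reciprocal quotient,
    which tends to 0.\<close>
  define h where "h z = v' (Ln z) / u' (Ln z)" for z
  have u0: "\<forall>\<^sub>F z in ?F. u' (Ln z) \<noteq> 0 \<and> norm (h z) \<le> \<eta>" if \<eta>: "\<eta> > 0" for \<eta>
  proof -
    obtain X where X: "X \<le> ln \<epsilon>" "\<And>\<zeta>. \<zeta> \<in> left_strip X \<Longrightarrow> norm (v' \<zeta>) \<le> \<eta> * norm (u' \<zeta>)"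
      using ratio_small[OF mf \<eta>] by blast
    show ?thesis using near0[of X]
    proof eventually_elim
      case (elim z)
      then have le: "norm (v' (Ln z)) \<le> \<eta> * norm (u' (Ln z))" using X(2) by blast
      then have "u' (Ln z) \<noteq> 0" using mf_nonzero[OF mf Ln_Dplus(3)[of z \<epsilon>]] elim eps by auto
      then show ?case using le by (simp add: h_def norm_divide divide_simps)
    qed
  qed
  have hlim: "(h \<longlongrightarrow> 0) ?F"
  proof (rule tendstoI)
    fix e :: real assume "e > 0"
    then have "\<forall>\<^sub>F z in ?F. norm (h z) \<le> e / 2" using u0[of "e / 2"] by (auto elim: eventually_mono)
    then show "\<forall>\<^sub>F z in ?F. dist (h z) 0 < e" by eventually_elim (use \<open>e > 0\<close> in simp)
  qed
  have part2: "(\<exists>L. (g \<longlongrightarrow> L) ?F) \<or> filterlim g at_infinity ?F"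
  proof (rule quotient_limit[OF AE hlim])
    show "\<forall>\<^sub>F z in ?F. C + E * h z \<noteq> 0 \<and> g z = (A + B * h z) / (C + E * h z)"
      using near0[of 0] u0[OF zero_less_one]
    proof eventually_elim
      case (elim z)
      have e: "C + E * h z = (C * u' (Ln z) + E * v' (Ln z)) / u' (Ln z)" "A + B * h z = (A * u' (Ln z) + B * v' (Ln z)) / u' (Ln z)"
        using elim by (simp_all add: h_def field_simps)
      show ?case unfolding e using geq[of z] elim by simp
    qed
  qed
  have part3: "\<exists>h. h holomorphic_on ball 0 \<epsilon> \<and> (\<forall>z\<in>Dplus \<epsilon>. z\<^sup>2 * schwarzian_map vs vt vss vst vts vtt z = h z)"
  proof -
    have Dst: "Dstar \<epsilon> = ball 0 \<epsilon> - {0}" by (auto simp: Dstar_def)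
    \<comment> \<open>As a solution without zeros near the puncture \<open>v'\<close> bounds R, and
      z^2 Q = 1/2 - 2 R; Riemann's theorem extends this function across 0.\<close>
    have "ode_sol R ?H v'" unfolding v'_def[abs_def] by (rule ode_sol_lincomb[OF open_halfspace_Re_lt y])
    from ode_coefficient_bounded[OF mf eps \<gamma>(1) \<gamma>exp this]
    obtain M X where M: "\<And>\<zeta>. Re \<zeta> < X \<Longrightarrow> norm (R \<zeta>) \<le> M" by blast
    have "\<forall>\<^sub>F z in at 0. z \<in> ball 0 (exp X) - {0::complex}" by (intro eventually_at_in_open) auto
    then have "\<forall>\<^sub>F z in at 0. norm (z\<^sup>2 * Qe z) \<le> 1 / 2 + 2 * M"
    proof eventually_elim
      case (elim z)
      then have "Re (Ln z) < X" using ln_less_cancel_iff[of "norm z" "exp X"] by simp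
      moreover have "z\<^sup>2 * Qe z = 1 / 2 - 2 * R (Ln z)" using elim by (simp add: R_def)
      moreover have "norm (1 / 2 - 2 * R (Ln z)) \<le> 1 / 2 + 2 * norm (R (Ln z))"
        using norm_triangle_ineq4[of "1 / 2" "2 * R (Ln z)"] by (simp add: norm_mult)
      ultimately show ?case using M[of "Ln z"] by simp
    qed
    moreover have "(\<lambda>z. z\<^sup>2 * Qe z) holomorphic_on ball 0 \<epsilon> - {0}" using Qhol Dst by (intro holomorphic_intros) auto
    ultimately obtain h where h: "h holomorphic_on ball 0 \<epsilon>" "\<And>z. z \<in> ball 0 \<epsilon> - {0} \<Longrightarrow> h z = z\<^sup>2 * Qe z"
      using holomorphic_on_extend_bounded[of "\<lambda>z. z\<^sup>2 * Qe z" "ball 0 \<epsilon>" 0] eps by (auto simp: interior_open)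
    have "z\<^sup>2 * schwarzian_map vs vt vss vst vts vtt z = h z" if z: "z \<in> Dplus \<epsilon>" for z
      using h(2)[of z] z Ln_Dplus(1)[OF z eps] by (simp add: Dplus_def Qe_def Q_def)
    then show ?thesis using h(1) by blast
  qed
  show ?thesis by (intro conjI part1 part2 part3)
qed

end
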